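(* Let $m,d\in\mathbb{Z}_{>0}$ with $m<d$, let $M_1:=\partial([0,1]^2)\subset\mathbb{R}^2$, let $M_2\subset\mathbb{R}^{d-2}$ be an arbitrary $(m-1)$-dimensional closed submanifold, and let $M:=M_1\times M_2\subset\mathbb{R}^2\times\mathbb{R}^{d-2}=\mathbb{R}^d$. Let $\alpha\in\mathbb{R}$ and let $F_\alpha$, $L_\epsilon$, $\sigma$ be as defined in the context. Then for any $p\in(1,\infty)$, $$\lim_{\epsilon\to0}\int_M\left|L_\epsilon F_\alpha-\frac12\sigma\Delta F_\alpha\right|^p\,d\mathrm{Vol}_M=\infty,$$ and $$\lim_{\epsilon\to0}\int_M\left|L_\epsilon F_\alpha-\frac12\sigma\Delta F_\alpha\right|\,d\mathrm{Vol}_M=2\pi(|\sin\alpha|+|\cos\alpha|)\,\mathrm{Vol}(M_2)\,\mathrm{Vol}(B^{\mathbb{R}^{m-1}}(0,1))\int_0^1|h_m(t)|\,dt\neq0,$$ where $h_m\colon[0,1]\to\mathbb{R}$ is the non-constant function defined by $$h_m(t)=\int_t^1s(1-s^2)^{(m-1)/2}\,ds-\int_0^{(1-t^2)^{1/2}}(s+t)(1-s^2-t^2)^{(m-1)/2}\,ds.$$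
   Context: Parametrize $M_1=\partial([0,1]^2)$ by $\phi\colon S^1\to M_1$, $$\phi(\cos\theta,\sin\theta)=\begin{cases}(\tfrac2\pi\theta,0)&0\le\theta\le\tfrac\pi2,\\(1,\tfrac2\pi\theta-1)&\tfrac\pi2\le\theta\le\pi,\\(3-\tfrac2\pi\theta,1)&\pi\le\theta\le\tfrac32\pi,\\(0,4-\tfrac2\pi\theta)&\tfrac32\pi\le\theta\le2\pi.\end{cases}$$ $\phi\colon(S^1,d_{S^1})\to(M_1,\frac\pi2d_{M_1})$ is an isometry for the intrinsic distances; thus $M_1$ with its intrinsic distance is a circle of length $4$, and $M=M_1\times M_2$ with its intrinsic (product) distance is isometric to a smooth Riemannian manifold. $\mathrm{Vol}_M$ and $dz$ denote its Riemannian volume measure, and $\Delta=-\mathrm{tr}\,\mathrm{Hess}$ its Laplacian (for this smooth structure). For $\alpha\in\mathbb{R}$, $f_\alpha\colon S^1\to\mathbb{R}$, $f_\alpha(\cos\theta,\sin\theta)=\sin(\theta-\alpha)$, and $F_\alpha\colon M_1\times M_2\to\mathbb{R}$, $F_\alpha(x,y)=f_\alpha(\phi^{-1}(x))$, a smooth eigenfunction of $\Delta$ on $M$. For $\epsilon>0$ and $h\in L^2(M)$, $$L_\epsilon h(z_0):=\frac1{\epsilon^{m+2}}\int_{B^{\mathbb{R}^d}(z_0,\epsilon)\cap M}(h(z_0)-h(z))\,dz\quad(z_0\in M),$$ where $B^{\mathbb{R}^d}(z_0,\epsilon)$ is the open Euclidean ball. Put $\sigma:=\frac{\mathrm{Vol}(S^{m-1})}{m(m+2)}=\frac{\mathrm{Vol}(B^{\mathbb{R}^m}(0,1))}{m+2}$.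 Closed means compact, connected, without boundary. When $m=1$, $M_2$ is a point with $\mathrm{Vol}(M_2)=1$ and $\mathrm{Vol}(B^{\mathbb{R}^0}(0,1))=1$. *)

theory Defs
  imports "HOL-Analysis.Analysis"
begin

text \<open>Embedded smooth submanifolds of a Euclidean space.\<close>

primrec Ck_on :: "nat \<Rightarrow> 'a::euclidean_space set \<Rightarrow> ('a \<Rightarrow> 'b::euclidean_space) \<Rightarrow> bool" where
  "Ck_on 0 U f \<longleftrightarrow> continuous_on U f"
| "Ck_on (Suc n) U f \<longleftrightarrow> (\<forall>x\<in>U. f differentiable (at x)) \<and>
     (\<forall>v. Ck_on n U (\<lambda>x. frechet_derivative f (at x) v))"

text \<open>Only used for open \<open>U\<close>.\<close>
definition smooth_on :: "'a::euclidean_space set \<Rightarrow> ('a \<Rightarrow> 'b::euclidean_space) \<Rightarrow> bool" where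
  "smooth_on U f \<longleftrightarrow> (\<forall>n. Ck_on n U f)"

text \<open>A diffeomorphism \<open>\<Phi> : U \<rightarrow> W\<close> of open sets of the ambient space, with inverse \<open>\<Psi>\<close>, which
  flattens \<open>S\<close> to the \<open>k\<close>-dimensional coordinate subspace \<open>span B\<close>. Coordinate subspaces stand in
  for \<open>\<real>\<^sup>k\<close> because this includes \<open>k = 0\<close>.\<close>
definition slice_chart ::
  "nat \<Rightarrow> 'a::euclidean_space set \<Rightarrow> 'a set \<Rightarrow> 'a set \<Rightarrow> ('a \<Rightarrow> 'a) \<Rightarrow> ('a \<Rightarrow> 'a) \<Rightarrow> 'a set \<Rightarrow> bool" where
  "slice_chart k S U W \<Phi> \<Psi> B \<longleftrightarrow>
     open U \<and> open W \<and> homeomorphism U W \<Phi> \<Psi> \<and> smooth_on U \<Phi> \<and> smooth_on W \<Psi> \<and>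
     B \<subseteq> Basis \<and> card B = k \<and> \<Phi> ` (S \<inter> U) = span B \<inter> W"

definition smooth_submanifold :: "nat \<Rightarrow> 'a::euclidean_space set \<Rightarrow> bool" where
  "smooth_submanifold k S \<longleftrightarrow> (\<forall>p\<in>S. \<exists>U W \<Phi> \<Psi> B. p \<in> U \<and> slice_chart k S U W \<Phi> \<Psi> B)"

text \<open>A Euclidean space type has positive dimension. Hence \<open>\<real>\<^sup>n\<close> with \<open>n \<ge> 0\<close> is rendered below as an
  \<open>n\<close>-dimensional linear subspace \<open>V\<close> of such a type; a subset of \<open>V\<close> is a submanifold of \<open>V\<close> iff it
  is one of the whole space.\<close>
definition closed_submanifold :: "nat \<Rightarrow> 'a::euclidean_space set \<Rightarrow> bool" where
  "closed_submanifold k S \<longleftrightarrow> smooth_submanifold k S \<and> compact S \<and> connected S \<and> S \<noteq> {}"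

text \<open>The Riemannian volume measure of the metric induced from the ambient space.\<close>

text \<open>\<open>card B\<close>-dimensional Lebesgue measure, carried by \<open>span B\<close>; this is \<open>lborel\<close> for
  \<open>B = Basis\<close> and the unit mass at \<open>0\<close> for \<open>B = {}\<close>.\<close>
definition coord_lborel :: "'a::euclidean_space set \<Rightarrow> 'a measure" where
  "coord_lborel B = distr (\<Pi>\<^sub>M b\<in>B. (lborel :: real measure)) borel (\<lambda>f. \<Sum>b\<in>B. f b *\<^sub>R b)"

text \<open>\<open>det (g\<^sub>b\<^sub>c)\<close> for the metric coefficients \<open>g\<^sub>b\<^sub>c = \<langle>\<partial>\<^sub>b\<Psi>, \<partial>\<^sub>c\<Psi>\<rangle>\<close>, \<open>b, c \<in> B\<close>, by the Leibniz formula: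
  \<open>det\<close> is only available for matrices indexed by a type.\<close>
definition gram_det ::
  "'a::euclidean_space set \<Rightarrow> ('a \<Rightarrow> 'a) \<Rightarrow> 'a \<Rightarrow> real" where
  "gram_det B \<Psi> x = (\<Sum>\<pi> | \<pi> permutes B. of_int (sign \<pi>) *
     (\<Prod>b\<in>B. frechet_derivative \<Psi> (at x) b \<bullet> frechet_derivative \<Psi> (at x) (\<pi> b)))"

text \<open>The unique Borel measure on \<open>S\<close> given by \<open>\<surd>(det g) dx\<close> in every chart.\<close>
definition riemannian_volume :: "nat \<Rightarrow> 'a::euclidean_space set \<Rightarrow> 'a measure" where
  "riemannian_volume k S = (THE \<mu>. sets \<mu> = sets (restrict_space borel S) \<and>
     (\<forall>U W \<Phi> \<Psi> B A. slice_chart k S U W \<Phi> \<Psi> B \<longrightarrow> A \<in> sets borel \<longrightarrow> A \<subseteq> S \<inter> U \<longrightarrow>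
        emeasure \<mu> A =
          (\<integral>\<^sup>+ x. ennreal (sqrt (gram_det B \<Psi> x)) * indicator {x \<in> span B \<inter> W. \<Psi> x \<in> A} x
             \<partial>coord_lborel B)))"

text \<open>Gradient, Hessian and Laplacian of the induced metric. The Levi-Civita connection of \<open>S\<close> is
  the tangential part of the ambient derivative, so \<open>Hess f(u, v) = \<langle>D\<^sub>u(grad f), v\<rangle>\<close> for tangent
  vectors \<open>u, v\<close>. A derivative at \<open>p\<close> within \<open>S\<close> is determined only on tangent vectors, and it is
  only evaluated there.\<close>

definition tangent_space :: "'a::euclidean_space set \<Rightarrow> 'a \<Rightarrow> 'a set" where
  "tangent_space S p =
     {v. \<exists>\<gamma> e. e > 0 \<and> \<gamma> 0 = p \<and> \<gamma> ` {-e<..<e} \<subseteq> S \<and> (\<gamma> has_vector_derivative v) (at (0::real))}"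

definition grad_on :: "'a::euclidean_space set \<Rightarrow> ('a \<Rightarrow> real) \<Rightarrow> 'a \<Rightarrow> 'a" where
  "grad_on S f p = (THE v. v \<in> tangent_space S p \<and> (f has_derivative (\<lambda>h. v \<bullet> h)) (at p within S))"

definition hess_on :: "'a::euclidean_space set \<Rightarrow> ('a \<Rightarrow> real) \<Rightarrow> 'a \<Rightarrow> 'a \<Rightarrow> 'a \<Rightarrow> real" where
  "hess_on S f p u v = (SOME D. (grad_on S f has_derivative D) (at p within S)) u \<bullet> v"

definition laplacian_on :: "'a::euclidean_space set \<Rightarrow> ('a \<Rightarrow> real) \<Rightarrow> 'a \<Rightarrow> real" where
  "laplacian_on S f p =
     - (\<Sum>b\<in>(SOME E. pairwise orthogonal E \<and> (\<forall>b\<in>E. norm b = 1) \<and> span E = tangent_space S p).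
          hess_on S f p b b)"

text \<open>The boundary of the square. The unit circle is taken in \<open>\<complex> = \<real>\<^sup>2\<close>; \<open>Arg2pi\<close> is the
  angle in \<open>[0, 2\<pi>)\<close>.\<close>

definition M1 :: "(real \<times> real) set" where
  "M1 = frontier ({0..1} \<times> {0..1})"

definition phi :: "complex \<Rightarrow> real \<times> real" where
  "phi z = (let \<theta> = Arg2pi z in
     if \<theta> \<le> pi / 2 then (2 / pi * \<theta>, 0)
     else if \<theta> \<le> pi then (1, 2 / pi * \<theta> - 1)
     else if \<theta> \<le> 3 / 2 * pi then (3 - 2 / pi * \<theta>, 1)
     else (0, 4 - 2 / pi * \<theta>))"

definition phi_inv :: "real \<times> real \<Rightarrow> complex" where
  "phi_inv = inv_into (sphere 0 1) phi"

definition f_alpha :: "real \<Rightarrow> complex \<Rightarrow> real" where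
  "f_alpha \<alpha> z = sin (Arg2pi z - \<alpha>)"

definition F_alpha :: "real \<Rightarrow> (real \<times> real) \<times> 'a \<Rightarrow> real" where
  "F_alpha \<alpha> = (\<lambda>(x, y). f_alpha \<alpha> (phi_inv x))"

text \<open>Arc length on \<open>M1\<close>: \<open>t \<mapsto> phi (cis (\<pi>t/2))\<close>, \<open>0 \<le> t < 4\<close>, has unit speed.\<close>
definition vol_M1 :: "(real \<times> real) measure" where
  "vol_M1 = distr (restrict_space lborel {0..<4::real}) (restrict_space borel M1)
     (\<lambda>t. phi (cis (pi / 2 * t)))"

text \<open>The volume of the product metric on \<open>M1 \<times> S\<close>, for \<open>S\<close> of dimension \<open>m - 1\<close>.\<close>
definition vol_M :: "nat \<Rightarrow> 'a::euclidean_space set \<Rightarrow> ((real \<times> real) \<times> 'a) measure" where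
  "vol_M m S = vol_M1 \<Otimes>\<^sub>M riemannian_volume (m - 1) S"

text \<open>With the intrinsic distances, \<open>(w, y) \<mapsto> (phi (\<pi>w/2), y)\<close> is an isometry of
  \<open>sphere 0 (2/\<pi>) \<times> S\<close>, a smooth submanifold of \<open>\<complex> \<times> 'a\<close>, onto \<open>M1 \<times> S\<close>. The smooth structure
  and the metric of \<open>M1 \<times> S\<close>, hence its Laplacian, are transported along this map.\<close>
definition laplacian_M ::
  "'a::euclidean_space set \<Rightarrow> ((real \<times> real) \<times> 'a \<Rightarrow> real) \<Rightarrow> (real \<times> real) \<times> 'a \<Rightarrow> real" where
  "laplacian_M S F = (\<lambda>(x, y).
     laplacian_on (sphere (0::complex) (2 / pi) \<times> S)
       (\<lambda>(w, y'). F (phi ((pi / 2) *\<^sub>R w), y')) ((2 / pi) *\<^sub>R phi_inv x, y))"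

text \<open>\<open>vol_M m S\<close> lives on \<open>M1 \<times> S\<close>, so the domain of integration is the intersection of the
  Euclidean ball with \<open>M1 \<times> S\<close>.\<close>
definition L_eps ::
  "nat \<Rightarrow> 'a::euclidean_space set \<Rightarrow> real \<Rightarrow> ((real \<times> real) \<times> 'a \<Rightarrow> real) \<Rightarrow>
     (real \<times> real) \<times> 'a \<Rightarrow> real" where
  "L_eps m S \<epsilon> h z0 = 1 / \<epsilon> ^ (m + 2) *
     (LINT z : ball z0 \<epsilon> \<inter> M1 \<times> S | vol_M m S. h z0 - h z)"

definition sigma_m :: "nat \<Rightarrow> real" where
  "sigma_m m = unit_ball_vol (real m) / (real m + 2)"

text \<open>\<open>x\<^bsup>(m-1)/2\<^esup>\<close> is written \<open>(\<surd>x)\<^bsup>m-1\<^esup>\<close>.\<close>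
definition h_fun :: "nat \<Rightarrow> real \<Rightarrow> real" where
  "h_fun m t =
     integral {t..1} (\<lambda>s. s * sqrt (1 - s\<^sup>2) ^ (m - 1)) -
     integral {0..sqrt (1 - t\<^sup>2)} (\<lambda>s. (s + t) * sqrt (1 - s\<^sup>2 - t\<^sup>2) ^ (m - 1))"

end

theory Submission
  imports Defs
begin

text \<open>
  Let \<open>k = m - 1\<close>, let \<open>\<omega>\<close> be the volume of the unit ball of \<open>\<real>\<^sup>k\<close>, and let \<open>t\<close> be the arc
  length on the boundary of the square, so that \<open>F_alpha \<alpha>\<close> is the function \<open>sin (\<pi> t / 2 - \<alpha>)\<close>.

  At distance at least \<open>\<epsilon>\<close> from the corners, the ball meets only one side of the square and is symmetric
  about its centre. The first order terms of \<open>F z0 - F z\<close> therefore cancel in \<open>L_eps\<close>, and the second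
  order terms give \<open>1/2 \<sigma> \<Delta>F\<close> up to an error that tends to \<open>0\<close> uniformly
  (\<open>corner_int_flat\<close>). At distance \<open>\<epsilon> \<tau> < \<epsilon>\<close> from a corner \<open>c\<close> the symmetry fails, the first order term
  survives, and \<open>L_eps F\<close> is \<open>\<mp> \<omega> F'(c) h(\<tau>) / \<epsilon>\<close> up to an error that is small compared with \<open>1 / \<epsilon>\<close>
  (\<open>corner_int_corner\<close>). The corner strips have width \<open>2 \<epsilon>\<close>, so they contribute to the \<open>L\<^sup>1\<close> norm the
  same positive amount for every \<open>\<epsilon>\<close>; this is the limit. For \<open>p > 1\<close> the same strips make the \<open>p\<close>-th
  power blow up, because \<open>\<bar>x\<bar>\<^sup>p \<ge> K\<^sup>p\<^sup>-\<^sup>1 (\<bar>x\<bar> - K)\<close> for every \<open>K > 0\<close> and the strips lose all their measure: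
  the integral is eventually larger than a fixed multiple of \<open>K\<^sup>p\<^sup>-\<^sup>1\<close>. The comparison with the explicit
  model near the corners is \<open>defect_near_model\<close>, and both limits follow from \<open>norm_estimates\<close>.

  The second factor enters only through the volume of its intersection with small balls, which is
  \<open>\<omega> r\<^sup>k (1 + o(1))\<close> uniformly in the centre (\<open>riemannian_volume_density\<close>). In a chart this is the volume
  \<open>\<omega> r\<^sup>k / \<surd>det g\<close> of an ellipsoid (\<open>ellipsoid_volume\<close>). The same density shows that the Riemannian volume
  is well defined, in place of a change of variables between charts: measures with equal
  density on small balls are equal, by Fatou's lemma and Tonelli's theorem (\<open>uniform_density_le\<close>), so the
  chart measures agree on overlaps and can be glued (\<open>ex1_volume\<close>).

  The function \<open>h\<close> is explicit, \<open>h(t) = - c t (1 - t\<^sup>2)\<^sup>m\<^sup>/\<^sup>2\<close> with \<open>c > 0\<close> (\<open>h_fun_explicit\<close>): the first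
  moments of the two sides of the corner are equal, and only the term with the factor \<open>t\<close> remains.
\<close>

section \<open>Gram determinants and volumes of ellipsoids\<close>

text \<open>The index set is a parameter because the dimension changes in the inductions below.\<close>
definition set_det :: "'i set \<Rightarrow> ('i \<Rightarrow> 'i \<Rightarrow> real) \<Rightarrow> real" where
  "set_det I A = (\<Sum>\<pi> | \<pi> permutes I. of_int (sign \<pi>) * (\<Prod>i\<in>I. A i (\<pi> i)))"

lemma set_det_row:
  assumes "finite I" "i \<in> I"
  shows "set_det I (A(i := R)) =
    (\<Sum>\<pi> | \<pi> permutes I. of_int (sign \<pi>) * (\<Prod>j\<in>I - {i}. A j (\<pi> j)) * R (\<pi> i))"
  unfolding set_det_def
proof (rule sum.cong[OF refl])
  fix \<pi>
  have "(\<Prod>j\<in>I. (A(i := R)) j (\<pi> j)) = R (\<pi> i) * (\<Prod>j\<in>I - {i}. (A(i := R)) j (\<pi> j))"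
    using assms by (subst prod.remove[of I i]) auto
  also have "(\<Prod>j\<in>I - {i}. (A(i := R)) j (\<pi> j)) = (\<Prod>j\<in>I - {i}. A j (\<pi> j))"
    by (rule prod.cong) auto
  finally show "of_int (sign \<pi>) * (\<Prod>j\<in>I. (A(i := R)) j (\<pi> j)) =
     of_int (sign \<pi>) * (\<Prod>j\<in>I - {i}. A j (\<pi> j)) * R (\<pi> i)" by simp
qed

lemma set_det_row_add:
  assumes "finite I" "i \<in> I"
  shows "set_det I (A(i := (\<lambda>c. R c + R' c))) = set_det I (A(i := R)) + set_det I (A(i := R'))"
  unfolding set_det_row[OF assms] by (simp add: ring_distribs sum.distrib)

lemma set_det_row_scale:
  assumes "finite I" "i \<in> I"
  shows "set_det I (A(i := (\<lambda>c. x * R c))) = x * set_det I (A(i := R))"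
  unfolding set_det_row[OF assms] by (simp add: sum_distrib_left mult_ac)

text \<open>Composition with the transposition of the two rows pairs permutations of opposite sign.\<close>
lemma set_det_equal_rows:
  assumes I: "finite I" "i \<in> I" "k \<in> I" "i \<noteq> k" and eq: "A i = A k"
  shows "set_det I A = 0"
proof -
  let ?t = "Transposition.transpose i k"
  have t: "?t permutes I" using I by (simp add: permutes_swap_id)
  have "set_det I A = (\<Sum>\<pi> | \<pi> permutes I. of_int (sign (\<pi> \<circ> ?t)) * (\<Prod>j\<in>I. A j ((\<pi> \<circ> ?t) j)))"
    unfolding set_det_def by (rule sum_permutations_compose_right[OF t])
  also have "\<dots> = (\<Sum>\<pi> | \<pi> permutes I. - (of_int (sign \<pi>) * (\<Prod>j\<in>I. A j (\<pi> j))))"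
  proof (rule sum.cong[OF refl])
    fix \<pi> assume "\<pi> \<in> {\<pi>. \<pi> permutes I}"
    then have p: "permutation \<pi>" using I permutes_imp_permutation by blast
    have s: "sign (\<pi> \<circ> ?t) = - sign \<pi>"
      using I p by (simp add: sign_compose permutation_swap_id sign_swap_id)
    have "(\<Prod>j\<in>I. A j ((\<pi> \<circ> ?t) j)) = (\<Prod>j\<in>I. A (?t j) ((\<pi> \<circ> ?t) j))"
      by (rule prod.cong) (auto simp: eq Transposition.transpose_def)
    also have "\<dots> = (\<Prod>j\<in>I. A j (\<pi> j))"
      using prod.permute[OF t, of "\<lambda>j. A j (\<pi> j)"] by (simp add: o_def)
    finally show "of_int (sign (\<pi> \<circ> ?t)) * (\<Prod>j\<in>I. A j ((\<pi> \<circ> ?t) j)) =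
        - (of_int (sign \<pi>) * (\<Prod>j\<in>I. A j (\<pi> j)))"
      by (simp add: s)
  qed
  also have "\<dots> = - set_det I A" unfolding set_det_def by (simp add: sum_negf)
  finally show ?thesis by simp
qed

definition gram :: "'i set \<Rightarrow> ('i \<Rightarrow> 'b::real_inner) \<Rightarrow> real" where
  "gram I v = set_det I (\<lambda>i j. v i \<bullet> v j)"

lemma gram_empty [simp]: "gram {} v = 1"
  by (simp add: gram_def set_det_def sign_id)

text \<open>Subtracting the combination of the other rows that corresponds to \<open>a\<close> replaces row \<open>i\<close> by the inner
  products with \<open>u\<close>, of which only the diagonal entry \<open>u \<bullet> u\<close> is nonzero.\<close>
lemma gram_insert:
  fixes v :: "'i \<Rightarrow> 'b::real_inner"
  assumes I: "finite I" "i \<notin> I" and a: "a \<in> span (v ` I)" and v: "v i = a + u"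
    and u: "\<And>w. w \<in> span (v ` I) \<Longrightarrow> u \<bullet> w = 0"
  shows "gram (insert i I) v = (u \<bullet> u) * gram I v"
proof -
  let ?J = "insert i I" and ?A = "\<lambda>i j. v i \<bullet> v j"
  have J: "finite ?J" "i \<in> ?J" using I by auto
  let ?d = "\<lambda>R. set_det ?J (?A(i := R))"
  have z: "?d (\<lambda>c. a \<bullet> v c) = 0"
    using a
  proof (induction rule: span_induct)
    case base
    show ?case
      unfolding subspace_def mem_Collect_eq inner_add_left inner_scaleR_left set_det_row_add[OF J] set_det_row_scale[OF J]
      using set_det_row_scale[OF J, of ?A 0] by simp
  next
    case (step x)
    then obtain k where k: "k \<in> I" "x = v k" by blast
    then show ?case using I by (intro set_det_equal_rows[of _ i k]) auto
  qed
  have "gram ?J v = ?d (\<lambda>c. a \<bullet> v c + u \<bullet> v c)"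
    unfolding gram_def by (rule arg_cong[where f = "set_det ?J"]) (auto simp: v inner_add_left fun_eq_iff)
  also have "\<dots> = ?d (\<lambda>c. u \<bullet> v c)"
    by (simp add: set_det_row_add[OF J, of ?A] z)
  also have "\<dots> = (\<Sum>\<pi> | \<pi> permutes ?J. of_int (sign \<pi>) * (\<Prod>j\<in>I. ?A j (\<pi> j)) * (u \<bullet> v (\<pi> i)))"
    using I by (simp add: set_det_row[OF J])
  also have "\<dots> = (\<Sum>\<pi> | \<pi> permutes I. of_int (sign \<pi>) * (\<Prod>j\<in>I. ?A j (\<pi> j)) * (u \<bullet> v (\<pi> i)))"
  proof (rule sum.mono_neutral_right)
    show "finite {\<pi>. \<pi> permutes ?J}" using J by (simp add: finite_permutations)
    show "{\<pi>. \<pi> permutes I} \<subseteq> {\<pi>. \<pi> permutes ?J}" using permutes_subset by blast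
    show "\<forall>\<pi>\<in>{\<pi>. \<pi> permutes ?J} - {\<pi>. \<pi> permutes I}.
       of_int (sign \<pi>) * (\<Prod>j\<in>I. ?A j (\<pi> j)) * (u \<bullet> v (\<pi> i)) = 0"
    proof
      fix \<pi> assume p: "\<pi> \<in> {\<pi>. \<pi> permutes ?J} - {\<pi>. \<pi> permutes I}"
      have "\<pi> i \<noteq> i"
      proof
        assume "\<pi> i = i"
        then have "\<pi> permutes I"
          using p by (auto intro!: permutes_superset[of \<pi> ?J])
        then show False using p by simp
      qed
      moreover have "\<pi> i \<in> ?J" using p permutes_in_image[of \<pi> ?J i] by auto
      ultimately have "v (\<pi> i) \<in> v ` I" by auto
      then have "u \<bullet> v (\<pi> i) = 0" using u span_base by blast
      then show "of_int (sign \<pi>) * (\<Prod>j\<in>I. ?A j (\<pi> j)) * (u \<bullet> v (\<pi> i)) = 0" by simp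
    qed
  qed
  also have "\<dots> = (\<Sum>\<pi> | \<pi> permutes I. (u \<bullet> u) * (of_int (sign \<pi>) * (\<Prod>j\<in>I. ?A j (\<pi> j))))"
  proof (rule sum.cong[OF refl])
    fix \<pi> assume "\<pi> \<in> {\<pi>. \<pi> permutes I}"
    then have "\<pi> i = i" using I permutes_not_in by force
    moreover have "u \<bullet> v i = u \<bullet> u" using u[OF a] by (simp add: v inner_add_right)
    ultimately show "of_int (sign \<pi>) * (\<Prod>j\<in>I. ?A j (\<pi> j)) * (u \<bullet> v (\<pi> i)) =
       (u \<bullet> u) * (of_int (sign \<pi>) * (\<Prod>j\<in>I. ?A j (\<pi> j)))" by simp
  qed
  also have "\<dots> = (u \<bullet> u) * gram I v" by (simp add: gram_def set_det_def sum_distrib_left)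
  finally show ?thesis .
qed

lemma unit_ball_vol_Suc_Beta:
  "unit_ball_vol (real n) * Beta (1/2) (real n / 2 + 1) = unit_ball_vol (real (Suc n))"
proof -
  have g: "Gamma (real n / 2 + 1) \<noteq> 0"
  proof -
    have "real n / 2 + 1 > 0" by (intro add_nonneg_pos) auto
    from Gamma_real_pos[OF this] show ?thesis by linarith
  qed
  have p: "pi powr (real n / 2) * sqrt pi = pi powr (real (Suc n) / 2)"
    by (simp add: powr_half_sqrt[symmetric] powr_add[symmetric] add_divide_distrib add.commute)
  have e: "1/2 + (real n / 2 + 1) = real (Suc n) / 2 + 1" by (simp add: add_divide_distrib)
  show ?thesis
    unfolding unit_ball_vol_def Beta_def e Gamma_one_half_real p[symmetric] using g by simp
qed

lemma nn_integral_ball_slices: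
  assumes "r > 0" "q > 0"
  shows "(\<integral>\<^sup>+y. indicator {y. (y + \<beta>)\<^sup>2 * q\<^sup>2 < r\<^sup>2} y * ennreal (sqrt (r\<^sup>2 - (y + \<beta>)\<^sup>2 * q\<^sup>2) ^ n) \<partial>lborel)
     = ennreal (Beta (1/2) (real n / 2 + 1) * r ^ Suc n / q)"
proof -
  let ?c = "r / q"
  have c: "?c > 0" using assms by simp
  have "(\<integral>\<^sup>+y. indicator {y. (y + \<beta>)\<^sup>2 * q\<^sup>2 < r\<^sup>2} y * ennreal (sqrt (r\<^sup>2 - (y + \<beta>)\<^sup>2 * q\<^sup>2) ^ n) \<partial>lborel)
    = ennreal \<bar>?c\<bar> * (\<integral>\<^sup>+x. indicator {y. (y + \<beta>)\<^sup>2 * q\<^sup>2 < r\<^sup>2} (-\<beta> + ?c * x) *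
        ennreal (sqrt (r\<^sup>2 - ((-\<beta> + ?c * x) + \<beta>)\<^sup>2 * q\<^sup>2) ^ n) \<partial>lborel)"
    by (rule nn_integral_real_affine) (use c assms in \<open>simp_all\<close>)
  also have "(\<integral>\<^sup>+x. indicator {y. (y + \<beta>)\<^sup>2 * q\<^sup>2 < r\<^sup>2} (-\<beta> + ?c * x) *
        ennreal (sqrt (r\<^sup>2 - ((-\<beta> + ?c * x) + \<beta>)\<^sup>2 * q\<^sup>2) ^ n) \<partial>lborel)
     = (\<integral>\<^sup>+x. ennreal (r ^ n) * ennreal (indicator {-1..1} x * sqrt (1 - x\<^sup>2) ^ n) \<partial>lborel)"
  proof (rule nn_integral_cong_AE, rule AE_I[of _ _ "{-1, 1}"])
    show "emeasure lborel {-1, 1 :: real} = 0" by (simp add: emeasure_lborel_countable)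
    have "indicator {y. (y + \<beta>)\<^sup>2 * q\<^sup>2 < r\<^sup>2} (-\<beta> + ?c * x) *
        ennreal (sqrt (r\<^sup>2 - ((-\<beta> + ?c * x) + \<beta>)\<^sup>2 * q\<^sup>2) ^ n) =
        ennreal (r ^ n) * ennreal (indicator {-1..1} x * sqrt (1 - x\<^sup>2) ^ n)"
      if x: "x \<noteq> -1" "x \<noteq> 1" for x
    proof -
      have e: "((-\<beta> + ?c * x) + \<beta>)\<^sup>2 * q\<^sup>2 = r\<^sup>2 * x\<^sup>2"
        using assms by (simp add: power_mult_distrib power_divide)
      have s: "sqrt (r\<^sup>2 - r\<^sup>2 * x\<^sup>2) = r * sqrt (1 - x\<^sup>2)"
      proof -
        have "r\<^sup>2 - r\<^sup>2 * x\<^sup>2 = r\<^sup>2 * (1 - x\<^sup>2)" by (simp add: algebra_simps)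
        then show ?thesis using assms by (simp add: real_sqrt_mult)
      qed
      have "r\<^sup>2 * x\<^sup>2 < r\<^sup>2 \<longleftrightarrow> x\<^sup>2 < 1" using assms by simp
      also have "\<dots> \<longleftrightarrow> -1 < x \<and> x < 1" by (simp add: abs_less_iff abs_square_less_1) auto
      also have "\<dots> \<longleftrightarrow> x \<in> {-1..1}" using x by auto
      finally have i: "(-\<beta> + ?c * x) \<in> {y. (y + \<beta>)\<^sup>2 * q\<^sup>2 < r\<^sup>2} \<longleftrightarrow> x \<in> {-1..1}"
        using e by simp
      show ?thesis unfolding indicator_def of_bool_def i e s
        using assms by (auto simp: power_mult_distrib ennreal_mult')
    qed
    then show "{x \<in> space lborel. \<not> indicator {y. (y + \<beta>)\<^sup>2 * q\<^sup>2 < r\<^sup>2} (-\<beta> + ?c * x) *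
        ennreal (sqrt (r\<^sup>2 - ((-\<beta> + ?c * x) + \<beta>)\<^sup>2 * q\<^sup>2) ^ n) =
        ennreal (r ^ n) * ennreal (indicator {-1..1} x * sqrt (1 - x\<^sup>2) ^ n)} \<subseteq> {-1, 1}"
      by blast
  qed simp
  also have "\<dots> = ennreal (r ^ n) * ennreal (Beta (1/2) (real n / 2 + 1))"
    by (subst nn_integral_cmult) (simp_all add: emeasure_cball_aux_integral)
  also have "ennreal \<bar>?c\<bar> * \<dots> = ennreal (Beta (1/2) (real n / 2 + 1) * r ^ Suc n / q)"
    using assms by (simp add: ennreal_mult'[symmetric] mult_ac)
  finally show ?thesis .
qed

text \<open>Induction on the dimension. Write the new vector as \<open>v i = a + u\<close> with \<open>a\<close> in the span of the others and \<open>u\<close>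
  orthogonal to it. By Pythagoras the slice at \<open>f i = y\<close> is an ellipsoid of one dimension less, with radius
  \<open>sqrt (r\<^sup>2 - (y + \<beta>)\<^sup>2 \<parallel>u\<parallel>\<^sup>2)\<close> and a new centre; this is why the centre \<open>w\<close> is arbitrary. The
  integral over \<open>y\<close> produces the factor \<open>1 / \<parallel>u\<parallel>\<close>, the inverse square root of what \<open>u\<close> contributes
  to the Gram determinant.\<close>
lemma ellipsoid_volume:
  fixes v :: "'i \<Rightarrow> 'b::euclidean_space"
  assumes "finite I" "inj_on v I" "independent (v ` I)"
  shows "gram I v > 0 \<and> (\<forall>w r. w \<in> span (v ` I) \<longrightarrow> r > 0 \<longrightarrow>
    emeasure (PiM I (\<lambda>_. lborel)) {f \<in> space (PiM I (\<lambda>_. lborel)). norm (w + (\<Sum>i\<in>I. f i *\<^sub>R v i)) < r} =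
      ennreal (unit_ball_vol (real (card I)) * r ^ card I / sqrt (gram I v)))"
  using assms
proof (induction I)
  case empty
  have "{f. f = (\<lambda>x. undefined)} = {\<lambda>x. undefined}" by auto
  then show ?case by (auto simp: space_PiM)
next
  case (insert i I)
  interpret product_sigma_finite "\<lambda>_::'i. lborel :: real measure" by standard
  let ?P = "PiM I (\<lambda>_. lborel :: real measure)" and ?Q = "PiM (insert i I) (\<lambda>_. lborel :: real measure)"
  let ?S = "span (v ` I)" and ?n = "card I"
  have ni: "v i \<notin> v ` I" using insert.prems insert.hyps by auto
  then have ind: "v i \<notin> ?S" "independent (v ` I)"
    using insert.prems by (auto simp: independent_insert)
  obtain a u where a: "a \<in> ?S" and u: "\<And>w. w \<in> ?S \<Longrightarrow> orthogonal u w" and vi: "v i = a + u"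
    using orthogonal_subspace_decomp_exists by metis
  have u': "u \<bullet> w = 0" if "w \<in> ?S" for w using u[OF that] by (simp add: orthogonal_def)
  define q where "q = norm u"
  have q: "q > 0" using ind(1) vi a unfolding q_def by auto
  have IH: "gram I v > 0" "\<And>w r. w \<in> ?S \<Longrightarrow> r > 0 \<Longrightarrow>
    emeasure ?P {f \<in> space ?P. norm (w + (\<Sum>i\<in>I. f i *\<^sub>R v i)) < r} =
      ennreal (unit_ball_vol (real ?n) * r ^ ?n / sqrt (gram I v))"
    using insert.IH insert.prems ind by auto
  have g: "gram (insert i I) v = q\<^sup>2 * gram I v"
    using gram_insert[OF insert.hyps a vi u'] by (simp add: q_def dot_square_norm)
  have "emeasure ?Q {f \<in> space ?Q. norm (w + (\<Sum>j\<in>insert i I. f j *\<^sub>R v j)) < r} =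
      ennreal (unit_ball_vol (real (card (insert i I))) * r ^ card (insert i I) / sqrt (gram (insert i I) v))"
    if w: "w \<in> span (v ` insert i I)" and r: "r > 0" for w r
  proof -
    obtain \<beta> where \<beta>: "w - \<beta> *\<^sub>R v i \<in> ?S" using w span_breakdown_eq by (metis image_insert)
    let ?w = "w - \<beta> *\<^sub>R v i"
    define E where "E = {f \<in> space ?Q. norm (w + (\<Sum>j\<in>insert i I. f j *\<^sub>R v j)) < r}"
    have E[measurable]: "E \<in> sets ?Q" unfolding E_def by measurable
    have slice: "indicator E (f(i := y)) = (indicator {y. (y + \<beta>)\<^sup>2 * q\<^sup>2 < r\<^sup>2} y *
        indicator {f \<in> space ?P. norm ((?w + (y + \<beta>) *\<^sub>R a) + (\<Sum>i\<in>I. f i *\<^sub>R v i)) < sqrt (r\<^sup>2 - (y + \<beta>)\<^sup>2 * q\<^sup>2)} f :: ennreal)"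
      if f: "f \<in> space ?P" for f y
    proof -
      have sp: "f(i := y) \<in> space ?Q" using f by (auto simp: space_PiM PiE_def extensional_def)
      have s: "(\<Sum>j\<in>insert i I. (f(i := y)) j *\<^sub>R v j) = y *\<^sub>R v i + (\<Sum>j\<in>I. f j *\<^sub>R v j)"
        using insert.hyps by (subst sum.insert) (auto intro!: sum.cong)
      define z where "z = (?w + (y + \<beta>) *\<^sub>R a) + (\<Sum>i\<in>I. f i *\<^sub>R v i)"
      have zS: "z \<in> ?S" unfolding z_def using \<beta> a
        by (intro span_add span_scale span_sum) (auto intro: span_base)
      have d: "w + (\<Sum>j\<in>insert i I. (f(i := y)) j *\<^sub>R v j) = z + (y + \<beta>) *\<^sub>R u"
        unfolding s z_def vi by (simp add: algebra_simps)
      have n: "(norm (z + (y + \<beta>) *\<^sub>R u))\<^sup>2 = (norm z)\<^sup>2 + (y + \<beta>)\<^sup>2 * q\<^sup>2"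
        using u[OF zS]
        by (subst norm_add_Pythagorean) (auto simp: orthogonal_def inner_commute q_def power_mult_distrib)
      have "norm (z + (y + \<beta>) *\<^sub>R u) < r \<longleftrightarrow> (norm (z + (y + \<beta>) *\<^sub>R u))\<^sup>2 < r\<^sup>2"
        using r by (metis norm_ge_zero abs_of_nonneg abs_of_pos power2_abs power2_less_imp_less power_strict_mono pos2 less_imp_le)
      also have "\<dots> \<longleftrightarrow> (norm z)\<^sup>2 < r\<^sup>2 - (y + \<beta>)\<^sup>2 * q\<^sup>2" unfolding n by linarith
      also have "\<dots> \<longleftrightarrow> (y + \<beta>)\<^sup>2 * q\<^sup>2 < r\<^sup>2 \<and> norm z < sqrt (r\<^sup>2 - (y + \<beta>)\<^sup>2 * q\<^sup>2)"
        using real_less_rsqrt[of "norm z"]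
          real_sqrt_less_iff[of "(norm z)\<^sup>2" "r\<^sup>2 - (y + \<beta>)\<^sup>2 * q\<^sup>2"] zero_le_power2[of "norm z"]
        by (auto simp del: zero_le_power2 real_sqrt_less_iff)
           (smt (verit) zero_le_power2)
      finally show ?thesis using sp f unfolding E_def z_def[symmetric] indicator_def mem_Collect_eq d
        by auto
    qed
    have "emeasure ?Q E = (\<integral>\<^sup>+f. indicator E f \<partial>?Q)" by simp
    also have "\<dots> = (\<integral>\<^sup>+y. (\<integral>\<^sup>+f. indicator E (f(i := y)) \<partial>?P) \<partial>lborel)"
      using insert.hyps by (intro product_nn_integral_insert_rev) auto
    also have "\<dots> = (\<integral>\<^sup>+y. indicator {y. (y + \<beta>)\<^sup>2 * q\<^sup>2 < r\<^sup>2} y *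
        emeasure ?P {f \<in> space ?P. norm ((?w + (y + \<beta>) *\<^sub>R a) + (\<Sum>i\<in>I. f i *\<^sub>R v i)) < sqrt (r\<^sup>2 - (y + \<beta>)\<^sup>2 * q\<^sup>2)} \<partial>lborel)"
    proof (rule nn_integral_cong)
      fix y :: real
      have [measurable]: "{f \<in> space ?P. norm ((?w + (y + \<beta>) *\<^sub>R a) + (\<Sum>i\<in>I. f i *\<^sub>R v i)) < sqrt (r\<^sup>2 - (y + \<beta>)\<^sup>2 * q\<^sup>2)} \<in> sets ?P"
        by measurable
      show "(\<integral>\<^sup>+f. indicator E (f(i := y)) \<partial>?P) = indicator {y. (y + \<beta>)\<^sup>2 * q\<^sup>2 < r\<^sup>2} y *
        emeasure ?P {f \<in> space ?P. norm ((?w + (y + \<beta>) *\<^sub>R a) + (\<Sum>i\<in>I. f i *\<^sub>R v i)) < sqrt (r\<^sup>2 - (y + \<beta>)\<^sup>2 * q\<^sup>2)}"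
        by (subst nn_integral_cong[OF slice]) (simp_all add: nn_integral_cmult)
    qed
    also have "\<dots> = (\<integral>\<^sup>+y. ennreal (unit_ball_vol (real ?n) / sqrt (gram I v)) *
       (indicator {y. (y + \<beta>)\<^sup>2 * q\<^sup>2 < r\<^sup>2} y * ennreal (sqrt (r\<^sup>2 - (y + \<beta>)\<^sup>2 * q\<^sup>2) ^ ?n)) \<partial>lborel)"
    proof (rule nn_integral_cong)
      fix y :: real
      have wa: "?w + (y + \<beta>) *\<^sub>R a \<in> ?S" using \<beta> a by (intro span_add span_scale)
      show "indicator {y. (y + \<beta>)\<^sup>2 * q\<^sup>2 < r\<^sup>2} y *
        emeasure ?P {f \<in> space ?P. norm ((?w + (y + \<beta>) *\<^sub>R a) + (\<Sum>i\<in>I. f i *\<^sub>R v i)) < sqrt (r\<^sup>2 - (y + \<beta>)\<^sup>2 * q\<^sup>2)} =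
        ennreal (unit_ball_vol (real ?n) / sqrt (gram I v)) *
       (indicator {y. (y + \<beta>)\<^sup>2 * q\<^sup>2 < r\<^sup>2} y * ennreal (sqrt (r\<^sup>2 - (y + \<beta>)\<^sup>2 * q\<^sup>2) ^ ?n))"
        using IH(1) by (auto simp: indicator_def IH(2)[OF wa] ennreal_mult'[symmetric])
    qed
    also have "\<dots> = ennreal (unit_ball_vol (real ?n) / sqrt (gram I v)) * ennreal (Beta (1/2) (real ?n / 2 + 1) * r ^ Suc ?n / q)"
      by (subst nn_integral_cmult, measurable) (simp only: nn_integral_ball_slices[OF r q])
    also have "\<dots> = ennreal (unit_ball_vol (real ?n) * Beta (1/2) (real ?n / 2 + 1) * r ^ Suc ?n / (q * sqrt (gram I v)))"
      using IH(1) by (simp add: ennreal_mult'[symmetric] mult_ac)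
    finally show ?thesis
      using insert.hyps q unfolding E_def unit_ball_vol_Suc_Beta g by (simp add: real_sqrt_mult)
  qed
  then show ?case using g q IH(1) by simp
qed

section \<open>The volume of small balls in a chart\<close>

lemma gram_det_eq_gram: "gram_det B \<Psi> x = gram B (frechet_derivative \<Psi> (at x))"
  by (simp add: gram_det_def gram_def set_det_def)

lemma coord_map_measurable [measurable]:
  fixes B :: "'a::euclidean_space set"
  assumes "finite B"
  shows "(\<lambda>f. \<Sum>b\<in>B. f b *\<^sub>R b) \<in> borel_measurable (\<Pi>\<^sub>M b\<in>B. (lborel :: real measure))"
proof (intro borel_measurable_sum borel_measurable_scaleR borel_measurable_const)
  fix b assume "b \<in> B"
  then show "(\<lambda>f. f b) \<in> borel_measurable (\<Pi>\<^sub>M b\<in>B. (lborel :: real measure))"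
    using measurable_component_singleton[of b B "\<lambda>_. lborel :: real measure"] by simp
qed

lemma sets_coord_lborel [simp, measurable_cong]: "sets (coord_lborel B) = sets borel"
  by (simp add: coord_lborel_def)

lemma space_coord_lborel [simp]: "space (coord_lborel B) = UNIV"
  by (simp add: coord_lborel_def)

lemma AE_coord_lborel_span:
  fixes B :: "'a::euclidean_space set"
  assumes "finite B" shows "AE x in coord_lborel B. x \<in> span B"
proof -
  have *: "(\<lambda>f. \<Sum>b\<in>B. f b *\<^sub>R b) \<in> measurable (\<Pi>\<^sub>M b\<in>B. (lborel :: real measure)) borel"
    using assms by measurable
  show ?thesis
    unfolding coord_lborel_def
    by (subst AE_distr_iff[OF *]) (auto intro!: span_sum span_scale intro: span_base)
qed

lemma coord_lborel_ellipsoid: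
  fixes B :: "'a::euclidean_space set" and L :: "'a \<Rightarrow> 'b::euclidean_space"
  assumes B: "B \<subseteq> Basis" and L: "linear L" "inj L" and x: "x \<in> span B" and r: "r > 0"
  shows "gram B L > 0"
    and "emeasure (coord_lborel B) {x'. norm (L (x' - x)) < r} =
      ennreal (unit_ball_vol (real (card B)) * r ^ card B / sqrt (gram B L))"
proof -
  have fB: "finite B" using B finite_Basis finite_subset by blast
  have ind: "independent B" using B independent_Basis independent_mono by blast
  have indL: "independent (L ` B)"
    by (rule linear_independent_injective_image[OF L(1) ind]) (use L(2) inj_on_subset in blast)
  have injL: "inj_on L B" using L inj_on_subset by blast
  interpret linear L by fact
  have w: "- L x \<in> span (L ` B)" using x linear_span_image[OF L(1), of B] by (auto intro!: span_neg)
  have E: "{x'. norm (L (x' - x)) < r} \<in> sets borel"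
    by (intro borel_open open_Collect_less continuous_intros
         linear_continuous_on_compose[OF _ L(1)])
  have m: "(\<lambda>f. \<Sum>b\<in>B. f b *\<^sub>R b) \<in> measurable (\<Pi>\<^sub>M b\<in>B. (lborel :: real measure)) borel"
    using fB by measurable
  have "emeasure (coord_lborel B) {x'. norm (L (x' - x)) < r} =
    emeasure (\<Pi>\<^sub>M b\<in>B. lborel) ((\<lambda>f. \<Sum>b\<in>B. f b *\<^sub>R b) -` {x'. norm (L (x' - x)) < r} \<inter> space (\<Pi>\<^sub>M b\<in>B. lborel))"
    unfolding coord_lborel_def by (rule emeasure_distr[OF m E])
  also have "(\<lambda>f. \<Sum>b\<in>B. f b *\<^sub>R b) -` {x'. norm (L (x' - x)) < r} \<inter> space (\<Pi>\<^sub>M b\<in>B. lborel) =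
    {f \<in> space (\<Pi>\<^sub>M b\<in>B. lborel). norm (- L x + (\<Sum>b\<in>B. f b *\<^sub>R L b)) < r}"
    by (auto simp: diff sum scale)
  finally show "emeasure (coord_lborel B) {x'. norm (L (x' - x)) < r} =
      ennreal (unit_ball_vol (real (card B)) * r ^ card B / sqrt (gram B L))"
    by (simp only: ellipsoid_volume[OF fB injL indL, THEN conjunct2, rule_format, OF w r])
  show "gram B L > 0" using ellipsoid_volume[OF fB injL indL] by simp
qed

lemma smooth_on_imp_C1:
  assumes "smooth_on U f"
  shows "\<And>x. x \<in> U \<Longrightarrow> f differentiable (at x)"
    and "\<And>v. continuous_on U (\<lambda>x. frechet_derivative f (at x) v)"
proof -
  have "Ck_on (Suc 0) U f" using assms unfolding smooth_on_def by blast
  then show "\<And>x. x \<in> U \<Longrightarrow> f differentiable (at x)"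
    "\<And>v. continuous_on U (\<lambda>x. frechet_derivative f (at x) v)" by auto
qed

lemma slice_chartD:
  assumes "slice_chart k S U W \<Phi> \<Psi> B"
  shows "open U" "open W" "B \<subseteq> Basis" "finite B" "card B = k"
    "continuous_on U \<Phi>" "continuous_on W \<Psi>"
    "\<And>y. y \<in> U \<Longrightarrow> \<Phi> y \<in> W" "\<And>x. x \<in> W \<Longrightarrow> \<Psi> x \<in> U"
    "\<And>y. y \<in> U \<Longrightarrow> \<Psi> (\<Phi> y) = y" "\<And>x. x \<in> W \<Longrightarrow> \<Phi> (\<Psi> x) = x"
    "\<And>y. y \<in> U \<Longrightarrow> y \<in> S \<longleftrightarrow> \<Phi> y \<in> span B"
    "\<And>y. y \<in> U \<Longrightarrow> \<Phi> differentiable (at y)"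
    "\<And>x. x \<in> W \<Longrightarrow> \<Psi> differentiable (at x)"
    "\<And>v. continuous_on W (\<lambda>x. frechet_derivative \<Psi> (at x) v)"
proof -
  note a = assms[unfolded slice_chart_def homeomorphism_def]
  show "open U" "open W" "B \<subseteq> Basis" "card B = k" "continuous_on U \<Phi>" "continuous_on W \<Psi>"
    using a by auto
  show "finite B" using \<open>B \<subseteq> Basis\<close> finite_Basis finite_subset by blast
  show i: "\<And>y. y \<in> U \<Longrightarrow> \<Phi> y \<in> W" "\<And>x. x \<in> W \<Longrightarrow> \<Psi> x \<in> U"
    "\<And>y. y \<in> U \<Longrightarrow> \<Psi> (\<Phi> y) = y" "\<And>x. x \<in> W \<Longrightarrow> \<Phi> (\<Psi> x) = x" using a by auto
  show "y \<in> S \<longleftrightarrow> \<Phi> y \<in> span B" if y: "y \<in> U" for y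
  proof
    assume "y \<in> S" then show "\<Phi> y \<in> span B" using a y by blast
  next
    assume "\<Phi> y \<in> span B"
    then have "\<Phi> y \<in> \<Phi> ` (S \<inter> U)" using a y by blast
    then show "y \<in> S" using i y by (metis IntE imageE)
  qed
  show "\<And>y. y \<in> U \<Longrightarrow> \<Phi> differentiable (at y)"
    "\<And>x. x \<in> W \<Longrightarrow> \<Psi> differentiable (at x)"
    "\<And>v. continuous_on W (\<lambda>x. frechet_derivative \<Psi> (at x) v)"
    using smooth_on_imp_C1[of U \<Phi>] smooth_on_imp_C1[of W \<Psi>] a by simp_all
qed

lemma slice_chart_derivatives:
  assumes c: "slice_chart k S U W \<Phi> \<Psi> B" and x: "x \<in> W"
  shows "(\<Psi> has_derivative frechet_derivative \<Psi> (at x)) (at x)"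
    "linear (frechet_derivative \<Psi> (at x))"
    "(\<Phi> has_derivative frechet_derivative \<Phi> (at (\<Psi> x))) (at (\<Psi> x))"
    "frechet_derivative \<Phi> (at (\<Psi> x)) (frechet_derivative \<Psi> (at x) v) = v"
    "frechet_derivative \<Psi> (at x) (frechet_derivative \<Phi> (at (\<Psi> x)) v) = v"
    "inj (frechet_derivative \<Psi> (at x))"
proof -
  note C = slice_chartD[OF c]
  show d\<Psi>: "(\<Psi> has_derivative frechet_derivative \<Psi> (at x)) (at x)"
    using C(14)[OF x] by (simp add: frechet_derivative_works)
  show "linear (frechet_derivative \<Psi> (at x))" using d\<Psi> has_derivative_linear by blast
  show d\<Phi>: "(\<Phi> has_derivative frechet_derivative \<Phi> (at (\<Psi> x))) (at (\<Psi> x))"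
    using C(13)[OF C(9)[OF x]] by (simp add: frechet_derivative_works)
  have "((\<lambda>x. \<Phi> (\<Psi> x)) has_derivative (\<lambda>v. frechet_derivative \<Phi> (at (\<Psi> x)) (frechet_derivative \<Psi> (at x) v))) (at x)"
    using has_derivative_compose[OF d\<Psi> d\<Phi>] .
  moreover have "((\<lambda>x. \<Phi> (\<Psi> x)) has_derivative (\<lambda>v. v)) (at x)"
    by (rule has_derivative_transform_within_open[OF has_derivative_ident C(2) x]) (simp add: C)
  ultimately show 1: "frechet_derivative \<Phi> (at (\<Psi> x)) (frechet_derivative \<Psi> (at x) v) = v" for v
    using has_derivative_unique by (metis (no_types, lifting))
  have d\<Psi>': "(\<Psi> has_derivative frechet_derivative \<Psi> (at x)) (at (\<Phi> (\<Psi> x)))" using d\<Psi> C x by simp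
  have "((\<lambda>y. \<Psi> (\<Phi> y)) has_derivative (\<lambda>v. frechet_derivative \<Psi> (at x) (frechet_derivative \<Phi> (at (\<Psi> x)) v))) (at (\<Psi> x))"
    using has_derivative_compose[OF d\<Phi> d\<Psi>'] .
  moreover have "((\<lambda>y. \<Psi> (\<Phi> y)) has_derivative (\<lambda>v. v)) (at (\<Psi> x))"
    by (rule has_derivative_transform_within_open[OF has_derivative_ident C(1) C(9)[OF x]]) (simp add: C)
  ultimately show "frechet_derivative \<Psi> (at x) (frechet_derivative \<Phi> (at (\<Psi> x)) v) = v" for v
    using has_derivative_unique by (metis (no_types, lifting))
  show "inj (frechet_derivative \<Psi> (at x))"
    using 1 by (metis injI)
qed

lemma continuous_on_gram_det:
  assumes c: "slice_chart k S U W \<Phi> \<Psi> B"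
  shows "continuous_on W (gram_det B \<Psi>)"
  unfolding gram_det_def by (intro continuous_intros slice_chartD(15)[OF c])

lemma span_Int_borel:
  assumes c: "slice_chart k S U W \<Phi> \<Psi> B" shows "span B \<inter> W \<in> sets borel"
  using slice_chartD(2)[OF c] by (intro sets.Int) auto

text \<open>The chart formula for the volume, as a measure on the whole space that is carried by \<open>S \<inter> U\<close>
  (see \<open>chart_measure_concentrated\<close>).\<close>
definition chart_measure :: "'a::euclidean_space set \<Rightarrow> ('a \<Rightarrow> 'a) \<Rightarrow> 'a set \<Rightarrow> 'a measure" where
  "chart_measure W \<Psi> B = distr (density (restrict_space (coord_lborel B) (span B \<inter> W))
     (\<lambda>x. ennreal (sqrt (gram_det B \<Psi> x)))) borel \<Psi>"

lemma sets_chart_measure [simp, measurable_cong]: "sets (chart_measure W \<Psi> B) = sets borel"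
  and space_chart_measure [simp]: "space (chart_measure W \<Psi> B) = UNIV"
  by (simp_all add: chart_measure_def)

lemma emeasure_chart_measure:
  assumes c: "slice_chart k S U W \<Phi> \<Psi> B" and A: "A \<in> sets borel"
  shows "emeasure (chart_measure W \<Psi> B) A =
     (\<integral>\<^sup>+ x. ennreal (sqrt (gram_det B \<Psi> x)) * indicator {x \<in> span B \<inter> W. \<Psi> x \<in> A} x \<partial>coord_lborel B)"
proof -
  note C = slice_chartD[OF c] and Sp = span_Int_borel[OF c]
  let ?R = "restrict_space (coord_lborel B) (span B \<inter> W)"
  let ?J = "\<lambda>x. ennreal (sqrt (gram_det B \<Psi> x))"
  have sub: "sets ?R = sets (restrict_space borel (span B \<inter> W))"
    by (intro sets_restrict_space_cong) simp
  have "gram_det B \<Psi> \<in> borel_measurable (restrict_space borel (span B \<inter> W))"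
    by (intro borel_measurable_continuous_on_restrict continuous_on_subset[OF continuous_on_gram_det[OF c]]) auto
  then have J: "?J \<in> borel_measurable ?R"
    unfolding measurable_cong_sets[OF sub refl] by measurable
  have "\<Psi> \<in> borel_measurable (restrict_space borel (span B \<inter> W))"
    by (intro borel_measurable_continuous_on_restrict continuous_on_subset[OF C(7)]) auto
  then have M: "\<Psi> \<in> borel_measurable (density ?R ?J)"
    by (simp add: measurable_cong_sets[OF sub refl])
  then have M': "\<Psi> \<in> borel_measurable ?R" by simp
  have "emeasure (chart_measure W \<Psi> B) A = emeasure (density ?R ?J) (\<Psi> -` A \<inter> space ?R)"
    unfolding chart_measure_def using emeasure_distr[OF M A] by simp
  also have "\<dots> = (\<integral>\<^sup>+ x. ?J x * indicator (\<Psi> -` A \<inter> space ?R) x \<partial>?R)"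
    using measurable_sets[OF M' A] by (intro emeasure_density J) auto
  also have "\<dots> = (\<integral>\<^sup>+ x. ?J x * indicator (\<Psi> -` A \<inter> space ?R) x * indicator (span B \<inter> W) x \<partial>coord_lborel B)"
    using Sp by (intro nn_integral_restrict_space) auto
  also have "\<dots> = (\<integral>\<^sup>+ x. ?J x * indicator {x \<in> span B \<inter> W. \<Psi> x \<in> A} x \<partial>coord_lborel B)"
    by (intro nn_integral_cong) (auto simp: indicator_def space_restrict_space)
  finally show ?thesis .
qed

text \<open>The mean value inequality for \<open>f - f' x0\<close>. Both points vary, so that the bound holds uniformly for all
  balls with centre near \<open>x0\<close>.\<close>
lemma C1_strict_derivative:
  fixes f :: "'a::euclidean_space \<Rightarrow> 'b::euclidean_space"
  assumes W: "open W" "x0 \<in> W" and d: "\<And>x. x \<in> W \<Longrightarrow> (f has_derivative f' x) (at x)"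
    and cont: "\<And>v. continuous_on W (\<lambda>x. f' x v)" and e: "e > 0"
  obtains \<delta> where "\<delta> > 0" "ball x0 \<delta> \<subseteq> W"
    "\<And>x x'. x \<in> ball x0 \<delta> \<Longrightarrow> x' \<in> ball x0 \<delta> \<Longrightarrow> norm (f x' - f x - f' x0 (x' - x)) \<le> e * norm (x' - x)"
proof -
  have "((\<lambda>x. \<Sum>b\<in>Basis. norm (f' x b - f' x0 b)) \<longlongrightarrow> (\<Sum>b\<in>Basis. norm (f' x0 b - f' x0 b))) (at x0)"
    using cont W by (intro tendsto_intros) (simp add: continuous_on_eq_continuous_at isCont_def)
  then have "eventually (\<lambda>x. (\<Sum>b\<in>Basis. norm (f' x b - f' x0 b)) < e) (at x0)"
    using e by (intro order_tendstoD(2)) auto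
  then obtain d1 where d1: "d1 > 0" "\<And>x. x \<noteq> x0 \<Longrightarrow> dist x x0 < d1 \<Longrightarrow> (\<Sum>b\<in>Basis. norm (f' x b - f' x0 b)) < e"
    unfolding eventually_at by auto
  obtain d2 where d2: "d2 > 0" "ball x0 d2 \<subseteq> W" using W openE by blast
  let ?d = "min d1 d2"
  have dW: "ball x0 ?d \<subseteq> W" using d2 by auto
  have lin: "linear (f' x)" if "x \<in> W" for x using d[OF that] has_derivative_linear by blast
  have bd: "norm (f' x u - f' x0 u) \<le> e * norm u" if x: "x \<in> ball x0 ?d" for x u
  proof -
    have "(\<Sum>b\<in>Basis. norm (f' x b - f' x0 b)) \<le> e"
      using d1(2)[of x] x e by (cases "x = x0") (auto simp: dist_commute)
    interpret a: linear "f' x" using lin x dW by blast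
    interpret b: linear "f' x0" using lin W by blast
    have "f' x u - f' x0 u = f' x (\<Sum>b\<in>Basis. (u \<bullet> b) *\<^sub>R b) - f' x0 (\<Sum>b\<in>Basis. (u \<bullet> b) *\<^sub>R b)"
      by (simp add: euclidean_representation)
    also have "\<dots> = (\<Sum>b\<in>Basis. (u \<bullet> b) *\<^sub>R (f' x b - f' x0 b))"
      by (simp only: a.sum b.sum a.scale b.scale scaleR_diff_right sum_subtractf)
    also have "norm \<dots> \<le> (\<Sum>b\<in>Basis. norm u * norm (f' x b - f' x0 b))"
      by (intro order_trans[OF norm_sum] sum_mono) (auto intro!: mult_right_mono simp: Basis_le_norm)
    also have "\<dots> = norm u * (\<Sum>b\<in>Basis. norm (f' x b - f' x0 b))" by (simp add: sum_distrib_left)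
    also have "\<dots> \<le> norm u * e" by (intro mult_left_mono) (use \<open>_ \<le> e\<close> in auto)
    finally show ?thesis by (simp add: mult.commute)
  qed
  have "norm (f x' - f x - f' x0 (x' - x)) \<le> e * norm (x' - x)" if xx: "x \<in> ball x0 ?d" "x' \<in> ball x0 ?d" for x x'
  proof -
    interpret b: linear "f' x0" using lin W by blast
    have "norm ((f x' - f' x0 x') - (f x - f' x0 x)) \<le> e * norm (x' - x)"
    proof (rule differentiable_bound[where S = "ball x0 ?d"])
      show "convex (ball x0 ?d)" by (rule convex_ball)
      fix z assume z: "z \<in> ball x0 ?d"
      have "(f' x0 has_derivative f' x0) (at z)"
        using b.linear_axioms by (simp add: bounded_linear_imp_has_derivative linear_conv_bounded_linear)
      moreover have "(f has_derivative f' z) (at z)" using d z dW by blast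
      ultimately have "((\<lambda>z. f z - f' x0 z) has_derivative (\<lambda>u. f' z u - f' x0 u)) (at z)"
        by (rule has_derivative_diff[rotated])
      then show "((\<lambda>z. f z - f' x0 z) has_derivative (\<lambda>u. f' z u - f' x0 u)) (at z within ball x0 ?d)"
        by (rule has_derivative_at_withinI)
      show "onorm (\<lambda>u. f' z u - f' x0 u) \<le> e" by (rule onorm_le) (rule bd[OF z])
    qed (rule xx)+
    also have "(f x' - f' x0 x') - (f x - f' x0 x) = f x' - f x - f' x0 (x' - x)"
      by (simp add: b.diff)
    finally show ?thesis .
  qed
  then show ?thesis using d1(1) d2(1) by (intro that[of ?d] dW) auto
qed

lemma shrink_constant:
  fixes e :: real
  assumes "e > 0"
  obtains e1 where "0 < e1" "e1 < 1" "(1 + e1) / (1 - e1) ^ k \<le> 1 + e" "1 - e \<le> (1 - e1) / (1 + e1) ^ k"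
proof -
  have "((\<lambda>x::real. (1 + x) / (1 - x) ^ k) \<longlongrightarrow> (1 + 0) / (1 - 0) ^ k) (at_right 0)"
    by (intro tendsto_intros) auto
  then have 1: "eventually (\<lambda>x. (1 + x) / (1 - x) ^ k < 1 + e) (at_right 0)"
    using assms by (intro order_tendstoD(2)) auto
  have "((\<lambda>x::real. (1 - x) / (1 + x) ^ k) \<longlongrightarrow> (1 - 0) / (1 + 0) ^ k) (at_right 0)"
    by (intro tendsto_intros) auto
  then have 2: "eventually (\<lambda>x. 1 - e < (1 - x) / (1 + x) ^ k) (at_right 0)"
    using assms by (intro order_tendstoD(1)) auto
  have 3: "eventually (\<lambda>x::real. x \<in> {0<..<1}) (at_right 0)"
    by (rule eventually_at_right_real) simp
  from eventually_happens'[OF _ eventually_conj[OF 1 eventually_conj[OF 2 3]]]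
  obtain x where "(1 + x) / (1 - x) ^ k < 1 + e" "1 - e < (1 - x) / (1 + x) ^ k" "x \<in> {0<..<1}" by auto
  then show ?thesis using that[of x] by auto
qed

text \<open>Near \<open>p\<close>, strict differentiability squeezes the preimage of a ball of radius \<open>r\<close> about \<open>\<Psi> x\<close>
  between the ellipsoids \<open>\<parallel>L (x' - x)\<parallel> < r / (1 \<plusminus> e1)\<close>, and the density of the chart measure is
  almost \<open>sqrt (gram B L)\<close>, which cancels the Gram determinant in the volume of the ellipsoid. This cancellation
  makes the density on balls independent of the chart.\<close>
lemma chart_measure_density:
  fixes S :: "'a::euclidean_space set"
  assumes c: "slice_chart k S U W \<Phi> \<Psi> B" and p: "p \<in> S" "p \<in> U" and e: "e > 0"
  obtains \<rho> where "\<rho> > 0" "ball p \<rho> \<subseteq> U"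
    "\<And>y r. y \<in> S \<Longrightarrow> y \<in> ball p \<rho> \<Longrightarrow> 0 < r \<Longrightarrow> r < \<rho> \<Longrightarrow>
      ennreal ((1 - e) * (unit_ball_vol (real k) * r ^ k)) \<le> emeasure (chart_measure W \<Psi> B) (ball y r) \<and>
      emeasure (chart_measure W \<Psi> B) (ball y r) \<le> ennreal ((1 + e) * (unit_ball_vol (real k) * r ^ k))"
proof -
  note C = slice_chartD[OF c]
  obtain e1 where e1: "0 < e1" "e1 < 1" "(1 + e1) / (1 - e1) ^ k \<le> 1 + e" "1 - e \<le> (1 - e1) / (1 + e1) ^ k"
    using shrink_constant[OF e] by blast
  define x0 where "x0 = \<Phi> p"
  have x0: "x0 \<in> W" "x0 \<in> span B" "\<Psi> x0 = p" using C p by (auto simp: x0_def)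
  define L where "L = frechet_derivative \<Psi> (at x0)"
  note D = slice_chart_derivatives[OF c x0(1), folded L_def]
  interpret L: linear L by (rule D(2))
  define J where "J = (\<lambda>x. sqrt (gram_det B \<Psi> x))"
  have G0: "gram B L > 0" by (rule coord_lborel_ellipsoid(1)[OF C(3) D(2) D(6) span_zero zero_less_one])
  then have J0: "J x0 > 0" by (simp add: J_def gram_det_eq_gram L_def)
  obtain a where a: "a > 0" "\<And>u. u \<in> span B \<Longrightarrow> a * norm u \<le> norm (L u)"
  proof -
    have "\<forall>x\<in>span B. L x = 0 \<longrightarrow> x = 0"
      using D(6) L.zero by (metis injD)
    then have "\<exists>e>0. \<forall>x\<in>span B. norm (L x) \<ge> e * norm x"
      using D(2) by (intro injective_imp_isometric closed_span subspace_span) (simp_all add: linear_linear)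
    then show ?thesis using that by blast
  qed
  obtain d1 where d1: "d1 > 0" "ball x0 d1 \<subseteq> W"
    "\<And>x x'. x \<in> ball x0 d1 \<Longrightarrow> x' \<in> ball x0 d1 \<Longrightarrow> norm (\<Psi> x' - \<Psi> x - L (x' - x)) \<le> (e1 * a) * norm (x' - x)"
  proof (rule C1_strict_derivative[OF C(2) x0(1), of \<Psi> "\<lambda>x. frechet_derivative \<Psi> (at x)" "e1 * a"])
    show "\<And>x. x \<in> W \<Longrightarrow> (\<Psi> has_derivative frechet_derivative \<Psi> (at x)) (at x)"
      using slice_chart_derivatives(1)[OF c] .
    show "\<And>v. continuous_on W (\<lambda>x. frechet_derivative \<Psi> (at x) v)" by (rule C(15))
    show "e1 * a > 0" using e1 a by simp
  qed (use that in \<open>simp add: L_def\<close>)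
  have "continuous_on W J" unfolding J_def by (intro continuous_intros continuous_on_gram_det[OF c])
  then have "(J \<longlongrightarrow> J x0) (at x0)" using C(2) x0 by (simp add: continuous_on_eq_continuous_at isCont_def)
  then have "eventually (\<lambda>x. J x < (1 + e1) * J x0 \<and> (1 - e1) * J x0 < J x) (at x0)"
    using e1 J0 by (intro eventually_conj order_tendstoD) auto
  then obtain d2 where d2: "d2 > 0"
    "\<And>x. x \<noteq> x0 \<Longrightarrow> dist x x0 < d2 \<Longrightarrow> J x < (1 + e1) * J x0 \<and> (1 - e1) * J x0 < J x"
    unfolding eventually_at by auto
  have Jb: "J x \<le> (1 + e1) * J x0 \<and> (1 - e1) * J x0 \<le> J x" if "dist x x0 < d2" for x
  proof (cases "x = x0")
    case True
    have "0 \<le> e1 * J x0" using e1 J0 by simp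
    then show ?thesis unfolding True by (simp add: algebra_simps)
  qed (use d2(2)[of x] that in auto)
  define d where "d = min d1 d2"
  have d: "d > 0" using d1 d2 by (simp add: d_def)
  have cmp: "(1 - e1) * norm (L (x' - x)) \<le> norm (\<Psi> x' - \<Psi> x) \<and> norm (\<Psi> x' - \<Psi> x) \<le> (1 + e1) * norm (L (x' - x))"
    if x: "x \<in> span B" "x' \<in> span B" "x \<in> ball x0 d" "x' \<in> ball x0 d" for x x'
  proof -
    have "norm (\<Psi> x' - \<Psi> x - L (x' - x)) \<le> e1 * (a * norm (x' - x))"
      using d1(3)[of x x'] x by (simp add: d_def mult.assoc)
    also have "\<dots> \<le> e1 * norm (L (x' - x))"
      using e1 a(2)[of "x' - x"] x by (intro mult_left_mono) (auto intro: span_diff)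
    finally have "norm (\<Psi> x' - \<Psi> x - L (x' - x)) \<le> e1 * norm (L (x' - x))" .
    then show ?thesis
      using norm_triangle_ineq2[of "\<Psi> x' - \<Psi> x" "L (x' - x)"] norm_triangle_ineq3[of "\<Psi> x' - \<Psi> x" "L (x' - x)"]
      by (simp add: algebra_simps abs_le_iff)
  qed
  have "isCont \<Phi> p" using C(1,6) p by (simp add: continuous_on_eq_continuous_at)
  then obtain d3 where d3: "d3 > 0" "\<And>y. dist y p < d3 \<Longrightarrow> dist (\<Phi> y) x0 < d / 2"
    unfolding x0_def continuous_at_eps_delta using d by (metis half_gt_zero)
  obtain d4 where d4: "d4 > 0" "ball p d4 \<subseteq> U" using C(1) p openE by blast
  define \<rho> where "\<rho> = min (min (d3 / 2) (d4 / 2)) (a * d / 2)"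
  have \<rho>: "\<rho> > 0" "2 * \<rho> \<le> d3" "2 * \<rho> \<le> d4" "\<rho> \<le> a * d / 2" using a d d3 d4 by (auto simp: \<rho>_def)
  let ?M = "chart_measure W \<Psi> B" and ?w = "unit_ball_vol (real k)"
  have wpos: "?w > 0" by simp
  have "ennreal ((1 - e) * (?w * r ^ k)) \<le> emeasure ?M (ball y r) \<and>
      emeasure ?M (ball y r) \<le> ennreal ((1 + e) * (?w * r ^ k))"
    if y: "y \<in> S" "y \<in> ball p \<rho>" and r: "0 < r" "r < \<rho>" for y r
  proof -
    have yU: "y \<in> U" using y d4 \<rho> by (auto simp: subset_iff)
    define x where "x = \<Phi> y"
    have x: "x \<in> span B" "x \<in> W" "\<Psi> x = y" using C yU y by (auto simp: x_def)
    have dx: "dist x x0 < d / 2" unfolding x_def using y \<rho> by (intro d3(2)) (auto simp: dist_commute)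
    have xd: "x \<in> ball x0 d" using dx d by (simp add: dist_commute)
    define E where "E = (\<lambda>s. {x'. norm (L (x' - x)) < s})"
    have Eb: "E s \<in> sets (coord_lborel B)" for s
      unfolding E_def by (simp, intro borel_open open_Collect_less continuous_intros
         linear_continuous_on_compose[OF _ D(2)])
    have Em: "emeasure (coord_lborel B) (E s) = ennreal (?w * s ^ k / J x0)" if "s > 0" for s
      unfolding E_def using coord_lborel_ellipsoid(2)[OF C(3) D(2) D(6) x(1) that] C(5)
      by (simp add: J_def gram_det_eq_gram L_def)
    let ?T = "{x' \<in> span B \<inter> W. \<Psi> x' \<in> ball y r}"
    have M: "emeasure ?M (ball y r) = (\<integral>\<^sup>+ x. ennreal (J x) * indicator ?T x \<partial>coord_lborel B)"
      unfolding J_def by (rule emeasure_chart_measure[OF c]) simp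
    have "emeasure ?M (ball y r) \<le> (\<integral>\<^sup>+ x. ennreal ((1 + e1) * J x0) * indicator (E (r / (1 - e1))) x \<partial>coord_lborel B)"
      unfolding M
    proof (rule nn_integral_mono)
      fix x'
      show "ennreal (J x') * indicator ?T x' \<le> ennreal ((1 + e1) * J x0) * indicator (E (r / (1 - e1))) x'"
      proof (cases "x' \<in> ?T")
        case True
        then have "dist (\<Psi> x') p < d3" using y r \<rho> dist_triangle[of "\<Psi> x'" p y] by (auto simp: dist_commute)
        then have "dist x' x0 < d / 2" using d3(2)[of "\<Psi> x'"] C True by auto
        then have d': "x' \<in> ball x0 d" "dist x' x0 < d2" using d by (auto simp: dist_commute d_def)
        have "(1 - e1) * norm (L (x' - x)) < r"
          using cmp[of x x'] True x xd d' by (auto simp: dist_norm norm_minus_commute)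
        then have "x' \<in> E (r / (1 - e1))" using e1 by (simp add: E_def field_simps)
        moreover have "J x' \<le> (1 + e1) * J x0" using Jb d' by blast
        ultimately show ?thesis using True by (simp add: ennreal_leI)
      qed simp
    qed
    also have "\<dots> = ennreal ((1 + e1) * J x0 * (?w * (r / (1 - e1)) ^ k / J x0))"
      using Eb e1 r J0 by (simp add: nn_integral_cmult Em ennreal_mult'[symmetric])
    also have "(1 + e1) * J x0 * (?w * (r / (1 - e1)) ^ k / J x0) = ((1 + e1) / (1 - e1) ^ k) * (?w * r ^ k)"
      using J0 by (simp add: power_divide)
    also have "ennreal \<dots> \<le> ennreal ((1 + e) * (?w * r ^ k))"
      using e1 r by (intro ennreal_leI mult_right_mono) auto
    finally have up: "emeasure ?M (ball y r) \<le> ennreal ((1 + e) * (?w * r ^ k))" .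
    have "ennreal ((1 - e) * (?w * r ^ k)) \<le> ennreal (((1 - e1) / (1 + e1) ^ k) * (?w * r ^ k))"
      using e1 r by (intro ennreal_leI mult_right_mono) auto
    also have "((1 - e1) / (1 + e1) ^ k) * (?w * r ^ k) = (1 - e1) * J x0 * (?w * (r / (1 + e1)) ^ k / J x0)"
      using J0 by (simp add: power_divide)
    also have "ennreal \<dots> = (\<integral>\<^sup>+ x. ennreal ((1 - e1) * J x0) * indicator (E (r / (1 + e1))) x \<partial>coord_lborel B)"
      using Eb e1 r J0 by (simp add: nn_integral_cmult Em ennreal_mult'[symmetric])
    also have "\<dots> \<le> emeasure ?M (ball y r)"
      unfolding M
    proof (rule nn_integral_mono_AE)
      show "AE x' in coord_lborel B. ennreal ((1 - e1) * J x0) * indicator (E (r / (1 + e1))) x' \<le> ennreal (J x') * indicator ?T x'"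
        using AE_coord_lborel_span[OF C(4)]
      proof eventually_elim
        case (elim x')
        show ?case
        proof (cases "x' \<in> E (r / (1 + e1))")
          case True
          then have "(1 + e1) * norm (L (x' - x)) < r" using e1 by (simp add: E_def field_simps)
          moreover have "norm (L (x' - x)) \<le> (1 + e1) * norm (L (x' - x))" using e1 by (simp add: mult_le_cancel_right1)
          moreover have "a * norm (x' - x) \<le> norm (L (x' - x))" using elim x by (intro a(2) span_diff)
          ultimately have "a * norm (x' - x) < a * (d / 2)" using r \<rho> by linarith
          then have "norm (x' - x) < d / 2" using a by simp
          then have dd: "dist x' x0 < d" using dx dist_triangle[of x' x0 x] by (simp add: dist_norm)
          then have d': "x' \<in> ball x0 d" "dist x' x0 < d2" "x' \<in> W" using d1(2) by (auto simp: dist_commute d_def)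
          have "norm (\<Psi> x' - \<Psi> x) < r"
            using cmp[of x x'] elim x xd d' \<open>(1 + e1) * norm (L (x' - x)) < r\<close> by auto
          then have "x' \<in> ?T" using elim d' x by (simp add: dist_norm norm_minus_commute)
          moreover have "(1 - e1) * J x0 \<le> J x'" using Jb d' by blast
          ultimately show ?thesis using True by (simp add: ennreal_leI)
        qed simp
      qed
    qed
    finally show ?thesis using up by blast
  qed
  moreover have "ball p \<rho> \<subseteq> U" using d4 \<rho> by (auto simp: subset_iff)
  ultimately show ?thesis using that[of \<rho>] \<rho>(1) by blast
qed

section \<open>Measures with the same density on small balls\<close>

text \<open>The argument of Christensen's theorem on uniformly distributed measures. By Fatou's lemma, \<open>\<mu> G\<close>
  is at most the lower limit of \<open>\<integral> \<nu> (ball x (r n)) / c n \<partial>\<mu>\<close>. By Tonelli's theorem and the symmetry of the distance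
  the roles of \<open>\<mu>\<close> and \<open>\<nu>\<close> in this integral can be exchanged, and then the upper bound for \<open>\<mu>\<close>
  applies.\<close>
lemma uniform_density_le:
  fixes \<mu> \<nu> :: "'a::euclidean_space measure"
  assumes sets: "sets \<mu> = sets borel" "sets \<nu> = sets borel" and G: "G \<in> sets borel"
    and fin: "emeasure \<mu> G < \<infinity>" "emeasure \<nu> G < \<infinity>"
    and c: "\<And>n. c n > 0"
    and dens_\<nu>: "\<And>x e. x \<in> G \<Longrightarrow> e > 0 \<Longrightarrow>
        eventually (\<lambda>n. ennreal ((1 - e) * c n) \<le> emeasure \<nu> (ball x (r n) \<inter> G)) sequentially"
    and e: "e > 0"
    and dens_\<mu>: "
        eventually (\<lambda>n. \<forall>y\<in>G. emeasure \<mu> (ball y (r n) \<inter> G) \<le> ennreal ((1 + e) * c n)) sequentially"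
  shows "emeasure \<mu> G \<le> ennreal (1 + e) * emeasure \<nu> G"
proof -
  define \<mu>' where "\<mu>' = density \<mu> (indicator G)"
  define \<nu>' where "\<nu>' = density \<nu> (indicator G)"
  have s[simp, measurable_cong]: "sets \<mu>' = sets borel" "sets \<nu>' = sets borel"
    by (simp_all add: \<mu>'_def \<nu>'_def sets)
  have sp[simp]: "space \<mu>' = UNIV" "space \<nu>' = UNIV"
    using sets_eq_imp_space_eq[OF s(1)] sets_eq_imp_space_eq[OF s(2)] by simp_all
  have em: "emeasure \<mu>' A = emeasure \<mu> (A \<inter> G)" "emeasure \<nu>' A = emeasure \<nu> (A \<inter> G)" if "A \<in> sets borel" for A
    using emeasure_restricted[of G \<mu> A] emeasure_restricted[of G \<nu> A] that G
    unfolding \<mu>'_def \<nu>'_def by (simp_all add: sets Int_commute)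
  interpret m: finite_measure \<mu>' by standard (use fin em[of UNIV] in auto)
  interpret n: finite_measure \<nu>' by standard (use fin em[of UNIV] in auto)
  interpret pair_sigma_finite \<mu>' \<nu>' ..
  have AEm: "AE x in \<mu>'. x \<in> G" and AEn: "AE x in \<nu>'. x \<in> G"
    using G unfolding \<mu>'_def \<nu>'_def by (simp_all add: indicator_def AE_density measurable_cong_sets[OF sets(1) refl]
      measurable_cong_sets[OF sets(2) refl])
  have [measurable]: "Measurable.pred (borel \<Otimes>\<^sub>M borel) (\<lambda>p::'a \<times> 'a. dist (fst p) (snd p) < r n)" for n
    by measurable
  let ?T = "\<lambda>n. indicator {p::'a \<times> 'a. dist (fst p) (snd p) < r n} :: _ \<Rightarrow> ennreal"
  have T[measurable]: "?T n \<in> borel_measurable (borel \<Otimes>\<^sub>M borel)" for n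
    by measurable
  have ind: "(\<integral>\<^sup>+y. ?T n (x, y) \<partial>\<nu>') = emeasure \<nu>' (ball x (r n))"
     "(\<integral>\<^sup>+x. ?T n (x, y) \<partial>\<mu>') = emeasure \<mu>' (ball y (r n))" for x y n
  proof -
    have i1: "?T n (x, y) = indicator (ball x (r n)) y" and i2: "?T n (x, y) = indicator (ball y (r n)) x" for x y
      by (auto simp: indicator_def dist_commute)
    show "(\<integral>\<^sup>+y. ?T n (x, y) \<partial>\<nu>') = emeasure \<nu>' (ball x (r n))"
      unfolding i1 by simp
    show "(\<integral>\<^sup>+x. ?T n (x, y) \<partial>\<mu>') = emeasure \<mu>' (ball y (r n))"
      unfolding i2 by simp
  qed
  have meas[measurable]: "(\<lambda>x. emeasure \<nu>' (ball x (r n))) \<in> borel_measurable \<mu>'" for n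
    unfolding ind[symmetric] by measurable
    have "emeasure \<mu> G = (\<integral>\<^sup>+x. 1 \<partial>\<mu>')" using em(1)[of UNIV] by simp
    also have "\<dots> \<le> (\<integral>\<^sup>+x. liminf (\<lambda>n. emeasure \<nu>' (ball x (r n)) / ennreal (c n)) \<partial>\<mu>')"
    proof (rule nn_integral_mono_AE)
      show "AE x in \<mu>'. 1 \<le> liminf (\<lambda>n. emeasure \<nu>' (ball x (r n)) / ennreal (c n))"
        using AEm
      proof eventually_elim
        case (elim x)
        have "ennreal (1 - d) \<le> liminf (\<lambda>n. emeasure \<nu>' (ball x (r n)) / ennreal (c n))" if d: "d > 0" for d
        proof (rule Liminf_bounded)
          show "eventually (\<lambda>n. ennreal (1 - d) \<le> emeasure \<nu>' (ball x (r n)) / ennreal (c n)) sequentially"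
            using dens_\<nu>[OF elim d]
          proof eventually_elim
            case (elim n)
            have "ennreal (1 - d) = ennreal ((1 - d) * c n) / ennreal (c n)"
              using c[of n] by (cases "d \<le> 1") (auto simp: divide_ennreal ennreal_neg mult_le_0_iff)
            also have "\<dots> \<le> emeasure \<nu>' (ball x (r n)) / ennreal (c n)"
              using elim by (simp add: em divide_right_mono_ennreal)
            finally show ?case .
          qed
        qed
        note lo = this
        show ?case
        proof (rule tendsto_upperbound)
          have "((\<lambda>d. ennreal (1 - d)) \<longlongrightarrow> ennreal (1 - 0)) (at_right 0)"
            by (intro tendsto_ennrealI tendsto_intros)
          then show "((\<lambda>d. ennreal (1 - d)) \<longlongrightarrow> 1) (at_right 0)" by simp
          show "eventually (\<lambda>d. ennreal (1 - d) \<le> liminf (\<lambda>n. emeasure \<nu>' (ball x (r n)) / ennreal (c n))) (at_right 0)"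
            using eventually_at_right_less[of "0::real"] by eventually_elim (rule lo)
        qed simp
      qed
    qed
    also have "\<dots> \<le> liminf (\<lambda>n. \<integral>\<^sup>+x. emeasure \<nu>' (ball x (r n)) / ennreal (c n) \<partial>\<mu>')"
      by (rule nn_integral_liminf) measurable
    also have "\<dots> \<le> ennreal (1 + e) * emeasure \<nu> G"
    proof (rule Liminf_le)
      show "eventually (\<lambda>n. (\<integral>\<^sup>+x. emeasure \<nu>' (ball x (r n)) / ennreal (c n) \<partial>\<mu>') \<le> ennreal (1 + e) * emeasure \<nu> G) sequentially"
        using dens_\<mu>
      proof eventually_elim
        case (elim n)
        have "(\<integral>\<^sup>+x. emeasure \<nu>' (ball x (r n)) \<partial>\<mu>') = (\<integral>\<^sup>+x. \<integral>\<^sup>+y. ?T n (x, y) \<partial>\<nu>' \<partial>\<mu>')"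
          by (simp only: ind)
        also have "\<dots> = (\<integral>\<^sup>+y. \<integral>\<^sup>+x. ?T n (x, y) \<partial>\<mu>' \<partial>\<nu>')"
          by (rule Fubini'[symmetric]) (simp only: case_prod_eta, measurable)
        also have "\<dots> = (\<integral>\<^sup>+y. emeasure \<mu>' (ball y (r n)) \<partial>\<nu>')"
          by (simp only: ind)
        also have "\<dots> \<le> (\<integral>\<^sup>+y. ennreal ((1 + e) * c n) \<partial>\<nu>')"
          by (rule nn_integral_mono_AE) (use AEn elim in \<open>auto simp: em\<close>)
        also have "\<dots> = ennreal (c n) * (ennreal (1 + e) * emeasure \<nu> G)"
          using em(2)[of UNIV] c[of n] e by (simp add: ennreal_mult' mult_ac)
        finally have "(\<integral>\<^sup>+x. emeasure \<nu>' (ball x (r n)) \<partial>\<mu>') / ennreal (c n) \<le>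
           ennreal (c n) * (ennreal (1 + e) * emeasure \<nu> G) / ennreal (c n)"
          by (rule divide_right_mono_ennreal)
        also have "\<dots> = ennreal (1 + e) * emeasure \<nu> G"
          using c[of n] by (simp add: ennreal_mult_divide_eq mult.commute[of "ennreal (c n)"])
        finally show ?case by (simp add: nn_integral_divide)
      qed
    qed simp
    finally show ?thesis .
qed

lemma chart_piece_borel:
  assumes c: "slice_chart k S U W \<Phi> \<Psi> B"
  shows "S \<inter> U \<in> sets borel"
proof -
  note C = slice_chartD[OF c]
  have "closedin (top_of_set U) (U \<inter> \<Phi> -` span B)"
    by (rule continuous_closedin_preimage[OF C(6)]) simp
  then obtain T where "closed T" "U \<inter> \<Phi> -` span B = U \<inter> T" by (metis closedin_closed Int_commute)
  moreover have "S \<inter> U = U \<inter> \<Phi> -` span B" using C(12) by auto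
  ultimately show ?thesis using C(1) by simp
qed

lemma chart_measure_concentrated:
  assumes c: "slice_chart k S U W \<Phi> \<Psi> B" and A: "A \<in> sets borel"
  shows "emeasure (chart_measure W \<Psi> B) (A \<inter> S \<inter> U) = emeasure (chart_measure W \<Psi> B) A"
proof -
  note C = slice_chartD[OF c]
  have "A \<inter> S \<inter> U \<in> sets borel" using A chart_piece_borel[OF c] by (simp add: Int_assoc)
  moreover have "{x \<in> span B \<inter> W. \<Psi> x \<in> A \<inter> S \<inter> U} = {x \<in> span B \<inter> W. \<Psi> x \<in> A}"
    using C by (auto simp: C(12))
  ultimately show ?thesis by (simp only: emeasure_chart_measure[OF c] A)
qed

text \<open>The neighbourhood depends on \<open>e\<close>, because the density bounds are uniform only near \<open>p\<close> for a fixed \<open>e\<close>. The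
  comparison holds first on relatively open sets, where small balls about a point stay inside
  the set, and passes to Borel sets by outer regularity.\<close>
lemma chart_measures_locally_le:
  fixes S :: "'a::euclidean_space set"
  assumes c1: "slice_chart k S U1 W1 \<Phi>1 \<Psi>1 B1" and c2: "slice_chart k S U2 W2 \<Phi>2 \<Psi>2 B2"
    and p: "p \<in> S" "p \<in> U1" "p \<in> U2" and e: "e > 0"
  obtains d where "d > 0"
    "\<And>A. A \<in> sets borel \<Longrightarrow> A \<subseteq> S \<inter> ball p d \<Longrightarrow>
      emeasure (chart_measure W1 \<Psi>1 B1) A \<le> ennreal (1 + e) * emeasure (chart_measure W2 \<Psi>2 B2) A"
proof -
  let ?M1 = "chart_measure W1 \<Psi>1 B1" and ?M2 = "chart_measure W2 \<Psi>2 B2"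
  let ?w = "\<lambda>r. unit_ball_vol (real k) * r ^ k"
  obtain d1 where d1: "d1 > 0" "ball p d1 \<subseteq> U1" "\<And>y r. y \<in> S \<Longrightarrow> y \<in> ball p d1 \<Longrightarrow> 0 < r \<Longrightarrow> r < d1 \<Longrightarrow>
      ennreal ((1 - e) * ?w r) \<le> emeasure ?M1 (ball y r) \<and> emeasure ?M1 (ball y r) \<le> ennreal ((1 + e) * ?w r)"
    using chart_measure_density[OF c1 p(1,2) e] by metis
  obtain d2 where d2: "d2 > 0" "ball p d2 \<subseteq> U2" "\<And>y r. y \<in> S \<Longrightarrow> y \<in> ball p d2 \<Longrightarrow> 0 < r \<Longrightarrow> r < d2 \<Longrightarrow>
      ennreal ((1 - 1) * ?w r) \<le> emeasure ?M2 (ball y r) \<and> emeasure ?M2 (ball y r) \<le> ennreal ((1 + 1) * ?w r)"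
    using chart_measure_density[OF c2 p(1,3) zero_less_one] by metis
  define d where "d = min d1 d2 / 2"
  have d: "0 < d" "d < d1" "d < d2" using d1(1) d2(1) by (auto simp: d_def)
  have dU: "ball p d \<subseteq> U1" "ball p d \<subseteq> U2"
    using d1(2) d2(2) d subset_ball[of d d1 p] subset_ball[of d d2 p] by auto
  define Q where "Q = S \<inter> ball p d"
  have "Q = (S \<inter> U1) \<inter> ball p d" using dU by (auto simp: Q_def)
  then have Q: "Q \<in> sets borel" using chart_piece_borel[OF c1] by simp
  have fin1: "emeasure ?M1 (ball p d) < \<infinity>"
    using d1(3)[of p d] p d by (auto intro: le_less_trans)
  have fin2: "emeasure ?M2 (ball p d) < \<infinity>"
    using d2(3)[of p d] p d by (auto intro: le_less_trans)
  have le_open: "emeasure ?M1 (Q \<inter> V) \<le> ennreal (1 + e) * emeasure ?M2 (Q \<inter> V)" if V: "open V" for V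
  proof (rule uniform_density_le[where r = "\<lambda>n. 1 / real (Suc n)" and c = "\<lambda>n. ?w (1 / real (Suc n))"])
    show QV: "Q \<inter> V \<in> sets borel" using Q V by simp
    show "emeasure ?M1 (Q \<inter> V) < \<infinity>"
      by (rule le_less_trans[OF emeasure_mono fin1]) (auto simp: Q_def)
    show "emeasure ?M2 (Q \<inter> V) < \<infinity>"
      by (rule le_less_trans[OF emeasure_mono fin2]) (auto simp: Q_def)
    show "\<And>n. ?w (1 / real (Suc n)) > 0" by simp
    have r0: "eventually (\<lambda>n. 1 / real (Suc n) < t) sequentially" if "t > 0" for t
      using LIMSEQ_inverse_real_of_nat that by (auto dest!: order_tendstoD(2) simp: inverse_eq_divide)
    show "eventually (\<lambda>n. \<forall>y\<in>Q \<inter> V. emeasure ?M1 (ball y (1 / real (Suc n)) \<inter> (Q \<inter> V))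
        \<le> ennreal ((1 + e) * ?w (1 / real (Suc n)))) sequentially"
      using r0[OF d1(1)]
    proof eventually_elim
      case (elim n)
      show ?case
      proof
        fix y assume y: "y \<in> Q \<inter> V"
        have "emeasure ?M1 (ball y (1 / real (Suc n)) \<inter> (Q \<inter> V)) \<le> emeasure ?M1 (ball y (1 / real (Suc n)))"
          by (rule emeasure_mono) auto
        also have "\<dots> \<le> ennreal ((1 + e) * ?w (1 / real (Suc n)))"
          using d1(3)[of y "1 / real (Suc n)"] y d elim by (auto simp: Q_def)
        finally show "emeasure ?M1 (ball y (1 / real (Suc n)) \<inter> (Q \<inter> V)) \<le> ennreal ((1 + e) * ?w (1 / real (Suc n)))" .
      qed
    qed
    show "eventually (\<lambda>n. ennreal ((1 - t) * ?w (1 / real (Suc n))) \<le>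
        emeasure ?M2 (ball x (1 / real (Suc n)) \<inter> (Q \<inter> V))) sequentially"
      if x: "x \<in> Q \<inter> V" and t: "t > 0" for x t
    proof -
      have xS: "x \<in> S" "x \<in> U2" using x dU by (auto simp: Q_def)
      obtain d3 where d3: "d3 > 0" "\<And>y r. y \<in> S \<Longrightarrow> y \<in> ball x d3 \<Longrightarrow> 0 < r \<Longrightarrow> r < d3 \<Longrightarrow>
         ennreal ((1 - t) * ?w r) \<le> emeasure ?M2 (ball y r) \<and> emeasure ?M2 (ball y r) \<le> ennreal ((1 + t) * ?w r)"
        using chart_measure_density[OF c2 xS t] by metis
      have "open (ball p d \<inter> V)" "x \<in> ball p d \<inter> V" using V x by (auto simp: Q_def)
      then obtain d4 where d4: "d4 > 0" "ball x d4 \<subseteq> ball p d \<inter> V" by (metis openE)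
      have "min d3 d4 > 0" using d3 d4 by simp
      from r0[OF this] show ?thesis
      proof eventually_elim
        case (elim n)
        let ?r = "1 / real (Suc n)"
        have "ball x ?r \<subseteq> ball x d4" using elim by (intro subset_ball) simp
        then have sub: "ball x ?r \<inter> (Q \<inter> V) = ball x ?r \<inter> S \<inter> U2"
          using d4 dU by (auto simp: Q_def)
        have "ennreal ((1 - t) * ?w ?r) \<le> emeasure ?M2 (ball x ?r)"
          using d3 elim xS by auto
        also have "\<dots> = emeasure ?M2 (ball x ?r \<inter> (Q \<inter> V))"
          unfolding sub by (rule chart_measure_concentrated[OF c2, symmetric]) simp
        finally show ?case .
      qed
    qed
  qed (use e in auto)
  have le: "emeasure ?M1 A \<le> ennreal (1 + e) * emeasure ?M2 A" if A: "A \<in> sets borel" "A \<subseteq> S \<inter> ball p d" for A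
  proof -
    define \<nu> where "\<nu> = density ?M2 (indicator Q)"
    have s: "sets \<nu> = sets borel" by (simp add: \<nu>_def)
    have em: "emeasure \<nu> X = emeasure ?M2 (Q \<inter> X)" if "X \<in> sets borel" for X
      using that Q unfolding \<nu>_def by (simp add: emeasure_restricted)
    have "emeasure \<nu> (space \<nu>) \<noteq> \<infinity>"
    proof -
      have "emeasure ?M2 Q < \<infinity>"
        by (rule le_less_trans[OF emeasure_mono fin2]) (auto simp: Q_def)
      then show ?thesis using em[of UNIV] sets_eq_imp_space_eq[OF s] by simp
    qed
    then have "emeasure \<nu> A = (INF V\<in>{V. A \<subseteq> V \<and> open V}. emeasure \<nu> V)"
      using A s by (intro outer_regular) auto
    moreover have "emeasure ?M1 A / ennreal (1 + e) \<le> (INF V\<in>{V. A \<subseteq> V \<and> open V}. emeasure \<nu> V)"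
    proof (rule INF_greatest)
      fix V assume V: "V \<in> {V. A \<subseteq> V \<and> open V}"
      have "emeasure ?M1 A \<le> emeasure ?M1 (Q \<inter> V)"
        using V A Q by (intro emeasure_mono) (auto simp: Q_def)
      also have "\<dots> \<le> ennreal (1 + e) * emeasure ?M2 (Q \<inter> V)" using V by (intro le_open) auto
      also have "\<dots> = ennreal (1 + e) * emeasure \<nu> V" using V by (simp add: em)
      finally have "emeasure ?M1 A / ennreal (1 + e) \<le> ennreal (1 + e) * emeasure \<nu> V / ennreal (1 + e)"
        by (rule divide_right_mono_ennreal)
      also have "\<dots> = emeasure \<nu> V"
        using e by (subst mult.commute) (rule ennreal_mult_divide_eq, auto)
      finally show "emeasure ?M1 A / ennreal (1 + e) \<le> emeasure \<nu> V" .
    qed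
    ultimately have "emeasure ?M1 A / ennreal (1 + e) \<le> emeasure \<nu> A" by simp
    then have "emeasure ?M1 A / ennreal (1 + e) * ennreal (1 + e) \<le> emeasure \<nu> A * ennreal (1 + e)"
      by (rule mult_right_mono) simp
    moreover have "emeasure ?M1 A / ennreal (1 + e) * ennreal (1 + e) = emeasure ?M1 A"
      using e by (simp add: ennreal_divide_times ennreal_mult_divide_eq)
    moreover have "Q \<inter> A = A" using A by (auto simp: Q_def)
    ultimately show ?thesis using em[OF A(1)] by (simp add: mult.commute)
  qed
  show ?thesis using that[of d] d(1) le by auto
qed

text \<open>Countably many of the neighbourhoods of the local comparison cover \<open>A\<close>. The factor \<open>1 + e\<close> is the
  same for all of them, so it survives the summation over disjoint pieces.\<close>
lemma chart_measures_le:
  fixes S :: "'a::euclidean_space set"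
  assumes c1: "slice_chart k S U1 W1 \<Phi>1 \<Psi>1 B1" and c2: "slice_chart k S U2 W2 \<Phi>2 \<Psi>2 B2"
    and A: "A \<in> sets borel" "A \<subseteq> S \<inter> U1 \<inter> U2" and e: "e > 0"
  shows "emeasure (chart_measure W1 \<Psi>1 B1) A \<le> ennreal (1 + e) * emeasure (chart_measure W2 \<Psi>2 B2) A"
proof (cases "A = {}")
  case False
  let ?M1 = "chart_measure W1 \<Psi>1 B1" and ?M2 = "chart_measure W2 \<Psi>2 B2"
  have "\<exists>d. d > 0 \<and> (\<forall>A'. A' \<in> sets borel \<longrightarrow> A' \<subseteq> S \<inter> ball p d \<longrightarrow> emeasure ?M1 A' \<le> ennreal (1 + e) * emeasure ?M2 A')"
    if "p \<in> A" for p
  proof -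
    have "p \<in> S" "p \<in> U1" "p \<in> U2" using that A by auto
    from chart_measures_locally_le[OF c1 c2 this e] show ?thesis by metis
  qed
  then obtain d where d: "\<And>p. p \<in> A \<Longrightarrow> d p > 0"
    "\<And>p A'. p \<in> A \<Longrightarrow> A' \<in> sets borel \<Longrightarrow> A' \<subseteq> S \<inter> ball p (d p) \<Longrightarrow> emeasure ?M1 A' \<le> ennreal (1 + e) * emeasure ?M2 A'"
    by metis
  obtain F where F: "F \<subseteq> (\<lambda>p. ball p (d p)) ` A" "countable F" "\<Union>F = \<Union>((\<lambda>p. ball p (d p)) ` A)"
    by (rule Lindelof[of "(\<lambda>p. ball p (d p)) ` A"]) auto
  have cov: "A \<subseteq> \<Union>F" unfolding F(3) using d(1) by force
  then have F0: "F \<noteq> {}" using False by auto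
  define b where "b = from_nat_into F"
  have b: "range b = F" unfolding b_def using F0 F(2) by (rule range_from_nat_into)
  have bo: "open (b n)" for n using b F(1) by (metis (no_types, lifting) imageE open_ball rangeI subsetD)
  define D where "D n = A \<inter> disjointed b n" for n
  have Db: "D n \<in> sets borel" for n
  proof -
    have "disjointed b n \<in> sets borel"
      unfolding disjointed_def using bo by (intro sets.Diff sets.finite_UN) auto
    then show ?thesis using A unfolding D_def by simp
  qed
  have dis: "disjoint_family D"
    using disjoint_family_disjointed[of b] by (auto simp: disjoint_family_on_def D_def)
  have un: "(\<Union>n. D n) = A" using cov b UN_disjointed_eq[of b] by (auto simp: D_def)
  have le: "emeasure ?M1 (D n) \<le> ennreal (1 + e) * emeasure ?M2 (D n)" for n
  proof -
    obtain p where p: "p \<in> A" "b n = ball p (d p)" using b F(1) by blast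
    show ?thesis using disjointed_subset[of b n] A p by (intro d(2)[OF p(1) Db]) (auto simp: D_def)
  qed
  have "emeasure ?M1 A = (\<Sum>n. emeasure ?M1 (D n))"
    using Db dis unfolding un[symmetric] by (intro suminf_emeasure[symmetric]) auto
  also have "\<dots> \<le> (\<Sum>n. ennreal (1 + e) * emeasure ?M2 (D n))" by (intro suminf_le le) auto
  also have "\<dots> = ennreal (1 + e) * (\<Sum>n. emeasure ?M2 (D n))" by simp
  also have "(\<Sum>n. emeasure ?M2 (D n)) = emeasure ?M2 A"
    using Db dis unfolding un[symmetric] by (intro suminf_emeasure) auto
  finally show ?thesis .
qed simp

lemma chart_measures_agree:
  fixes S :: "'a::euclidean_space set"
  assumes c1: "slice_chart k S U1 W1 \<Phi>1 \<Psi>1 B1" and c2: "slice_chart k S U2 W2 \<Phi>2 \<Psi>2 B2"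
    and A: "A \<in> sets borel" "A \<subseteq> S \<inter> U1 \<inter> U2"
  shows "emeasure (chart_measure W1 \<Psi>1 B1) A = emeasure (chart_measure W2 \<Psi>2 B2) A"
proof -
  have lim: "x \<le> y" if *: "\<And>e. e > 0 \<Longrightarrow> x \<le> ennreal (1 + e) * y" for x y :: ennreal
  proof (cases y)
    case (real b)
    show ?thesis
    proof (rule tendsto_lowerbound)
      have "((\<lambda>e. ennreal ((1 + e) * b)) \<longlongrightarrow> ennreal ((1 + 0) * b)) (at_right 0)"
        by (intro tendsto_ennrealI tendsto_intros)
      then show "((\<lambda>e. ennreal ((1 + e) * b)) \<longlongrightarrow> y) (at_right 0)" by (simp add: real)
      show "eventually (\<lambda>e. x \<le> ennreal ((1 + e) * b)) (at_right 0)"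
        using eventually_at_right_less[of "0::real"]
        by eventually_elim (use * real in \<open>auto simp: ennreal_mult'\<close>)
    qed simp
  qed simp
  have A': "A \<subseteq> S \<inter> U2 \<inter> U1" using A by auto
  show ?thesis
    using lim[OF chart_measures_le[OF c1 c2 A]] lim[OF chart_measures_le[OF c2 c1 A(1) A']] by (rule antisym)
qed

section \<open>The Riemannian volume measure\<close>

text \<open>The property that characterizes the Riemannian volume, with the chart integrals written as chart measures.\<close>
definition is_volume :: "nat \<Rightarrow> 'a::euclidean_space set \<Rightarrow> 'a measure \<Rightarrow> bool" where
  "is_volume k S \<mu> \<longleftrightarrow> sets \<mu> = sets (restrict_space borel S) \<and>
     (\<forall>U W \<Phi> \<Psi> B A. slice_chart k S U W \<Phi> \<Psi> B \<longrightarrow> A \<in> sets borel \<longrightarrow> A \<subseteq> S \<inter> U \<longrightarrow>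
        emeasure \<mu> A = emeasure (chart_measure W \<Psi> B) A)"

lemma riemannian_volume_eq: "riemannian_volume k S = (THE \<mu>. is_volume k S \<mu>)"
  unfolding riemannian_volume_def is_volume_def
  by (intro arg_cong[where f = The] ext conj_cong refl iff_allI imp_cong)
     (simp add: emeasure_chart_measure)

lemma sum_of_restrictions_measure:
  fixes M :: "nat \<Rightarrow> 'a::topological_space measure"
  assumes "\<And>i. sets (M i) = sets borel" "\<And>i. D i \<in> sets borel"
  obtains \<nu> where "sets \<nu> = sets borel" "\<And>A. A \<in> sets borel \<Longrightarrow> emeasure \<nu> A = (\<Sum>i<n. emeasure (M i) (A \<inter> D i))"
proof -
  define f where "f A = (\<Sum>i<n. emeasure (M i) (A \<inter> D i))" for A
  define \<nu> where "\<nu> = measure_of UNIV (sets (borel :: 'a measure)) f"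
  have sa: "sigma_algebra UNIV (sets (borel :: 'a measure))"
    using sets.sigma_algebra_axioms[of "borel :: 'a measure"] by simp
  have s: "sets \<nu> = sets borel" unfolding \<nu>_def
    using sigma_algebra.sets_measure_of_eq[OF sa] by simp
  have "emeasure \<nu> A = f A" if A: "A \<in> sets borel" for A
    unfolding \<nu>_def
  proof (rule emeasure_measure_of_sigma[OF sa _ _ A])
    show "positive (sets borel) f" by (auto simp: positive_def f_def)
    show "countably_additive (sets borel) f"
    proof (rule countably_additiveI)
      fix X :: "nat \<Rightarrow> 'a set" assume X: "range X \<subseteq> sets borel" "disjoint_family X"
      have "(\<Sum>j. f (X j)) = (\<Sum>i<n. \<Sum>j. emeasure (M i) (X j \<inter> D i))"
        unfolding f_def by (rule suminf_sum) simp
      also have "\<dots> = (\<Sum>i<n. emeasure (M i) ((\<Union>j. X j) \<inter> D i))"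
      proof (rule sum.cong[OF refl])
        fix i
        have "(\<Sum>j. emeasure (M i) (X j \<inter> D i)) = emeasure (M i) (\<Union>j. X j \<inter> D i)"
          using X assms by (intro suminf_emeasure) (auto simp: disjoint_family_on_def)
        then show "(\<Sum>j. emeasure (M i) (X j \<inter> D i)) = emeasure (M i) ((\<Union>j. X j) \<inter> D i)" by simp
      qed
      finally show "(\<Sum>j. f (X j)) = f (\<Union>j. X j)" by (simp add: f_def)
    qed
  qed
  then show ?thesis using that s f_def by metis
qed

lemma finite_atlas:
  fixes S :: "'a::euclidean_space set"
  assumes S: "compact S" "smooth_submanifold k S"
  obtains n U W \<Phi> \<Psi> B where "\<And>i. i < (n::nat) \<Longrightarrow> slice_chart k S (U i) (W i) (\<Phi> i) (\<Psi> i) (B i)"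
    "S \<subseteq> (\<Union>i<n. U i)"
proof -
  define chart where "chart p c \<longleftrightarrow> p \<in> fst c \<and>
    slice_chart k S (fst c) (fst (snd c)) (fst (snd (snd c))) (fst (snd (snd (snd c)))) (snd (snd (snd (snd c))))" for p c
  have "\<exists>c. chart p c" if "p \<in> S" for p
  proof -
    obtain U W \<Phi> \<Psi> B where "p \<in> U" "slice_chart k S U W \<Phi> \<Psi> B"
      using S(2) \<open>p \<in> S\<close> unfolding smooth_submanifold_def by auto
    then have "chart p (U, W, \<Phi>, \<Psi>, B)" by (simp add: chart_def)
    then show ?thesis by (rule exI)
  qed
  then obtain c where c': "\<And>p. p \<in> S \<Longrightarrow> chart p (c p)" by metis
  have c: "\<And>p. p \<in> S \<Longrightarrow> p \<in> fst (c p)"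
    "\<And>p. p \<in> S \<Longrightarrow> slice_chart k S (fst (c p)) (fst (snd (c p))) (fst (snd (snd (c p)))) (fst (snd (snd (snd (c p))))) (snd (snd (snd (snd (c p)))))"
    using c' by (auto simp: chart_def)
  have "open (fst (c p))" if "p \<in> S" for p using slice_chartD(1)[OF c(2)[OF that]] .
  then obtain P where P: "P \<subseteq> S" "finite P" "S \<subseteq> (\<Union>p\<in>P. fst (c p))"
    by (rule compactE_image[OF S(1), of S "\<lambda>p. fst (c p)"]) (use c(1) in auto)
  obtain h where h: "bij_betw h {..<card P} P"
    using ex_bij_betw_nat_finite[OF P(2)] by (auto simp: atLeast0LessThan)
  show ?thesis
  proof (rule that)
    fix i assume "i < card P"
    then have "h i \<in> S" using h P by (auto simp: bij_betw_def)
    from c(2)[OF this] show "slice_chart k S (fst (c (h i))) (fst (snd (c (h i)))) (fst (snd (snd (c (h i)))))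
      (fst (snd (snd (snd (c (h i)))))) (snd (snd (snd (snd (c (h i))))))" .
  next
    show "S \<subseteq> (\<Union>i<card P. fst (c (h i)))"
    proof -
      have "P = h ` {..<card P}" using h by (simp add: bij_betw_def)
      then show ?thesis using P(3) by (metis image_image)
    qed
  qed
qed

lemma emeasure_disjoint_pieces:
  fixes S :: "'a::euclidean_space set"
  assumes N: "\<And>X. X \<in> sets borel \<Longrightarrow> X \<subseteq> A \<Longrightarrow> X \<in> sets N" and A: "A \<in> sets borel" "A \<subseteq> (\<Union>i<n. D i)"
    and D: "\<And>i. i < n \<Longrightarrow> D i \<in> sets borel" and dis: "disjoint_family_on D {..<n}"
  shows "emeasure N A = (\<Sum>i<(n::nat). emeasure N (A \<inter> D i))"
proof -
  have "(\<Sum>i<n. emeasure N (A \<inter> D i)) = emeasure N (\<Union>i<n. A \<inter> D i)"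
  proof (rule sum_emeasure)
    show "(\<lambda>i. A \<inter> D i) ` {..<n} \<subseteq> sets N"
    proof
      fix X assume "X \<in> (\<lambda>i. A \<inter> D i) ` {..<n}"
      then obtain i where "i < n" "X = A \<inter> D i" by auto
      then show "X \<in> sets N" using A(1) D[of i] by (intro N) auto
    qed
    show "disjoint_family_on (\<lambda>i. A \<inter> D i) {..<n}"
      using dis unfolding disjoint_family_on_def by blast
  qed simp
  also have "(\<Union>i<n. A \<inter> D i) = A" using A by auto
  finally show ?thesis by simp
qed

text \<open>Both existence and uniqueness come from cutting \<open>S\<close> into disjoint Borel pieces \<open>D i\<close>, each inside the domain of
  one chart of a finite atlas. That the sum of the chart measures on the pieces satisfies the formula in
  every other chart is the agreement of chart measures on overlaps.\<close>
lemma ex1_volume: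
  fixes S :: "'a::euclidean_space set"
  assumes S: "compact S" "smooth_submanifold k S"
  shows "\<exists>!\<mu>. is_volume k S \<mu>"
proof -
  obtain n U W \<Phi> \<Psi> B where c: "\<And>i. i < (n::nat) \<Longrightarrow> slice_chart k S (U i) (W i) (\<Phi> i) (\<Psi> i) (B i)"
    and cov: "S \<subseteq> (\<Union>i<n. U i)"
    using finite_atlas[OF S] by metis
  have Sb: "S \<in> sets borel" using S(1) by (simp add: compact_imp_closed)
  define M where "M i = chart_measure (W i) (\<Psi> i) (B i)" for i
  define D where "D i = (if i < n then S \<inter> U i - (\<Union>j<i. U j) else {})" for i
  have Uo: "open (U i)" if "i < n" for i using slice_chartD(1)[OF c[OF that]] .
  have Db: "D i \<in> sets borel" for i
    using Sb Uo unfolding D_def by (auto intro!: sets.Diff sets.Int sets.finite_UN)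
  have dis: "disjoint_family_on D {..<n}"
    unfolding disjoint_family_on_def
  proof (intro ballI impI)
    fix i j assume "i \<in> {..<n}" "j \<in> {..<n}" "i \<noteq> j"
    then show "D i \<inter> D j = {}" by (cases "i < j") (auto simp: D_def)
  qed
  have covD: "S \<subseteq> (\<Union>i<n. D i)"
  proof
    fix x assume x: "x \<in> S"
    define i where "i = (LEAST i. x \<in> U i)"
    obtain i0 where i0: "i0 < n" "x \<in> U i0" using x cov by auto
    have "x \<in> U i" unfolding i_def by (rule LeastI[of _ i0]) (rule i0)
    moreover have "i \<le> i0" unfolding i_def by (rule Least_le) (rule i0)
    moreover have "x \<notin> U j" if "j < i" for j using not_less_Least that unfolding i_def by blast
    ultimately have "x \<in> D i" "i < n" using x i0 by (auto simp: D_def)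
    then show "x \<in> (\<Union>i<n. D i)" by blast
  qed
  obtain \<nu> where \<nu>: "sets \<nu> = sets borel" "\<And>A. A \<in> sets borel \<Longrightarrow> emeasure \<nu> A = (\<Sum>i<n. emeasure (M i) (A \<inter> D i))"
    by (rule sum_of_restrictions_measure[of M D n]) (auto simp: M_def Db)
  have \<nu>S: "sets (restrict_space \<nu> S) = sets (restrict_space borel S)"
    using \<nu>(1) by (rule sets_restrict_space_cong)
  have ex: "is_volume k S (restrict_space \<nu> S)"
    unfolding is_volume_def
  proof (intro conjI allI impI)
    show "sets (restrict_space \<nu> S) = sets (restrict_space borel S)" by (rule \<nu>S)
    fix V X F G C A assume ch: "slice_chart k S V X F G C" and A: "A \<in> sets borel" "A \<subseteq> S \<inter> V"
    have "emeasure (restrict_space \<nu> S) A = emeasure \<nu> A"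
      using A Sb sets_eq_imp_space_eq[OF \<nu>(1)] by (intro emeasure_restrict_space) (auto simp: \<nu>(1))
    also have "\<dots> = (\<Sum>i<n. emeasure (M i) (A \<inter> D i))" by (rule \<nu>(2)[OF A(1)])
    also have "\<dots> = (\<Sum>i<n. emeasure (chart_measure X G C) (A \<inter> D i))"
    proof (rule sum.cong[OF refl])
      fix i assume "i \<in> {..<n}"
      then have i: "i < n" by simp
      show "emeasure (M i) (A \<inter> D i) = emeasure (chart_measure X G C) (A \<inter> D i)"
        unfolding M_def using A Db[of i] i by (intro chart_measures_agree[OF c[OF i] ch]) (auto simp: D_def)
    qed
    also have "\<dots> = emeasure (chart_measure X G C) A"
      using A covD Db dis by (intro emeasure_disjoint_pieces[symmetric]) auto
    finally show "emeasure (restrict_space \<nu> S) A = emeasure (chart_measure X G C) A" .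
  qed
  moreover have "\<mu> = restrict_space \<nu> S" if v: "is_volume k S \<mu>" for \<mu>
  proof (rule measure_eqI)
    show s: "sets \<mu> = sets (restrict_space \<nu> S)" using v \<nu>S by (simp add: is_volume_def)
    fix A assume "A \<in> sets \<mu>"
    then have A: "A \<in> sets borel" "A \<subseteq> S" using Sb s \<nu>S by (auto simp: sets_restrict_space_iff)
    have eq: "emeasure N A = (\<Sum>i<n. emeasure (M i) (A \<inter> D i))" if N: "is_volume k S N" for N
    proof -
      have "emeasure N A = (\<Sum>i<n. emeasure N (A \<inter> D i))"
        using A covD Db dis N Sb
        by (intro emeasure_disjoint_pieces) (auto simp: is_volume_def sets_restrict_space_iff)
      also have "\<dots> = (\<Sum>i<n. emeasure (M i) (A \<inter> D i))"
      proof (rule sum.cong[OF refl])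
        fix i assume "i \<in> {..<n}"
        then have i: "i < n" by simp
        have "A \<inter> D i \<in> sets borel" "A \<inter> D i \<subseteq> S \<inter> U i" using A Db[of i] i by (auto simp: D_def)
        then show "emeasure N (A \<inter> D i) = emeasure (M i) (A \<inter> D i)"
          using N c[OF i] unfolding is_volume_def M_def by blast
      qed
      finally show ?thesis .
    qed
    show "emeasure \<mu> A = emeasure (restrict_space \<nu> S) A" by (simp only: eq[OF v] eq[OF ex])
  qed
  ultimately show ?thesis by (rule ex1I)
qed

lemma riemannian_volume_is_volume:
  fixes S :: "'a::euclidean_space set"
  assumes "compact S" "smooth_submanifold k S"
  shows "is_volume k S (riemannian_volume k S)"
  unfolding riemannian_volume_eq by (rule theI'[OF ex1_volume[OF assms]])

lemma sets_riemannian_volume: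
  fixes S :: "'a::euclidean_space set"
  assumes "compact S" "smooth_submanifold k S"
  shows "sets (riemannian_volume k S) = sets (restrict_space borel S)"
    and "space (riemannian_volume k S) = S"
proof -
  show s: "sets (riemannian_volume k S) = sets (restrict_space borel S)"
    using riemannian_volume_is_volume[OF assms] by (simp add: is_volume_def)
  show "space (riemannian_volume k S) = S"
    using sets_eq_imp_space_eq[OF s] by (simp add: space_restrict_space)
qed

lemma riemannian_volume_density:
  fixes S :: "'a::euclidean_space set"
  assumes S: "compact S" "smooth_submanifold k S" and e: "e > 0"
  obtains \<rho> where "\<rho> > 0" "\<And>y r. y \<in> S \<Longrightarrow> 0 < r \<Longrightarrow> r < \<rho> \<Longrightarrow>
      ennreal ((1 - e) * (unit_ball_vol (real k) * r ^ k)) \<le> emeasure (riemannian_volume k S) (S \<inter> ball y r) \<and>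
      emeasure (riemannian_volume k S) (S \<inter> ball y r) \<le> ennreal ((1 + e) * (unit_ball_vol (real k) * r ^ k))"
proof -
  let ?\<mu> = "riemannian_volume k S"
  define P where "P y r \<longleftrightarrow> ennreal ((1 - e) * (unit_ball_vol (real k) * r ^ k)) \<le> emeasure ?\<mu> (S \<inter> ball y r) \<and>
      emeasure ?\<mu> (S \<inter> ball y r) \<le> ennreal ((1 + e) * (unit_ball_vol (real k) * r ^ k))" for y r
  have v: "is_volume k S ?\<mu>" by (rule riemannian_volume_is_volume[OF S])
  have Sb: "S \<in> sets borel" using S(1) by (simp add: compact_imp_closed)
  have "\<exists>d>0. \<forall>y r. y \<in> S \<longrightarrow> y \<in> ball p d \<longrightarrow> 0 < r \<longrightarrow> r < d \<longrightarrow> P y r" if p: "p \<in> S" for p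
  proof -
    obtain U W \<Phi> \<Psi> B where pU: "p \<in> U" and c: "slice_chart k S U W \<Phi> \<Psi> B"
      using S(2) p unfolding smooth_submanifold_def by metis
    obtain d where d: "d > 0" "ball p d \<subseteq> U" "\<And>y r. y \<in> S \<Longrightarrow> y \<in> ball p d \<Longrightarrow> 0 < r \<Longrightarrow> r < d \<Longrightarrow>
      ennreal ((1 - e) * (unit_ball_vol (real k) * r ^ k)) \<le> emeasure (chart_measure W \<Psi> B) (ball y r) \<and>
      emeasure (chart_measure W \<Psi> B) (ball y r) \<le> ennreal ((1 + e) * (unit_ball_vol (real k) * r ^ k))"
      using chart_measure_density[OF c p pU e] by metis
    have "P y r" if y: "y \<in> S" "y \<in> ball p (d / 2)" "0 < r" "r < d / 2" for y r
    proof -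
      have "ball y r \<subseteq> U"
      proof
        fix x assume "x \<in> ball y r"
        then have "dist p x < d" using y dist_triangle[of p x y] by simp
        then show "x \<in> U" using d(2) by auto
      qed
      then have sub: "S \<inter> ball y r = ball y r \<inter> S \<inter> U" by auto
      have "emeasure ?\<mu> (S \<inter> ball y r) = emeasure (chart_measure W \<Psi> B) (S \<inter> ball y r)"
      proof -
        have "S \<inter> ball y r \<in> sets borel" "S \<inter> ball y r \<subseteq> S \<inter> U"
          using Sb \<open>ball y r \<subseteq> U\<close> by auto
        with v c show ?thesis unfolding is_volume_def by blast
      qed
      also have "\<dots> = emeasure (chart_measure W \<Psi> B) (ball y r)"
        unfolding sub by (rule chart_measure_concentrated[OF c]) simp
      finally show ?thesis using d(3)[of y r] y d(1) by (simp add: P_def)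
    qed
    then show ?thesis using d(1) by (intro exI[of _ "d / 2"]) auto
  qed
  then obtain d where d: "\<And>p. p \<in> S \<Longrightarrow> d p > 0" "\<And>p y r. p \<in> S \<Longrightarrow> y \<in> S \<Longrightarrow> y \<in> ball p (d p) \<Longrightarrow> 0 < r \<Longrightarrow> r < d p \<Longrightarrow> P y r"
    by metis
  obtain Q where Q: "Q \<subseteq> S" "finite Q" "S \<subseteq> (\<Union>p\<in>Q. ball p (d p))"
    by (rule compactE_image[OF S(1), of S "\<lambda>p. ball p (d p)"]) (use d(1) in force)+
  define \<rho> where "\<rho> = Min (insert 1 (d ` Q))"
  have \<rho>: "\<rho> > 0" "\<And>p. p \<in> Q \<Longrightarrow> \<rho> \<le> d p"
    using Q d(1) unfolding \<rho>_def by (auto simp: subset_iff)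
  have "P y r" if y: "y \<in> S" "0 < r" "r < \<rho>" for y r
  proof -
    obtain p where p: "p \<in> Q" "y \<in> ball p (d p)" using Q y by auto
    show ?thesis using d(2)[of p y r] p \<rho>(2)[OF p(1)] Q y by auto
  qed
  then show ?thesis using \<rho>(1) unfolding P_def by (intro that[of \<rho>])
qed

lemma riemannian_volume_finite:
  fixes S :: "'a::euclidean_space set"
  assumes S: "compact S" "smooth_submanifold k S"
  shows "finite_measure (riemannian_volume k S)"
proof
  let ?\<mu> = "riemannian_volume k S"
  note s = sets_riemannian_volume[OF S]
  have Sb: "S \<in> sets borel" using S(1) by (simp add: compact_imp_closed)
  obtain \<rho> where \<rho>: "\<rho> > 0" "\<And>y r. y \<in> S \<Longrightarrow> 0 < r \<Longrightarrow> r < \<rho> \<Longrightarrow>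
      emeasure ?\<mu> (S \<inter> ball y r) \<le> ennreal ((1 + 1) * (unit_ball_vol (real k) * r ^ k))"
    using riemannian_volume_density[OF S zero_less_one] by metis
  obtain Q where Q: "Q \<subseteq> S" "finite Q" "S \<subseteq> (\<Union>p\<in>Q. ball p (\<rho> / 2))"
    by (rule compactE_image[OF S(1), of S "\<lambda>p. ball p (\<rho> / 2)"]) (use \<rho>(1) in force)+
  have "emeasure ?\<mu> S \<le> emeasure ?\<mu> (\<Union>p\<in>Q. S \<inter> ball p (\<rho> / 2))"
    using Q Sb by (intro emeasure_mono sets.finite_UN) (auto simp: s sets_restrict_space_iff)
  also have "\<dots> \<le> (\<Sum>p\<in>Q. emeasure ?\<mu> (S \<inter> ball p (\<rho> / 2)))"
    using Q Sb by (intro emeasure_subadditive_finite) (auto simp: s sets_restrict_space_iff)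
  also have "\<dots> < \<infinity>"
    using \<rho> Q by (auto intro!: le_less_trans[OF \<rho>(2)] simp: subset_iff)
  finally show "emeasure ?\<mu> (space ?\<mu>) \<noteq> \<infinity>" by (simp add: s)
qed

lemma riemannian_volume_pos:
  fixes S :: "'a::euclidean_space set"
  assumes S: "compact S" "smooth_submanifold k S" "S \<noteq> {}"
  shows "measure (riemannian_volume k S) S > 0"
proof -
  let ?\<mu> = "riemannian_volume k S"
  interpret finite_measure ?\<mu> by (rule riemannian_volume_finite[OF S(1,2)])
  have Sb: "S \<in> sets borel" using S(1) by (simp add: compact_imp_closed)
  obtain \<rho> where \<rho>: "\<rho> > 0" "\<And>y r. y \<in> S \<Longrightarrow> 0 < r \<Longrightarrow> r < \<rho> \<Longrightarrow>
      ennreal ((1 - 1/2) * (unit_ball_vol (real k) * r ^ k)) \<le> emeasure ?\<mu> (S \<inter> ball y r)"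
    using riemannian_volume_density[OF S(1,2), of "1/2"] by (metis half_gt_zero zero_less_one)
  obtain y where y: "y \<in> S" using S(3) by blast
  have "0 < ennreal ((1 - 1/2) * (unit_ball_vol (real k) * (\<rho> / 2) ^ k))" using \<rho>(1) by simp
  also have "\<dots> \<le> emeasure ?\<mu> (S \<inter> ball y (\<rho> / 2))" using \<rho> y by (intro \<rho>(2)) auto
  also have "\<dots> \<le> emeasure ?\<mu> S"
    using Sb by (intro emeasure_mono) (auto simp: sets_riemannian_volume[OF S(1,2)] sets_restrict_space_iff)
  finally show ?thesis by (simp add: emeasure_eq_measure)
qed

section \<open>The Laplacian of a product with a circle\<close>

lemma tangent_spaceI:
  assumes "e > 0" "\<gamma> 0 = p" "\<gamma> ` {-e<..<e} \<subseteq> S" "(\<gamma> has_vector_derivative v) (at (0::real))"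
  shows "v \<in> tangent_space S p"
  unfolding tangent_space_def using assms by blast

lemma curve_derivative:
  assumes f: "(f has_derivative D) (at p within S)"
    and g: "e > 0" "\<gamma> 0 = p" "\<gamma> ` {-e<..<e} \<subseteq> S" "(\<gamma> has_vector_derivative v) (at (0::real))"
  shows "((\<lambda>t. f (\<gamma> t)) has_vector_derivative D v) (at 0)"
proof -
  let ?I = "{-e<..<e}"
  have at: "at 0 within ?I = at (0::real)" using g(1) by (intro at_within_open) auto
  interpret bounded_linear D using f by (rule has_derivative_bounded_linear)
  have 1: "(\<gamma> has_derivative (\<lambda>t. t *\<^sub>R v)) (at 0 within ?I)"
    using g(4) unfolding has_vector_derivative_def by (rule has_derivative_at_withinI)
  have 2: "(f has_derivative D) (at (\<gamma> 0) within \<gamma> ` ?I)"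
    using f g(2,3) by (auto intro: has_derivative_subset)
  have "((\<lambda>t. f (\<gamma> t)) has_derivative (\<lambda>t. D (t *\<^sub>R v))) (at 0 within ?I)"
    by (rule has_derivative_in_compose[OF 1 2])
  then show ?thesis unfolding at has_vector_derivative_def by (simp add: scaleR)
qed

text \<open>A derivative within \<open>S\<close> is determined on tangent vectors only. This is what allows one to evaluate the
  choice operators in \<open>grad_on\<close> and \<open>hess_on\<close>.\<close>
lemma tangent_space_derivative_unique:
  assumes "(f has_derivative D) (at p within S)" "(f has_derivative D') (at p within S)" "v \<in> tangent_space S p"
  shows "D v = D' v"
proof -
  obtain \<gamma> e where g: "e > 0" "\<gamma> 0 = p" "\<gamma> ` {-e<..<e} \<subseteq> S" "(\<gamma> has_vector_derivative v) (at (0::real))"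
    using assms(3) unfolding tangent_space_def by auto
  show ?thesis
    using curve_derivative[OF assms(1) g] curve_derivative[OF assms(2) g] by (rule vector_derivative_unique_at)
qed

lemma tangent_space_chart:
  fixes S :: "'a::euclidean_space set"
  assumes c: "slice_chart k S U W \<Phi> \<Psi> B" and p: "p \<in> S" "p \<in> U"
  shows "tangent_space S p = frechet_derivative \<Psi> (at (\<Phi> p)) ` span B"
proof -
  note C = slice_chartD[OF c]
  define x where "x = \<Phi> p"
  have x: "x \<in> W" "x \<in> span B" "\<Psi> x = p" using C p by (auto simp: x_def)
  note D = slice_chart_derivatives[OF c x(1), unfolded x(3)]
  let ?L = "frechet_derivative \<Psi> (at x)" and ?K = "frechet_derivative \<Phi> (at p)"
  show ?thesis unfolding x_def[symmetric]
  proof (intro equalityI subsetI)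
    fix v assume "v \<in> tangent_space S p"
    then obtain \<gamma> e where g: "e > 0" "\<gamma> 0 = p" "\<gamma> ` {-e<..<e} \<subseteq> S" "(\<gamma> has_vector_derivative v) (at (0::real))"
      unfolding tangent_space_def by auto
    have d: "((\<lambda>t. \<Phi> (\<gamma> t)) has_vector_derivative ?K v) (at 0)"
      by (rule curve_derivative[of \<Phi> _ p UNIV]) (use g D(3) in auto)
    have "isCont \<gamma> 0" using g(4) by (rule has_vector_derivative_continuous)
    then have "eventually (\<lambda>t. \<gamma> t \<in> U) (at 0)"
      using C(1) p g(2) unfolding isCont_def by (intro topological_tendstoD) auto
    moreover have "eventually (\<lambda>t. t \<in> {-e<..<e}) (at (0::real))"
      using g(1) by (intro eventually_at_in_open') auto
    ultimately have ev: "eventually (\<lambda>t. \<Phi> (\<gamma> t) \<in> span B) (at 0)"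
      by eventually_elim (use g(3) C(12) in blast)
    have "?K v \<bullet> b = 0" if b: "b \<in> Basis" "b \<notin> B" for b
    proof -
      have "((\<lambda>t. \<Phi> (\<gamma> t) \<bullet> b) has_vector_derivative ?K v \<bullet> b) (at 0)"
        by (rule bounded_linear.has_vector_derivative[OF bounded_linear_inner_left d])
      then have "((\<lambda>t. \<Phi> (\<gamma> t) \<bullet> b) has_derivative (\<lambda>h. h * (?K v \<bullet> b))) (at 0)"
        by (simp add: has_vector_derivative_def)
      then have "((\<lambda>t. 0) has_derivative (\<lambda>h. h * (?K v \<bullet> b))) (at 0)"
      proof (rule has_derivative_transform_eventually)
        show "eventually (\<lambda>t. \<Phi> (\<gamma> t) \<bullet> b = 0) (at 0)"
          using ev by eventually_elim (use b C(3) in \<open>auto simp: span_substd_basis\<close>)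
        show "\<Phi> (\<gamma> 0) \<bullet> b = 0"
          using x g(2) b C(3) by (auto simp: span_substd_basis x_def)
      qed simp
      from has_derivative_unique[OF this has_derivative_const] show ?thesis by (metis mult_1)
    qed
    then have "?K v \<in> span B" using C(3) by (simp add: span_substd_basis)
    then show "v \<in> ?L ` span B" using D(5)[of v] by (metis imageI)
  next
    fix v assume "v \<in> ?L ` span B"
    then obtain u where u: "u \<in> span B" "v = ?L u" by auto
    define \<gamma> where "\<gamma> t = \<Psi> (x + t *\<^sub>R u)" for t
    have "((\<lambda>t. x + t *\<^sub>R u) \<longlongrightarrow> x + 0 *\<^sub>R u) (at 0)" by (intro tendsto_intros)
    then have "eventually (\<lambda>t. x + t *\<^sub>R u \<in> W) (at 0)"
      using C(2) x(1) by (intro topological_tendstoD) auto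
    then obtain e where e: "e > 0" "\<And>t. t \<noteq> 0 \<Longrightarrow> dist t 0 < e \<Longrightarrow> x + t *\<^sub>R u \<in> W"
      unfolding eventually_at by auto
    have eW: "x + t *\<^sub>R u \<in> W" if "t \<in> {-e<..<e}" for t
      using e(2)[of t] that x(1) by (cases "t = 0") auto
    have "((\<lambda>t. x + t *\<^sub>R u) has_vector_derivative u) (at 0)"
      by (auto intro!: derivative_eq_intros simp: has_vector_derivative_def)
    then have "((\<lambda>t. \<Psi> (x + t *\<^sub>R u)) has_vector_derivative ?L u) (at 0)"
      by (intro curve_derivative[of \<Psi> _ x UNIV 1]) (use D(1) in auto)
    moreover have "\<gamma> ` {-e<..<e} \<subseteq> S"
    proof
      fix y assume "y \<in> \<gamma> ` {-e<..<e}"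
      then obtain t where t: "t \<in> {-e<..<e}" "y = \<Psi> (x + t *\<^sub>R u)" by (auto simp: \<gamma>_def)
      have "x + t *\<^sub>R u \<in> span B" using x u by (intro span_add span_scale)
      then show "y \<in> S" using eW[OF t(1)] t(2) C by auto
    qed
    ultimately show "v \<in> tangent_space S p"
      unfolding tangent_space_def using e(1) x(3) u(2) by (auto simp: \<gamma>_def[abs_def] intro!: exI[of _ \<gamma>] exI[of _ e])
  qed
qed

lemma subspace_tangent_space:
  fixes S :: "'a::euclidean_space set"
  assumes "smooth_submanifold k S" "p \<in> S"
  shows "subspace (tangent_space S p)"
proof -
  obtain U W \<Phi> \<Psi> B where c: "p \<in> U" "slice_chart k S U W \<Phi> \<Psi> B"
    using assms unfolding smooth_submanifold_def by auto
  have "\<Phi> p \<in> W" using slice_chartD(8)[OF c(2) c(1)] .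
  from slice_chart_derivatives(2)[OF c(2) this]
  show ?thesis unfolding tangent_space_chart[OF c(2) assms(2) c(1)]
    by (intro linear_subspace_image subspace_span)
qed

lemma tangent_space_Times:
  fixes S :: "'a::euclidean_space set" and T :: "'b::euclidean_space set"
  shows "tangent_space (S \<times> T) (p, q) = tangent_space S p \<times> tangent_space T q"
proof (intro equalityI subsetI)
  fix v assume "v \<in> tangent_space (S \<times> T) (p, q)"
  then obtain \<gamma> e where g: "e > 0" "\<gamma> 0 = (p, q)" "\<gamma> ` {-e<..<e} \<subseteq> S \<times> T" "(\<gamma> has_vector_derivative v) (at (0::real))"
    unfolding tangent_space_def by auto
  have d: "((\<lambda>t. fst (\<gamma> t)) has_vector_derivative fst v) (at 0)" "((\<lambda>t. snd (\<gamma> t)) has_vector_derivative snd v) (at 0)"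
    using g(4) by (auto intro: bounded_linear.has_vector_derivative[OF bounded_linear_fst] bounded_linear.has_vector_derivative[OF bounded_linear_snd])
  have "(\<lambda>t. fst (\<gamma> t)) ` {-e<..<e} \<subseteq> S" "(\<lambda>t. snd (\<gamma> t)) ` {-e<..<e} \<subseteq> T" using g(3) by force+
  then have "fst v \<in> tangent_space S p" "snd v \<in> tangent_space T q"
    using g(1,2) d tangent_spaceI[of e "\<lambda>t. fst (\<gamma> t)" p S "fst v"]
      tangent_spaceI[of e "\<lambda>t. snd (\<gamma> t)" q T "snd v"] by simp_all
  then show "v \<in> tangent_space S p \<times> tangent_space T q" by (metis mem_Times_iff)
next
  fix v assume "v \<in> tangent_space S p \<times> tangent_space T q"
  then have v: "fst v \<in> tangent_space S p" "snd v \<in> tangent_space T q" by auto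
  obtain \<gamma> e where g: "e > 0" "\<gamma> 0 = p" "\<gamma> ` {-e<..<e} \<subseteq> S" "(\<gamma> has_vector_derivative fst v) (at (0::real))"
    using v(1) unfolding tangent_space_def by blast
  obtain \<delta> d where d: "d > 0" "\<delta> 0 = q" "\<delta> ` {-d<..<d} \<subseteq> T" "(\<delta> has_vector_derivative snd v) (at (0::real))"
    using v(2) unfolding tangent_space_def by blast
  have "((\<lambda>t. (\<gamma> t, \<delta> t)) has_vector_derivative (fst v, snd v)) (at 0)"
    using g(4) d(4) by (rule has_vector_derivative_Pair)
  moreover have "(\<lambda>t. (\<gamma> t, \<delta> t)) ` {-min e d<..<min e d} \<subseteq> S \<times> T"
  proof
    fix z assume "z \<in> (\<lambda>t. (\<gamma> t, \<delta> t)) ` {-min e d<..<min e d}"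
    then obtain t where "t \<in> {-e<..<e}" "t \<in> {-d<..<d}" "z = (\<gamma> t, \<delta> t)"
      by (auto simp: min_def split: if_splits)
    then show "z \<in> S \<times> T" using g(3) d(3) by blast
  qed
  ultimately show "v \<in> tangent_space (S \<times> T) (p, q)"
    unfolding tangent_space_def mem_Collect_eq using g(1,2) d(1,2)
    by (intro exI[of _ "\<lambda>t. (\<gamma> t, \<delta> t)"] exI[of _ "min e d"] conjI) simp_all
qed

lemma tangent_space_circle:
  assumes w: "w \<in> sphere (0::complex) R" and R: "R > 0"
  shows "tangent_space (sphere 0 R) w = {v. w \<bullet> v = 0}"
    and "w \<bullet> v = 0 \<Longrightarrow> v = ((v \<bullet> (\<i> * w)) / R\<^sup>2) *\<^sub>R (\<i> * w)"
proof -
  have nw: "norm w = R" using w by simp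
  show *: "v = ((v \<bullet> (\<i> * w)) / R\<^sup>2) *\<^sub>R (\<i> * w)" if "w \<bullet> v = 0" for v
  proof -
    have wv: "Re w * Re v + Im w * Im v = 0" using that by (simp add: inner_complex_def)
    have R2: "R\<^sup>2 = (Re w)\<^sup>2 + (Im w)\<^sup>2" using nw by (simp add: cmod_power2[symmetric])
    have "Re v * R\<^sup>2 = (v \<bullet> (\<i> * w)) * - Im w"
      using wv unfolding R2 inner_complex_def by simp algebra
    moreover have "Im v * R\<^sup>2 = (v \<bullet> (\<i> * w)) * Re w"
      using wv unfolding R2 inner_complex_def by simp algebra
    ultimately show ?thesis using R by (simp add: complex_eq_iff field_simps)
  qed
  show "tangent_space (sphere 0 R) w = {v. w \<bullet> v = 0}"
  proof (intro equalityI subsetI)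
    fix v assume v: "v \<in> tangent_space (sphere 0 R) w"
    have 1: "((\<lambda>z::complex. z \<bullet> z) has_derivative (\<lambda>h. 2 * (w \<bullet> h))) (at w within sphere 0 R)"
      by (auto intro!: derivative_eq_intros simp: inner_commute)
    have 2: "((\<lambda>z::complex. z \<bullet> z) has_derivative (\<lambda>h. 0)) (at w within sphere 0 R)"
      by (rule has_derivative_transform[OF w _ has_derivative_const[of "R * R"]]) (auto simp: dot_square_norm power2_eq_square)
    show "v \<in> {v. w \<bullet> v = 0}" using tangent_space_derivative_unique[OF 1 2 v] by simp
  next
    fix v assume "v \<in> {v. w \<bullet> v = 0}"
    then have v: "v = ((v \<bullet> (\<i> * w)) / R\<^sup>2) *\<^sub>R (\<i> * w)" using * by simp
    define t where "t = (v \<bullet> (\<i> * w)) / R\<^sup>2"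
    have "((\<lambda>s. w * exp (\<i> * of_real (t * s))) has_vector_derivative w * (exp (\<i> * of_real (t * 0)) * (\<i> * of_real t))) (at 0)"
      by (auto intro!: derivative_eq_intros has_vector_derivative_real_field)
    moreover have "w * (exp (\<i> * of_real (t * 0)) * (\<i> * of_real t)) = v"
      using v unfolding t_def[symmetric] by (simp add: scaleR_conv_of_real)
    moreover have "(\<lambda>s. w * exp (\<i> * of_real (t * s))) ` {-1<..<1} \<subseteq> sphere 0 R"
      using nw by (auto simp: norm_mult)
    ultimately show "v \<in> tangent_space (sphere 0 R) w" unfolding tangent_space_def
      by (auto intro!: exI[of _ "\<lambda>s. w * exp (\<i> * of_real (t * s))"] exI[of _ 1])
  qed
qed

text \<open>The gradient of \<open>w \<mapsto> c \<bullet> w\<close> along the circle is \<open>c - (c \<bullet> w / R\<^sup>2) w\<close>, because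
  \<open>w \<bullet> w\<close> is constant there and can be used to correct the ambient derivative. Its derivative
  in a tangent direction \<open>b\<close> has the inner product \<open>- (c \<bullet> w / R\<^sup>2) \<parallel>fst b\<parallel>\<^sup>2\<close> with \<open>b\<close>. For an
  orthonormal basis of the tangent space the numbers \<open>\<parallel>fst b\<parallel>\<^sup>2\<close> add up to \<open>1\<close>, by Parseval's identity for the unit
  tangent vector of the circle.\<close>
lemma laplacian_on_circle_Times:
  fixes S :: "'a::euclidean_space set" and f :: "complex \<times> 'a \<Rightarrow> real"
  assumes S: "smooth_submanifold k S" and R: "R > 0"
    and f: "\<And>w y. w \<in> sphere 0 R \<Longrightarrow> y \<in> S \<Longrightarrow> f (w, y) = c \<bullet> w"
    and w: "w \<in> sphere 0 R" and y: "y \<in> S"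
  shows "laplacian_on (sphere 0 R \<times> S) f (w, y) = (c \<bullet> w) / R\<^sup>2"
proof -
  let ?X = "sphere (0::complex) R \<times> S"
  define G :: "complex \<times> 'a \<Rightarrow> complex \<times> 'a" where "G p = (c - ((c \<bullet> fst p) / R\<^sup>2) *\<^sub>R fst p, 0)" for p
  have T: "tangent_space ?X (w, y) = {v. w \<bullet> v = 0} \<times> tangent_space S y"
    if "w \<in> sphere 0 R" "y \<in> S" for w y
    using tangent_space_circle(1)[OF that(1) R] by (simp add: tangent_space_Times)
  have sub: "subspace (tangent_space ?X (w, y))" if "w \<in> sphere 0 R" "y \<in> S" for w y
    unfolding T[OF that] using subspace_tangent_space[OF S that(2)]
    by (intro subspace_Times) (auto simp: subspace_def inner_add_right)
  have grad: "grad_on ?X f p = G p" if p: "p \<in> ?X" for p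
  proof -
    obtain w y where wy: "p = (w, y)" "w \<in> sphere 0 R" "y \<in> S" using p by auto
    have nw: "w \<bullet> w = R\<^sup>2" using wy by (simp add: dot_square_norm)
    have d: "(f has_derivative (\<lambda>h. G p \<bullet> h)) (at p within ?X)"
    proof -
      define \<kappa> where "\<kappa> = (c \<bullet> w) / R\<^sup>2"
      have Gp: "G p = (c - \<kappa> *\<^sub>R w, 0)" by (simp add: G_def \<kappa>_def wy)
      have "((\<lambda>q. c \<bullet> fst q - \<kappa> * ((fst q \<bullet> fst q - R\<^sup>2) / 2)) has_derivative (\<lambda>h. G p \<bullet> h)) (at p within ?X)"
        unfolding Gp unfolding wy
        by (auto intro!: derivative_eq_intros simp: fun_eq_iff inner_diff_left inner_diff_right inner_prod_def inner_commute)
      then show ?thesis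
        by (rule has_derivative_transform[OF p, rotated]) (auto simp: f dot_square_norm)
    qed
    have GT: "G p \<in> tangent_space ?X p"
      using nw R subspace_0[OF subspace_tangent_space[OF S wy(3)]] unfolding wy(1) T[OF wy(2,3)] G_def
      by (simp add: inner_diff_right inner_commute)
    show ?thesis unfolding grad_on_def
    proof (rule the_equality)
      show "G p \<in> tangent_space ?X p \<and> (f has_derivative (\<lambda>h. G p \<bullet> h)) (at p within ?X)" using d GT by blast
      fix v assume v: "v \<in> tangent_space ?X p \<and> (f has_derivative (\<lambda>h. v \<bullet> h)) (at p within ?X)"
      have "v - G p \<in> tangent_space ?X p" using v GT sub[OF wy(2,3)] wy(1) by (auto intro: subspace_diff)
      from tangent_space_derivative_unique[OF _ d this, of "\<lambda>h. v \<bullet> h"] v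
      have "(v - G p) \<bullet> (v - G p) = 0" by (simp add: inner_diff_left)
      then show "v = G p" by simp
    qed
  qed
  define E where "E = (SOME E. pairwise orthogonal E \<and> (\<forall>b\<in>E. norm b = 1) \<and> span E = tangent_space ?X (w, y))"
  have "\<exists>E. pairwise orthogonal E \<and> (\<forall>b\<in>E. norm b = 1) \<and> span E = tangent_space ?X (w, y)"
    using orthonormal_basis_subspace[OF sub[OF w y]] by metis
  then have E: "pairwise orthogonal E" "\<And>b. b \<in> E \<Longrightarrow> norm b = 1" "span E = tangent_space ?X (w, y)"
    unfolding E_def using someI_ex[of "\<lambda>E. pairwise orthogonal E \<and> (\<forall>b\<in>E. norm b = 1) \<and> span E = tangent_space ?X (w, y)"] by blast+
  have "0 \<notin> E" using E(2)[of 0] by auto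
  then have finE: "finite E"
    using E(1) by (intro independent_imp_finite pairwise_orthogonal_independent)
  have nw: "w \<bullet> w = R\<^sup>2" using w by (simp add: dot_square_norm)
  have wX: "(w, y) \<in> ?X" using w y by simp
  have Gd: "(G has_derivative (\<lambda>h. (- ((c \<bullet> fst h) / R\<^sup>2) *\<^sub>R w - ((c \<bullet> w) / R\<^sup>2) *\<^sub>R fst h, 0))) (at (w, y) within ?X)"
  proof -
    define \<rho> where "\<rho> = inverse (R\<^sup>2)"
    have "G = (\<lambda>p. (c - (\<rho> * (c \<bullet> fst p)) *\<^sub>R fst p, 0))"
      by (simp add: fun_eq_iff G_def \<rho>_def divide_inverse mult.commute)
    moreover have "((\<lambda>p. (c - (\<rho> * (c \<bullet> fst p)) *\<^sub>R fst p, 0)) has_derivative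
      (\<lambda>h. (- (\<rho> * (c \<bullet> fst h)) *\<^sub>R w - (\<rho> * (c \<bullet> w)) *\<^sub>R fst h, 0))) (at (w, y) within ?X)"
      by (auto intro!: derivative_eq_intros)
    ultimately show ?thesis by (simp add: \<rho>_def divide_inverse mult.commute)
  qed
  then have gd: "(grad_on ?X f has_derivative (\<lambda>h. (- ((c \<bullet> fst h) / R\<^sup>2) *\<^sub>R w - ((c \<bullet> w) / R\<^sup>2) *\<^sub>R fst h, 0))) (at (w, y) within ?X)"
    by (rule has_derivative_transform[OF wX, rotated]) (use grad in auto)
  have hess: "hess_on ?X f (w, y) b b = - ((c \<bullet> w) / R\<^sup>2) * (fst b \<bullet> fst b)" if b: "b \<in> E" for b
  proof -
    have bT: "b \<in> tangent_space ?X (w, y)" using b E(3) span_base by blast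
    then have wb: "w \<bullet> fst b = 0" using T[OF w y] by auto
    define D where "D = (SOME D. (grad_on ?X f has_derivative D) (at (w, y) within ?X))"
    have "(grad_on ?X f has_derivative D) (at (w, y) within ?X)" unfolding D_def using gd by (rule someI[where P = "\<lambda>D. (grad_on ?X f has_derivative D) (at (w, y) within ?X)"])
    from tangent_space_derivative_unique[OF this gd bT]
    show ?thesis unfolding hess_on_def D_def[symmetric] using wb
      by (simp add: inner_prod_def inner_diff_left)
  qed
  \<comment> \<open>the unit tangent vector of the circle\<close>
  define u where "u = (\<i> * w) /\<^sub>R R"
  have u1: "u \<bullet> u = 1" using w R by (simp add: dot_square_norm u_def norm_mult)
  have "(u, 0) \<in> tangent_space ?X (w, y)"
    using subspace_0[OF subspace_tangent_space[OF S y]] unfolding T[OF w y]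
    by (simp add: u_def inner_complex_def)
  then have ux: "(u, 0) \<in> span E" using E(3) by simp
  have sq: "fst b \<bullet> fst b = ((u, 0) \<bullet> b) * ((u, 0) \<bullet> b)" if b: "b \<in> E" for b
  proof -
    have "b \<in> tangent_space ?X (w, y)" using b E(3) span_base by blast
    then have wb: "w \<bullet> fst b = 0" using T[OF w y] by auto
    have "fst b = ((fst b \<bullet> (\<i> * w)) / R\<^sup>2) *\<^sub>R (\<i> * w)" by (rule tangent_space_circle(2)[OF w R wb])
    also have "\<dots> = (u \<bullet> fst b) *\<^sub>R u" using R by (simp add: u_def power2_eq_square inner_commute divide_inverse)
    finally have fb: "fst b = (u \<bullet> fst b) *\<^sub>R u" .
    have "fst b \<bullet> fst b = fst b \<bullet> ((u \<bullet> fst b) *\<^sub>R u)" using fb by simp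
    then show ?thesis by (simp add: inner_prod_def inner_commute)
  qed
  have "(\<Sum>b\<in>E. fst b \<bullet> fst b) = (\<Sum>b\<in>E. ((u, 0) \<bullet> b) * ((u, 0) \<bullet> b))" by (rule sum.cong) (auto simp: sq)
  also have "\<dots> = (u, 0) \<bullet> (\<Sum>b\<in>E. ((u, 0) \<bullet> b) *\<^sub>R b)" by (simp add: inner_sum_right)
  also have "(\<Sum>b\<in>E. ((u, 0) \<bullet> b) *\<^sub>R b) = (u, 0::'a)"
    using E ux finE by (intro orthonormal_basis_expand) auto
  also have "(u, 0::'a) \<bullet> (u, 0) = 1" using u1 by (simp add: inner_prod_def)
  finally have one: "(\<Sum>b\<in>E. fst b \<bullet> fst b) = 1" .
  have "laplacian_on ?X f (w, y) = - (\<Sum>b\<in>E. - ((c \<bullet> w) / R\<^sup>2) * (fst b \<bullet> fst b))"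
    unfolding laplacian_on_def E_def[symmetric] by (simp add: hess)
  also have "\<dots> = (c \<bullet> w) / R\<^sup>2 * (\<Sum>b\<in>E. fst b \<bullet> fst b)" by (simp add: sum_negf sum_distrib_left)
  finally show ?thesis by (simp add: one)
qed

section \<open>Moments of the cap kernel and the function h\<close>

text \<open>The squared Euclidean distance of the points at signed arc lengths \<open>t\<close> and \<open>s\<close> from a corner with a
  right angle (see \<open>dist_contour_near\<close>).\<close>
definition corner_dist2 :: "real \<Rightarrow> real \<Rightarrow> real" where
  "corner_dist2 t s = (if t * s \<ge> 0 then (s - t)\<^sup>2 else s\<^sup>2 + t\<^sup>2)"

text \<open>The value \<open>0\<close> for \<open>r \<le> 0\<close> makes the function describe the volume of an open ball also when \<open>k = 0\<close>. As the
  square root of a negative number is negative, \<open>cut_power k (sqrt (r\<^sup>2 - x))\<close> vanishes by itself outside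
  the range of integration.\<close>
definition cut_power :: "nat \<Rightarrow> real \<Rightarrow> real" where
  "cut_power k r = (if r > 0 then r ^ k else 0)"

lemma cut_power_nonneg [simp]: "0 \<le> cut_power k r"
  by (simp add: cut_power_def)

lemma cut_power_le: "r \<le> e \<Longrightarrow> 0 \<le> e \<Longrightarrow> cut_power k r \<le> e ^ k"
  by (auto simp: cut_power_def intro: power_mono)

lemma cut_power_measurable [measurable]: "cut_power k \<in> borel_measurable borel"
  unfolding cut_power_def[abs_def] by measurable

lemma corner_dist2_measurable [measurable]: "corner_dist2 t \<in> borel_measurable borel"
  unfolding corner_dist2_def[abs_def] by measurable

lemma cut_power_scale: "e > 0 \<Longrightarrow> cut_power k (e * r) = e ^ k * cut_power k r"
  by (simp add: cut_power_def power_mult_distrib zero_less_mult_iff)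

lemma sqrt_scale: "e > 0 \<Longrightarrow> sqrt (e\<^sup>2 - e\<^sup>2 * x) = e * sqrt (1 - x)"
  using real_sqrt_mult[of "e\<^sup>2" "1 - x"] by (simp add: algebra_simps)

lemma integral_bounded_support:
  fixes f :: "real \<Rightarrow> real"
  assumes [measurable]: "f \<in> borel_measurable borel" and b: "\<And>x. \<bar>f x\<bar> \<le> C * indicator {a..b} x" and ab: "a \<le> b"
  shows "integrable lborel f" and "\<bar>\<integral>x. f x \<partial>lborel\<bar> \<le> C * (b - a)"
proof -
  have i: "integrable lborel (\<lambda>x. C * indicator {a..b} x)"
    using ab by (intro integrable_mult_right) (simp add: integrable_indicator_iff)
  show f: "integrable lborel f"
    by (rule Bochner_Integration.integrable_bound[OF i]) (use b in \<open>auto intro!: AE_I2 order_trans[OF b]\<close>)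
  have "\<bar>\<integral>x. f x \<partial>lborel\<bar> \<le> (\<integral>x. \<bar>f x\<bar> \<partial>lborel)" by (rule integral_abs_bound)
  also have "\<dots> \<le> (\<integral>x. C * indicator {a..b} x \<partial>lborel)"
    using f i b by (intro integral_mono) auto
  also have "\<dots> = C * (b - a)" using ab by simp
  finally show "\<bar>\<integral>x. f x \<partial>lborel\<bar> \<le> C * (b - a)" .
qed

lemma cut_sqrt_zero: "r \<le> \<bar>x\<bar> \<Longrightarrow> r \<ge> 0 \<Longrightarrow> cut_power k (sqrt (r\<^sup>2 - x\<^sup>2)) = 0"
  using abs_le_square_iff[of r x] by (simp add: cut_power_def)

lemma cut_sqrt_le: "r \<ge> 0 \<Longrightarrow> x \<ge> 0 \<Longrightarrow> cut_power k (sqrt (r\<^sup>2 - x)) \<le> r ^ k"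
  using real_sqrt_le_mono[of "r\<^sup>2 - x" "r\<^sup>2"] by (intro cut_power_le) auto

lemma cap_integrable:
  fixes g :: "real \<Rightarrow> real"
  assumes [measurable]: "g \<in> borel_measurable borel" and g: "\<And>x. \<bar>x\<bar> \<le> r \<Longrightarrow> \<bar>g x\<bar> \<le> C" and r: "r \<ge> 0"
  shows "integrable lborel (\<lambda>x. g x * cut_power k (sqrt (r\<^sup>2 - x\<^sup>2)))"
proof (rule integral_bounded_support(1))
  show "\<bar>g x * cut_power k (sqrt (r\<^sup>2 - x\<^sup>2))\<bar> \<le> C * r ^ k * indicator {-r..r} x" for x
  proof (cases "\<bar>x\<bar> \<le> r")
    case True
    have C: "0 \<le> C" using g[OF True] by simp
    have "\<bar>g x\<bar> * cut_power k (sqrt (r\<^sup>2 - x\<^sup>2)) \<le> C * r ^ k"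
      using g[OF True] C cut_sqrt_le[OF r, of "x\<^sup>2" k] by (intro mult_mono) auto
    then show ?thesis using True by (simp add: abs_mult abs_le_iff)
  next
    case False
    then have "x \<notin> {-r..r}" by auto
    then show ?thesis using False r by (simp add: cut_sqrt_zero)
  qed
qed (use r in auto)

definition cap_int :: "nat \<Rightarrow> real" where
  "cap_int k = (\<integral>x. cut_power k (sqrt (1 - x\<^sup>2)) \<partial>lborel)"

lemma cap_int_Beta: "cap_int k = Beta (1/2) (real k / 2 + 1)"
proof -
  have "Beta (1/2) (real k / 2 + 1) \<ge> 0"
    by (auto simp: Beta_def intro!: divide_nonneg_nonneg mult_nonneg_nonneg Gamma_real_nonneg add_nonneg_nonneg)
  moreover have "(\<integral>\<^sup>+x. ennreal (cut_power k (sqrt (1 - x\<^sup>2))) \<partial>lborel) = ennreal (Beta (1/2) (real k / 2 + 1))"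
    unfolding emeasure_cball_aux_integral[symmetric]
  proof (rule nn_integral_cong_AE, rule AE_I[of _ _ "{-1, 1}"])
    show "{x \<in> space lborel. \<not> ennreal (cut_power k (sqrt (1 - x\<^sup>2))) = ennreal (indicator {-1..1} x * sqrt (1 - x\<^sup>2) ^ k)} \<subseteq> {-1, 1::real}"
    proof
      fix x :: real assume x: "x \<in> {x \<in> space lborel. \<not> ennreal (cut_power k (sqrt (1 - x\<^sup>2))) = ennreal (indicator {-1..1} x * sqrt (1 - x\<^sup>2) ^ k)}"
      show "x \<in> {-1, 1}"
      proof (rule ccontr)
        assume n: "x \<notin> {-1, 1}"
        have "0 < 1 - x\<^sup>2 \<longleftrightarrow> x \<in> {-1..1}"
          using n abs_square_less_1[of x] by auto
        then have "ennreal (cut_power k (sqrt (1 - x\<^sup>2))) = ennreal (indicator {-1..1} x * sqrt (1 - x\<^sup>2) ^ k)"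
          unfolding cut_power_def indicator_def by (simp only: real_sqrt_gt_0_iff) simp
        then show False using x by simp
      qed
    qed
    show "emeasure lborel {-1, 1 :: real} = 0" by (simp add: emeasure_lborel_countable)
  qed simp
  ultimately show ?thesis unfolding cap_int_def
    by (subst integral_eq_nn_integral) auto
qed

lemma unit_ball_vol_Suc: "unit_ball_vol (real k) * cap_int k = unit_ball_vol (real (Suc k))"
  by (simp only: cap_int_Beta unit_ball_vol_Suc_Beta)

lemma cap_int_pos: "cap_int k > 0"
  using unit_ball_vol_Suc[of k] unit_ball_vol_pos[of "real k"] unit_ball_vol_pos[of "real (Suc k)"]
  by (metis of_nat_0_le_iff zero_less_mult_pos)

lemma cap_int_scale: "r > 0 \<Longrightarrow> (\<integral>x. cut_power k (sqrt (r\<^sup>2 - x\<^sup>2)) \<partial>lborel) = r ^ Suc k * cap_int k"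
  by (subst lborel_integral_real_affine[of r _ 0])
     (simp_all add: power_mult_distrib sqrt_scale cut_power_scale cap_int_def)

lemma cut_power_Suc2: "cut_power (Suc (Suc k)) (sqrt x) = x * cut_power k (sqrt x)"
  by (simp add: cut_power_def)

lemma cap_int_add2: "cap_int (Suc (Suc k)) = (real k + 2) / (real k + 3) * cap_int k"
proof -
  have "real k / 2 + 1 \<notin> \<int>\<^sub>\<le>\<^sub>0"
    using nonpos_Ints_nonpos[of "real k / 2 + 1"] by (smt (verit) of_nat_0_le_iff divide_nonneg_nonneg)
  from Beta_plus1_right[OF this, of "1/2"]
  have *: "(1/2 + (real k / 2 + 1)) * Beta (1/2) (real k / 2 + 1 + 1) = (real k / 2 + 1) * Beta (1/2) (real k / 2 + 1)" .
  have e: "real (Suc (Suc k)) / 2 + 1 = real k / 2 + 1 + 1" by (simp add: field_simps)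
  show ?thesis unfolding cap_int_Beta e using * by (simp add: field_simps)
qed

text \<open>Write \<open>x\<^sup>2 = 1 - (1 - x\<^sup>2)\<close> and use the recursion of the Beta integrals.\<close>
lemma cap_second_moment_unit:
  "unit_ball_vol (real k) * (\<integral>x. x\<^sup>2 * cut_power k (sqrt (1 - x\<^sup>2)) \<partial>lborel) = sigma_m (Suc k)"
proof -
  have i: "integrable lborel (\<lambda>x. cut_power k (sqrt (1 - x\<^sup>2)))" for k
    using cap_integrable[of "\<lambda>_. 1" 1 1 k] by simp
  have "x\<^sup>2 * cut_power k (sqrt (1 - x\<^sup>2)) = cut_power k (sqrt (1 - x\<^sup>2)) - cut_power (Suc (Suc k)) (sqrt (1 - x\<^sup>2))" for x
    unfolding cut_power_Suc2 by (simp add: algebra_simps)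
  then have "(\<integral>x. x\<^sup>2 * cut_power k (sqrt (1 - x\<^sup>2)) \<partial>lborel) = cap_int k - cap_int (Suc (Suc k))"
    using i unfolding cap_int_def by simp
  also have "\<dots> = cap_int k / (real k + 3)" by (simp add: cap_int_add2 field_simps)
  finally have "(\<integral>x. x\<^sup>2 * cut_power k (sqrt (1 - x\<^sup>2)) \<partial>lborel) = cap_int k / (real k + 3)" .
  then show ?thesis using unit_ball_vol_Suc[of k] by (simp add: sigma_m_def add.commute)
qed

lemma cap_second_moment:
  assumes "r > 0"
  shows "unit_ball_vol (real k) * (\<integral>x. x\<^sup>2 * cut_power k (sqrt (r\<^sup>2 - x\<^sup>2)) \<partial>lborel) = r ^ (k + 3) * sigma_m (Suc k)"
proof -
  have "(\<integral>x. x\<^sup>2 * cut_power k (sqrt (r\<^sup>2 - x\<^sup>2)) \<partial>lborel) =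
     \<bar>r\<bar> * (\<integral>x. (0 + r * x)\<^sup>2 * cut_power k (sqrt (r\<^sup>2 - (0 + r * x)\<^sup>2)) \<partial>lborel)"
    by (subst lborel_integral_real_affine[of r _ 0]) (use assms in auto)
  also have "\<dots> = r * (\<integral>x. (r\<^sup>2 * r ^ k) * (x\<^sup>2 * cut_power k (sqrt (1 - x\<^sup>2))) \<partial>lborel)"
  proof -
    have "(0 + r * x)\<^sup>2 * cut_power k (sqrt (r\<^sup>2 - (0 + r * x)\<^sup>2)) = (r\<^sup>2 * r ^ k) * (x\<^sup>2 * cut_power k (sqrt (1 - x\<^sup>2)))" for x
      using assms by (simp add: power_mult_distrib sqrt_scale cut_power_scale)
    then show ?thesis using assms by simp
  qed
  also have "\<dots> = r ^ (k + 3) * (\<integral>x. x\<^sup>2 * cut_power k (sqrt (1 - x\<^sup>2)) \<partial>lborel)"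
    by (simp add: power_add power3_eq_cube power2_eq_square)
  finally show ?thesis using cap_second_moment_unit[of k] by (simp add: mult_ac)
qed

lemma cap_integral_eq_HK:
  assumes a: "0 \<le> a" "a \<le> r" and g: "continuous_on UNIV (g :: real \<Rightarrow> real)"
  shows "(\<integral>s. indicator {a<..} s * (g s * cut_power k (sqrt (r\<^sup>2 - s\<^sup>2))) \<partial>lborel)
    = integral {a..r} (\<lambda>s. g s * sqrt (r\<^sup>2 - s\<^sup>2) ^ k)"
proof -
  have "continuous_on {a..r} (\<lambda>s. g s * sqrt (r\<^sup>2 - s\<^sup>2) ^ k)"
    by (intro continuous_intros continuous_on_subset[OF g]) auto
  then have si: "set_integrable lborel {a..r} (\<lambda>s. g s * sqrt (r\<^sup>2 - s\<^sup>2) ^ k)"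
    by (rule borel_integrable_atLeastAtMost')
  have [measurable]: "g \<in> borel_measurable borel" using g by (rule borel_measurable_continuous_onI)
  have "(\<integral>s. indicator {a<..} s * (g s * cut_power k (sqrt (r\<^sup>2 - s\<^sup>2))) \<partial>lborel) =
      (LINT s:{a..r}|lborel. g s * sqrt (r\<^sup>2 - s\<^sup>2) ^ k)"
    unfolding set_lebesgue_integral_def
  proof (rule integral_cong_AE)
    have "AE s in lborel. s \<notin> {a, r}"
      by (intro AE_not_in countable_imp_null_set_lborel) auto
    then show "AE s in lborel. indicator {a<..} s * (g s * cut_power k (sqrt (r\<^sup>2 - s\<^sup>2))) = indicator {a..r} s *\<^sub>R (g s * sqrt (r\<^sup>2 - s\<^sup>2) ^ k)"
    proof eventually_elim
      case (elim s)
      show ?case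
      proof (cases "a < s")
        case True
        have "s\<^sup>2 < r\<^sup>2 \<longleftrightarrow> s < r" using True a power2_less_imp_less[of s r] power_strict_mono[of s r 2] by auto
        then show ?thesis using elim True by (auto simp: cut_power_def indicator_def)
      qed (use elim in \<open>auto simp: indicator_def\<close>)
    qed
  qed measurable
  also have "\<dots> = integral {a..r} (\<lambda>s. g s * sqrt (r\<^sup>2 - s\<^sup>2) ^ k)"
    by (rule set_borel_integral_eq_integral(2)[OF si])
  finally show ?thesis .
qed

lemma cap_half:
  assumes "r \<ge> 0"
  shows "integral {0..r} (\<lambda>s. sqrt (r\<^sup>2 - s\<^sup>2) ^ k) = r ^ Suc k * cap_int k / 2"
proof (cases "r = 0")
  case False
  with assms have r: "r > 0" by simp
  let ?f = "\<lambda>s. cut_power k (sqrt (r\<^sup>2 - s\<^sup>2))"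
  have i: "integrable lborel (\<lambda>s. indicator A s * ?f s)" if "A \<in> sets borel" for A
    using that r by (intro cap_integrable[of _ _ 1]) (auto simp: indicator_def)
  have "(\<integral>s. indicator {..<0} s * ?f s \<partial>lborel) = (\<integral>s. indicator {0<..} s * ?f s \<partial>lborel)"
    by (subst lborel_integral_real_affine[of "-1" _ 0]) (auto simp: indicator_def intro!: Bochner_Integration.integral_cong)
  moreover have "(\<integral>s. ?f s \<partial>lborel) = (\<integral>s. indicator {..<0} s * ?f s + indicator {0<..} s * ?f s \<partial>lborel)"
  proof (rule integral_cong_AE)
    have "AE s in lborel. s \<notin> {0::real}"
      by (intro AE_not_in countable_imp_null_set_lborel) auto
    then show "AE s in lborel. ?f s = indicator {..<0} s * ?f s + indicator {0<..} s * ?f s"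
      by eventually_elim (auto simp: indicator_def)
  qed measurable
  moreover have "(\<integral>s. indicator {..<0} s * ?f s + indicator {0<..} s * ?f s \<partial>lborel) =
      (\<integral>s. indicator {..<0} s * ?f s \<partial>lborel) + (\<integral>s. indicator {0<..} s * ?f s \<partial>lborel)"
    by (intro Bochner_Integration.integral_add i) auto
  moreover have "(\<integral>s. indicator {0<..} s * ?f s \<partial>lborel) = integral {0..r} (\<lambda>s. sqrt (r\<^sup>2 - s\<^sup>2) ^ k)"
    using cap_integral_eq_HK[of 0 r "\<lambda>_. 1" k] r by simp
  ultimately show ?thesis using cap_int_scale[OF r, of k] by simp
qed simp

text \<open>The fundamental theorem of calculus in its interior form, since the square root is not differentiable
  at the endpoint \<open>r\<close>.\<close>
lemma cap_first_moment:
  assumes "0 \<le> a" "a \<le> r"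
  shows "((\<lambda>s. s * sqrt (r\<^sup>2 - s\<^sup>2) ^ k) has_integral sqrt (r\<^sup>2 - a\<^sup>2) ^ (k + 2) / (real k + 2)) {a..r}"
proof -
  let ?F = "\<lambda>s. - (sqrt (r\<^sup>2 - s\<^sup>2) ^ (k + 2) / (real k + 2))"
  have "((\<lambda>s. s * sqrt (r\<^sup>2 - s\<^sup>2) ^ k) has_integral (?F r - ?F a)) {a..r}"
  proof (rule fundamental_theorem_of_calculus_interior[OF assms(2)])
    show "continuous_on {a..r} ?F" by (intro continuous_intros) auto
    fix s assume s: "s \<in> {a<..<r}"
    then have p: "r\<^sup>2 - s\<^sup>2 > 0" using assms by (simp add: power_strict_mono)
    have "((\<lambda>s. sqrt (r\<^sup>2 - s\<^sup>2)) has_real_derivative - s / sqrt (r\<^sup>2 - s\<^sup>2)) (at s)"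
      using p by (auto intro!: derivative_eq_intros simp: field_simps)
    from DERIV_power[OF this, of "k + 2"]
    have "((\<lambda>s. sqrt (r\<^sup>2 - s\<^sup>2) ^ (k + 2)) has_real_derivative real (k + 2) * ((- s / sqrt (r\<^sup>2 - s\<^sup>2)) * sqrt (r\<^sup>2 - s\<^sup>2) ^ (k + 1))) (at s)"
      by simp
    from DERIV_minus[OF DERIV_cdivide[OF this, of "real k + 2"]]
    have "(?F has_real_derivative - (real (k + 2) * ((- s / sqrt (r\<^sup>2 - s\<^sup>2)) * sqrt (r\<^sup>2 - s\<^sup>2) ^ (k + 1)) / (real k + 2))) (at s)" .
    also have "- (real (k + 2) * ((- s / sqrt (r\<^sup>2 - s\<^sup>2)) * sqrt (r\<^sup>2 - s\<^sup>2) ^ (k + 1)) / (real k + 2)) = s * sqrt (r\<^sup>2 - s\<^sup>2) ^ k"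
    proof -
      have q: "sqrt (r\<^sup>2 - s\<^sup>2) \<noteq> 0" "real k + 2 \<noteq> 0" using p by auto
      have e: "real (k + 2) = real k + 2" by simp
      show ?thesis unfolding e using q by (simp add: power_add)
    qed
    finally show "(?F has_vector_derivative s * sqrt (r\<^sup>2 - s\<^sup>2) ^ k) (at s)"
      by (rule has_real_derivative_iff_has_vector_derivative[THEN iffD1])
  qed
  then show ?thesis by simp
qed

lemma h_fun_explicit:
  assumes t: "0 \<le> t" "t \<le> 1"
  shows "h_fun (Suc k) t = - (cap_int k / 2) * t * sqrt (1 - t\<^sup>2) ^ Suc k"
proof -
  define r where "r = sqrt (1 - t\<^sup>2)"
  have r: "r \<ge> 0" "r\<^sup>2 = 1 - t\<^sup>2" using t by (auto simp: r_def power_le_one)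
  have e: "1 - s\<^sup>2 - t\<^sup>2 = r\<^sup>2 - s\<^sup>2" for s by (simp add: r)
  have 1: "integral {t..1} (\<lambda>s. s * sqrt (1 - s\<^sup>2) ^ k) = r ^ (k + 2) / (real k + 2)"
    using cap_first_moment[of t 1 k] t by (simp add: integral_unique r_def)
  have c: "continuous_on {0..r} (\<lambda>s. s * sqrt (r\<^sup>2 - s\<^sup>2) ^ k)" "continuous_on {0..r} (\<lambda>s. t * sqrt (r\<^sup>2 - s\<^sup>2) ^ k)"
    by (intro continuous_intros; simp)+
  have "integral {0..r} (\<lambda>s. (s + t) * sqrt (r\<^sup>2 - s\<^sup>2) ^ k) =
     integral {0..r} (\<lambda>s. s * sqrt (r\<^sup>2 - s\<^sup>2) ^ k) + integral {0..r} (\<lambda>s. t * sqrt (r\<^sup>2 - s\<^sup>2) ^ k)"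
    using c by (subst Henstock_Kurzweil_Integration.integral_add[symmetric])
      (auto intro: integrable_continuous_real simp: distrib_right)
  also have "integral {0..r} (\<lambda>s. s * sqrt (r\<^sup>2 - s\<^sup>2) ^ k) = r ^ (k + 2) / (real k + 2)"
  proof -
    have "sqrt (r\<^sup>2 - 0\<^sup>2) = r" using r(1) by simp
    then show ?thesis using cap_first_moment[of 0 r k] r(1) by (metis integral_unique order_refl)
  qed
  also have "integral {0..r} (\<lambda>s. t * sqrt (r\<^sup>2 - s\<^sup>2) ^ k) = t * (r ^ Suc k * cap_int k / 2)"
    using cap_half[OF r(1), of k] by simp
  finally show ?thesis unfolding h_fun_def e r_def[symmetric] using 1 by simp
qed

text \<open>The side of the corner that contains \<open>t\<close> contributes an odd integrand over \<open>{-t..1}\<close>, of which only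
  \<open>{t..1}\<close> remains; this is the first integral in \<open>h\<close>. The adjacent side contributes the second one.\<close>
lemma corner_moment:
  assumes t: "0 \<le> t" "t < 1"
  shows "(\<integral>s. (t - s) * cut_power k (sqrt (1 - corner_dist2 t s)) \<partial>lborel) = - h_fun (Suc k) t"
proof -
  define r where "r = sqrt (1 - t\<^sup>2)"
  have r: "r \<ge> 0" "r\<^sup>2 = 1 - t\<^sup>2" using t by (auto simp: r_def power_le_one)
  let ?c1 = "\<lambda>v. cut_power k (sqrt (1\<^sup>2 - v\<^sup>2))" and ?c2 = "\<lambda>v. cut_power k (sqrt (r\<^sup>2 - v\<^sup>2))"
  have i1: "integrable lborel (\<lambda>v. g v * ?c1 v)" if "g \<in> borel_measurable borel" "\<And>v. \<bar>v\<bar> \<le> 1 \<Longrightarrow> \<bar>g v\<bar> \<le> 2" for g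
    using that by (intro cap_integrable[of g 1 2]) auto
  have i2: "integrable lborel (\<lambda>v. g v * ?c2 v)" if "g \<in> borel_measurable borel" "\<And>v. \<bar>v\<bar> \<le> 1 \<Longrightarrow> \<bar>g v\<bar> \<le> 2" for g
  proof (rule cap_integrable[of g r 2])
    have "r \<le> 1" unfolding r_def using t by simp
    then show "\<bar>g v\<bar> \<le> 2" if "\<bar>v\<bar> \<le> r" for v using \<open>\<And>v. \<bar>v\<bar> \<le> 1 \<Longrightarrow> \<bar>g v\<bar> \<le> 2\<close> that by auto
  qed (use that r in auto)
  have split: "(t - s) * cut_power k (sqrt (1 - corner_dist2 t s)) =
     - (indicator {-t..} (s - t) * (s - t) * ?c1 (s - t)) + indicator {..<0} s * (t - s) * ?c2 s" for s
  proof (cases "s \<ge> 0")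
    case True then show ?thesis using t by (simp add: corner_dist2_def indicator_def algebra_simps)
  next
    case False
    then have e: "1 - corner_dist2 t s = r\<^sup>2 - s\<^sup>2" using t r(2) by (auto simp: corner_dist2_def zero_le_mult_iff)
    show ?thesis unfolding e using False by (simp add: indicator_def)
  qed
  have j1: "integrable lborel (\<lambda>v. indicator {-t..} v * v * ?c1 v)"
    by (intro i1) (auto simp: indicator_def)
  have "(\<integral>s. (t - s) * cut_power k (sqrt (1 - corner_dist2 t s)) \<partial>lborel) =
     (\<integral>s. - (indicator {-t..} (s - t) * (s - t) * ?c1 (s - t)) \<partial>lborel) + (\<integral>s. indicator {..<0} s * (t - s) * ?c2 s \<partial>lborel)"
    unfolding split
  proof (intro Bochner_Integration.integral_add Bochner_Integration.integrable_minus)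
    show "integrable lborel (\<lambda>s. indicator {-t..} (s - t) * (s - t) * ?c1 (s - t))"
      using lborel_integrable_real_affine[OF j1, of 1 "-t"] by simp
    show "integrable lborel (\<lambda>s. indicator {..<0} s * (t - s) * ?c2 s)"
      using t by (intro i2) (auto simp: indicator_def)
  qed
  also have "(\<integral>s. - (indicator {-t..} (s - t) * (s - t) * ?c1 (s - t)) \<partial>lborel) = - (\<integral>v. indicator {-t..} v * v * ?c1 v \<partial>lborel)"
    by (subst lborel_integral_real_affine[of 1 _ "-t", symmetric, simplified]) (simp_all add: Bochner_Integration.integral_minus)
  also have "(\<integral>v. indicator {-t..} v * v * ?c1 v \<partial>lborel) = (\<integral>v. indicator {t<..} v * (v * ?c1 v) \<partial>lborel)"
  proof -
    have odd: "(\<integral>v. indicator {-t..} v * v * ?c1 v \<partial>lborel) = - (\<integral>v. indicator {..t} v * v * ?c1 v \<partial>lborel)"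
      by (subst lborel_integral_real_affine[of "-1" _ 0])
         (auto simp: indicator_def Bochner_Integration.integral_minus[symmetric] simp del: Bochner_Integration.integral_minus intro!: Bochner_Integration.integral_cong)
    have odd0: "(\<integral>v. v * ?c1 v \<partial>lborel) = - (\<integral>v. v * ?c1 v \<partial>lborel)"
      by (subst lborel_integral_real_affine[of "-1" _ 0]) auto
    have "(\<integral>v. v * ?c1 v \<partial>lborel) = (\<integral>v. indicator {..t} v * v * ?c1 v + indicator {t<..} v * v * ?c1 v \<partial>lborel)"
      by (rule Bochner_Integration.integral_cong) (auto simp: indicator_def)
    also have "\<dots> = (\<integral>v. indicator {..t} v * v * ?c1 v \<partial>lborel) + (\<integral>v. indicator {t<..} v * v * ?c1 v \<partial>lborel)"
      by (intro Bochner_Integration.integral_add i1) (auto simp: indicator_def)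
    finally show ?thesis using odd odd0 by (simp add: mult.assoc)
  qed
  also have "\<dots> = integral {t..1} (\<lambda>s. s * sqrt (1\<^sup>2 - s\<^sup>2) ^ k)"
    using t by (intro cap_integral_eq_HK) (auto intro!: continuous_intros)
  also have "(\<integral>s. indicator {..<0} s * (t - s) * ?c2 s \<partial>lborel) = (\<integral>s. indicator {0<..} s * ((s + t) * ?c2 s) \<partial>lborel)"
    by (subst lborel_integral_real_affine[of "-1" _ 0]) (auto simp: indicator_def intro!: Bochner_Integration.integral_cong)
  also have "\<dots> = integral {0..r} (\<lambda>s. (s + t) * sqrt (r\<^sup>2 - s\<^sup>2) ^ k)"
    using r by (intro cap_integral_eq_HK) (auto intro!: continuous_intros)
  finally show ?thesis
    unfolding h_fun_def r_def[symmetric] by (simp add: r algebra_simps)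
qed

section \<open>The operator near a corner\<close>

definition wave :: "real \<Rightarrow> real \<Rightarrow> real" where
  "wave \<alpha> t = sin (pi / 2 * t - \<alpha>)"

lemma wave_measurable [measurable]: "wave \<alpha> \<in> borel_measurable borel"
  unfolding wave_def[abs_def] by measurable

lemma abs_wave_le: "\<bar>wave \<alpha> t\<bar> \<le> 1" by (simp add: wave_def)

lemma wave_sum: "wave \<alpha> (t + u) + wave \<alpha> (t - u) = 2 * wave \<alpha> t * cos (pi / 2 * u)"
proof -
  have "pi / 2 * (t + u) - \<alpha> = (pi / 2 * t - \<alpha>) + pi / 2 * u" "pi / 2 * (t - u) - \<alpha> = (pi / 2 * t - \<alpha>) - pi / 2 * u"
    by (auto simp: algebra_simps add_divide_distrib diff_divide_distrib)
  then show ?thesis unfolding wave_def by (simp only: sin_add sin_diff)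
qed

lemma wave_minus: "wave \<alpha> (- t) = - wave (- \<alpha>) t"
  unfolding wave_def using sin_minus[of "pi / 2 * t + \<alpha>"] by simp

lemma wave_shift: "wave \<alpha> (real c + t) = wave (\<alpha> - pi / 2 * real c) t"
  unfolding wave_def by (simp add: algebra_simps add_divide_distrib)

lemma pi_sq_le: "pi\<^sup>2 \<le> 16"
  using pi_less_4 pi_gt_zero power_mono[of pi 4 2] by simp

lemma wave_taylor:
  assumes "\<bar>t\<bar> \<le> d" "\<bar>s\<bar> \<le> d"
  shows "\<bar>wave \<alpha> t - wave \<alpha> s - pi / 2 * cos \<alpha> * (t - s)\<bar> \<le> 4 * d * \<bar>t - s\<bar>"
proof -
  have d: "d \<ge> 0" using assms by simp
  let ?f = "\<lambda>x. wave \<alpha> x - pi / 2 * cos \<alpha> * x"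
  have "norm (?f t - ?f s) \<le> 4 * d * norm (t - s)"
  proof (rule field_differentiable_bound[where S = "{-d..d}"])
    show "convex {-d..d}" by (rule convex_real_interval)
    fix x assume x: "x \<in> {-d..d}"
    show "(?f has_field_derivative pi / 2 * (cos (pi / 2 * x - \<alpha>) - cos \<alpha>)) (at x within {-d..d})"
      unfolding wave_def by (auto intro!: derivative_eq_intros simp: algebra_simps)
    have "\<bar>cos (pi / 2 * x - \<alpha>) - cos (- \<alpha>)\<bar> \<le> \<bar>(pi / 2 * x - \<alpha>) - (- \<alpha>)\<bar>"
    proof -
      have "norm (cos (pi / 2 * x - \<alpha>) - cos (- \<alpha>)) \<le> 1 * norm ((pi / 2 * x - \<alpha>) - (- \<alpha>))"
        by (rule field_differentiable_bound[where S = UNIV and f' = "\<lambda>x. - sin x"])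
           (auto intro!: derivative_eq_intros)
      then show ?thesis by simp
    qed
    also have "\<dots> = pi / 2 * \<bar>x\<bar>" by (simp add: abs_mult)
    also have "\<dots> \<le> pi / 2 * d" using x by (intro mult_left_mono) auto
    finally have "pi / 2 * \<bar>cos (pi / 2 * x - \<alpha>) - cos \<alpha>\<bar> \<le> pi / 2 * (pi / 2 * d)"
      by (intro mult_left_mono) auto
    also have "\<dots> = pi\<^sup>2 * d / 4" by (simp add: power2_eq_square)
    also have "\<dots> \<le> 4 * d" using mult_right_mono[OF pi_sq_le d] by simp
    finally show "norm (pi / 2 * (cos (pi / 2 * x - \<alpha>) - cos \<alpha>)) \<le> 4 * d" by (simp add: abs_mult)
  qed (use assms in auto)
  moreover have "?f t - ?f s = wave \<alpha> t - wave \<alpha> s - pi / 2 * cos \<alpha> * (t - s)"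
    by (simp only: right_diff_distrib)
  ultimately show ?thesis by simp
qed

lemma cos_taylor: "\<bar>1 - cos x - x\<^sup>2 / 2\<bar> \<le> x ^ 4 / (24::real)"
proof -
  obtain t where t: "cos x = (\<Sum>m<4. cos_coeff m * x ^ m) + (cos (t + 1/2 * real 4 * pi) / fact 4) * x ^ 4"
    using Maclaurin_cos_expansion[of x 4] by auto
  have "(\<Sum>m<4. cos_coeff m * x ^ m) = 1 - x\<^sup>2 / 2"
  proof -
    have "{..<4} = {0, 1, 2, 3::nat}" by auto
    then show ?thesis by (simp add: cos_coeff_def fact_numeral)
  qed
  then have "1 - cos x - x\<^sup>2 / 2 = - (cos (t + 2 * pi) / 24) * x ^ 4"
    using t by (simp add: fact_numeral)
  then have "\<bar>1 - cos x - x\<^sup>2 / 2\<bar> = \<bar>cos (t + 2 * pi)\<bar> * x ^ 4 / 24" by (simp add: abs_mult)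
  also have "\<dots> \<le> 1 * x ^ 4 / 24" by (intro divide_right_mono mult_right_mono) auto
  finally show ?thesis by simp
qed

text \<open>The integral in \<open>L_eps\<close> near one corner, at arc length \<open>t\<close>; \<open>N r\<close> stands for the volume of the ball of radius
  \<open>r\<close> in the second factor.\<close>
definition corner_int :: "real \<Rightarrow> (real \<Rightarrow> real) \<Rightarrow> real \<Rightarrow> real \<Rightarrow> real" where
  "corner_int \<alpha> N e t = (\<integral>s. indicator {-1..1} s * ((wave \<alpha> t - wave \<alpha> s) * N (sqrt (e\<^sup>2 - corner_dist2 t s))) \<partial>lborel)"

lemma corner_int_reflect: "corner_int \<alpha> N e (- t) = - corner_int (- \<alpha>) N e t"
proof -
  have d: "corner_dist2 (- t) (- s) = corner_dist2 t s" for s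
    by (simp add: corner_dist2_def power2_commute)
  have "corner_int \<alpha> N e (- t) = (\<integral>s. indicator {-1..1} (-s) * ((wave \<alpha> (-t) - wave \<alpha> (-s)) * N (sqrt (e\<^sup>2 - corner_dist2 (-t) (-s)))) \<partial>lborel)"
    unfolding corner_int_def by (subst lborel_integral_real_affine[of "-1" _ 0]) auto
  also have "\<dots> = (\<integral>s. - (indicator {-1..1} s * ((wave (- \<alpha>) t - wave (- \<alpha>) s) * N (sqrt (e\<^sup>2 - corner_dist2 t s)))) \<partial>lborel)"
    by (rule Bochner_Integration.integral_cong) (auto simp: d wave_minus indicator_def algebra_simps)
  finally show ?thesis by (simp add: corner_int_def)
qed

definition near_power :: "nat \<Rightarrow> real \<Rightarrow> real \<Rightarrow> real \<Rightarrow> (real \<Rightarrow> real) \<Rightarrow> bool" where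
  "near_power k w \<eta> e N \<longleftrightarrow> N \<in> borel_measurable borel \<and>
     (\<forall>r\<le>e. \<bar>N r - w * cut_power k r\<bar> \<le> \<eta> * w * cut_power k r)"

context
  fixes k :: nat and w \<eta> e :: real and N :: "real \<Rightarrow> real"
  assumes N: "near_power k w \<eta> e N" and w: "w > 0" and \<eta>: "0 \<le> \<eta>" "\<eta> \<le> 1" and e: "0 < e" "e \<le> 1/2"
begin

lemma near_power_measurable: "N \<in> borel_measurable borel"
  using N by (simp add: near_power_def)

lemma near_power_bounds:
  assumes "x \<ge> 0"
  shows "\<bar>N (sqrt (e\<^sup>2 - x)) - w * cut_power k (sqrt (e\<^sup>2 - x))\<bar> \<le> \<eta> * w * cut_power k (sqrt (e\<^sup>2 - x))"
    and "\<bar>N (sqrt (e\<^sup>2 - x))\<bar> \<le> 2 * w * cut_power k (sqrt (e\<^sup>2 - x))"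
    and "cut_power k (sqrt (e\<^sup>2 - x)) \<le> e ^ k"
proof -
  have "sqrt (e\<^sup>2 - x) \<le> e" using real_sqrt_le_mono[of "e\<^sup>2 - x" "e\<^sup>2"] assms e by simp
  then show 1: "\<bar>N (sqrt (e\<^sup>2 - x)) - w * cut_power k (sqrt (e\<^sup>2 - x))\<bar> \<le> \<eta> * w * cut_power k (sqrt (e\<^sup>2 - x))"
    using N unfolding near_power_def by blast
  have "\<eta> * w * cut_power k (sqrt (e\<^sup>2 - x)) \<le> 1 * w * cut_power k (sqrt (e\<^sup>2 - x))"
    using \<eta> w by (intro mult_right_mono) auto
  moreover have "0 \<le> w * cut_power k (sqrt (e\<^sup>2 - x))" using w by simp
  ultimately show "\<bar>N (sqrt (e\<^sup>2 - x))\<bar> \<le> 2 * w * cut_power k (sqrt (e\<^sup>2 - x))" using 1 by linarith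
  show "cut_power k (sqrt (e\<^sup>2 - x)) \<le> e ^ k" using e assms by (intro cut_sqrt_le) auto
qed

lemma near_power_zero: "e \<le> \<bar>x\<bar> \<Longrightarrow> N (sqrt (e\<^sup>2 - x\<^sup>2)) = 0"
  using near_power_bounds(2)[of "x\<^sup>2"] cut_sqrt_zero[of e x k] e by simp

text \<open>All \<open>s\<close> that contribute lie on the side of \<open>t\<close>. After averaging over \<open>t + u\<close> and \<open>t - u\<close> the integrand is
  \<open>wave \<alpha> t * (1 - cos (\<pi> u / 2))\<close>, so that only the second moment of the kernel matters.\<close>
lemma corner_int_flat:
  assumes t: "e \<le> t" "t \<le> 1/2"
  shows "\<bar>corner_int \<alpha> N e t - pi\<^sup>2 / 8 * wave \<alpha> t * (w * (\<integral>x. x\<^sup>2 * cut_power k (sqrt (e\<^sup>2 - x\<^sup>2)) \<partial>lborel))\<bar>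
    \<le> 4 * w * e ^ (k + 3) * (e\<^sup>2 + \<eta>)"
proof -
  note [measurable] = near_power_measurable
  let ?n = "\<lambda>u. N (sqrt (e\<^sup>2 - u\<^sup>2))" and ?p = "\<lambda>u. cut_power k (sqrt (e\<^sup>2 - u\<^sup>2))"
  have n0: "?n u = 0" "?p u = 0" if "e \<le> \<bar>u\<bar>" for u
    using near_power_zero[OF that] cut_sqrt_zero[OF that] e by auto
  have nb: "\<bar>?n u\<bar> \<le> 2 * w * ?p u" "?p u \<le> e ^ k" for u using near_power_bounds[of "u\<^sup>2"] by auto
  have nint: "integrable lborel (\<lambda>u. g u * ?n u)" if [measurable]: "g \<in> borel_measurable borel" and g: "\<And>u. \<bar>g u\<bar> \<le> C" for g C
  proof (rule integral_bounded_support(1))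
    show "\<bar>g u * ?n u\<bar> \<le> C * (2 * w * e ^ k) * indicator {-e..e} u" for u
    proof (cases "e \<le> \<bar>u\<bar>")
      case True
      have "0 \<le> C" using g[of 0] by linarith
      then show ?thesis using n0[OF True] e w by simp
    next
      case False
      have "\<bar>g u\<bar> * \<bar>?n u\<bar> \<le> C * (2 * w * e ^ k)"
        using g[of u] nb[of u] w by (intro mult_mono) (auto intro: order_trans[OF nb(1)])
      moreover have "u \<in> {-e..e}" using False by auto
      ultimately show ?thesis by (simp add: abs_mult)
    qed
  qed (use e in auto)
  have "corner_int \<alpha> N e t = (\<integral>s. (wave \<alpha> t - wave \<alpha> s) * ?n (s - t) \<partial>lborel)"
    unfolding corner_int_def
  proof (rule Bochner_Integration.integral_cong[OF refl])
    fix s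
    show "indicator {-1..1} s * ((wave \<alpha> t - wave \<alpha> s) * N (sqrt (e\<^sup>2 - corner_dist2 t s))) = (wave \<alpha> t - wave \<alpha> s) * ?n (s - t)"
    proof (cases "0 \<le> s")
      case True
      then have "corner_dist2 t s = (s - t)\<^sup>2" using t e by (simp add: corner_dist2_def)
      then show ?thesis using True t e n0(1)[of "s - t"] by (cases "s \<le> 1") auto
    next
      case False
      then have "e \<le> \<bar>s - t\<bar>" using t by simp
      moreover have "N (sqrt (e\<^sup>2 - corner_dist2 t s)) = 0"
      proof -
        have "t * s < 0" using False t e by (intro mult_pos_neg) auto
        then have "corner_dist2 t s = s\<^sup>2 + t\<^sup>2" by (simp add: corner_dist2_def)
        moreover have "e\<^sup>2 \<le> t\<^sup>2" using t e by (intro power_mono) auto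
        ultimately have "cut_power k (sqrt (e\<^sup>2 - corner_dist2 t s)) = 0"
          by (auto simp: cut_power_def) (smt (verit) zero_le_power2)
        then show ?thesis using near_power_bounds(2)[of "corner_dist2 t s"] by (simp add: corner_dist2_def)
      qed
      ultimately show ?thesis using n0 by simp
    qed
  qed
  also have "\<dots> = (\<integral>u. (wave \<alpha> t - wave \<alpha> (t + u)) * ?n u \<partial>lborel)"
    by (subst lborel_integral_real_affine[of 1 _ t]) auto
  finally have c1: "corner_int \<alpha> N e t = (\<integral>u. (wave \<alpha> t - wave \<alpha> (t + u)) * ?n u \<partial>lborel)" .
  then have c2: "corner_int \<alpha> N e t = (\<integral>u. (wave \<alpha> t - wave \<alpha> (t - u)) * ?n u \<partial>lborel)"
    by (subst (asm) lborel_integral_real_affine[of "-1" _ 0]) auto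
  have b2: "\<bar>wave \<alpha> t - wave \<alpha> s\<bar> \<le> 2" for s
    using abs_wave_le[of \<alpha> t] abs_wave_le[of \<alpha> s] by linarith
  have "2 * corner_int \<alpha> N e t = (\<integral>u. (wave \<alpha> t - wave \<alpha> (t + u)) * ?n u + (wave \<alpha> t - wave \<alpha> (t - u)) * ?n u \<partial>lborel)"
    by (subst Bochner_Integration.integral_add)
      (use c1 c2 in \<open>auto intro!: nint[of _ 2] b2\<close>)
  also have "\<dots> = (\<integral>u. 2 * (wave \<alpha> t * ((1 - cos (pi / 2 * u)) * ?n u)) \<partial>lborel)"
  proof (rule Bochner_Integration.integral_cong[OF refl])
    fix u
    have "wave \<alpha> t - wave \<alpha> (t + u) + (wave \<alpha> t - wave \<alpha> (t - u)) = 2 * wave \<alpha> t * (1 - cos (pi / 2 * u))"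
      using wave_sum[of \<alpha> t u] by (simp add: algebra_simps)
    then show "(wave \<alpha> t - wave \<alpha> (t + u)) * ?n u + (wave \<alpha> t - wave \<alpha> (t - u)) * ?n u = 2 * (wave \<alpha> t * ((1 - cos (pi / 2 * u)) * ?n u))"
      by (simp only: distrib_right[symmetric])
  qed
  finally have c: "corner_int \<alpha> N e t = wave \<alpha> t * (\<integral>u. (1 - cos (pi / 2 * u)) * ?n u \<partial>lborel)"
    by simp
  have i1: "integrable lborel (\<lambda>u. (1 - cos (pi / 2 * u)) * ?n u)"
  proof (rule nint[of _ 2])
    show "\<bar>1 - cos (pi / 2 * u)\<bar> \<le> 2" for u using cos_le_one[of "pi / 2 * u"] cos_ge_minus_one[of "pi / 2 * u"] by linarith
  qed measurable
  have i2: "integrable lborel (\<lambda>u. u\<^sup>2 * ?p u)"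
  proof (rule cap_integrable[of _ _ "e\<^sup>2"])
    show "\<bar>x\<^sup>2\<bar> \<le> e\<^sup>2" if "\<bar>x\<bar> \<le> e" for x using that by (simp add: abs_le_square_iff[symmetric] abs_of_pos e)
  qed (use e in auto)
  define d where "d u = (1 - cos (pi / 2 * u)) * ?n u - pi\<^sup>2 / 8 * w * (u\<^sup>2 * ?p u)" for u
  have db: "\<bar>d u\<bar> \<le> 2 * w * e ^ k * (e ^ 4 + \<eta> * e\<^sup>2) * indicator {-e..e} u" for u
  proof (cases "e \<le> \<bar>u\<bar>")
    case True
    then show ?thesis using n0[OF True] w e \<eta> by (simp add: d_def)
  next
    case False
    then have ue: "\<bar>u\<bar> \<le> e" by simp
    then have u2: "u\<^sup>2 \<le> e\<^sup>2" using e by (simp add: abs_le_square_iff[symmetric] abs_of_pos)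
    then have u4: "u ^ 4 \<le> e ^ 4" using power_mono[of "u\<^sup>2" "e\<^sup>2" 2] by simp
    have "d u = (1 - cos (pi / 2 * u) - (pi / 2 * u)\<^sup>2 / 2) * ?n u + pi\<^sup>2 / 8 * u\<^sup>2 * (?n u - w * ?p u)"
      by (simp add: d_def power_mult_distrib power_divide algebra_simps)
    then have "\<bar>d u\<bar> \<le> \<bar>1 - cos (pi / 2 * u) - (pi / 2 * u)\<^sup>2 / 2\<bar> * \<bar>?n u\<bar> + pi\<^sup>2 / 8 * u\<^sup>2 * \<bar>?n u - w * ?p u\<bar>"
      using abs_triangle_ineq[of "(1 - cos (pi / 2 * u) - (pi / 2 * u)\<^sup>2 / 2) * ?n u" "pi\<^sup>2 / 8 * u\<^sup>2 * (?n u - w * ?p u)"]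
      by (simp add: abs_mult)
    also have "\<dots> \<le> e ^ 4 * (2 * w * e ^ k) + 2 * e\<^sup>2 * (\<eta> * w * e ^ k)"
    proof (intro add_mono mult_mono)
      have "\<bar>1 - cos (pi / 2 * u) - (pi / 2 * u)\<^sup>2 / 2\<bar> \<le> (pi / 2 * u) ^ 4 / 24" by (rule cos_taylor)
      also have "\<dots> = (pi\<^sup>2)\<^sup>2 * u ^ 4 / 384" by (simp add: power_mult_distrib power_divide)
      also have "\<dots> \<le> 16\<^sup>2 * e ^ 4 / 384"
        using power_mono[OF pi_sq_le, of 2] u4 by (intro divide_right_mono mult_mono) auto
      also have "\<dots> \<le> e ^ 4" using e by simp
      finally show "\<bar>1 - cos (pi / 2 * u) - (pi / 2 * u)\<^sup>2 / 2\<bar> \<le> e ^ 4" .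
      show "\<bar>?n u\<bar> \<le> 2 * w * e ^ k" using nb[of u] w
        by (intro order_trans[OF nb(1)] mult_left_mono) auto
      show "pi\<^sup>2 / 8 \<le> 2" using pi_sq_le by simp
      show "\<bar>?n u - w * ?p u\<bar> \<le> \<eta> * w * e ^ k"
        using nb(2)[of u] w \<eta> by (intro order_trans[OF near_power_bounds(1)] mult_left_mono) auto
    qed (use u2 w e \<eta> in auto)
    also have "\<dots> = 2 * w * e ^ k * (e ^ 4 + \<eta> * e\<^sup>2)" by (simp add: algebra_simps)
    finally show ?thesis using ue by (simp add: abs_le_iff)
  qed
  have dm: "d \<in> borel_measurable borel" unfolding d_def[abs_def] by measurable
  have "\<bar>\<integral>u. d u \<partial>lborel\<bar> \<le> 2 * w * e ^ k * (e ^ 4 + \<eta> * e\<^sup>2) * (e - (- e))"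
    by (rule integral_bounded_support(2)[OF dm db]) (use e in simp)
  also have "\<dots> = 4 * w * e ^ (k + 3) * (e\<^sup>2 + \<eta>)"
    by (simp add: power_add algebra_simps power2_eq_square power3_eq_cube power4_eq_xxxx)
  finally have D: "\<bar>\<integral>u. d u \<partial>lborel\<bar> \<le> 4 * w * e ^ (k + 3) * (e\<^sup>2 + \<eta>)" .
  define X where "X = (\<integral>u. (1 - cos (pi / 2 * u)) * ?n u \<partial>lborel)"
  define M where "M = (\<integral>u. u\<^sup>2 * ?p u \<partial>lborel)"
  have "(\<integral>u. d u \<partial>lborel) = X - pi\<^sup>2 / 8 * w * M"
    unfolding d_def X_def M_def using i1 i2 by simp
  then have "corner_int \<alpha> N e t - pi\<^sup>2 / 8 * wave \<alpha> t * (w * M) = wave \<alpha> t * (\<integral>u. d u \<partial>lborel)"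
    unfolding c X_def[symmetric] by (simp only: right_diff_distrib mult_ac)
  then have "\<bar>corner_int \<alpha> N e t - pi\<^sup>2 / 8 * wave \<alpha> t * (w * M)\<bar> = \<bar>wave \<alpha> t\<bar> * \<bar>\<integral>u. d u \<partial>lborel\<bar>"
    by (simp add: abs_mult)
  also have "\<dots> \<le> 1 * \<bar>\<integral>u. d u \<partial>lborel\<bar>" by (intro mult_right_mono abs_wave_le) auto
  finally show ?thesis using D by (simp add: M_def)
qed

text \<open>Linearizing the wave at the corner costs \<open>O(e)\<close> relative to the main term and replacing \<open>N\<close> by its
  power costs \<open>O(\<eta>)\<close>; what remains is \<open>corner_moment\<close>, scaled by \<open>e\<close>.\<close>
lemma corner_int_corner:
  assumes t: "0 \<le> t" "t < e"
  shows "\<bar>corner_int \<alpha> N e t + pi / 2 * cos \<alpha> * w * e ^ (k + 2) * h_fun (Suc k) (t / e)\<bar>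
    \<le> 128 * w * e ^ (k + 2) * (e + \<eta>)"
proof -
  note [measurable] = near_power_measurable
  let ?n = "\<lambda>s. N (sqrt (e\<^sup>2 - corner_dist2 t s))" and ?p = "\<lambda>s. cut_power k (sqrt (e\<^sup>2 - corner_dist2 t s))"
  have c0: "0 \<le> corner_dist2 t s" for s by (simp add: corner_dist2_def)
  have near: "\<bar>?n s - w * ?p s\<bar> \<le> \<eta> * w * ?p s" "\<bar>?n s\<bar> \<le> 2 * w * ?p s" "?p s \<le> e ^ k" for s
    using near_power_bounds[OF c0] by auto
  have p0: "\<bar>s\<bar> \<le> 2 * e \<and> \<bar>t - s\<bar> \<le> 2 * e \<and> \<bar>s\<bar> \<le> 1" if "?p s \<noteq> 0" for s
  proof -
    have "corner_dist2 t s < e\<^sup>2" using that by (auto simp: cut_power_def split: if_splits)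
    then have "\<bar>s - t\<bar>\<^sup>2 < e\<^sup>2 \<and> t * s \<ge> 0 \<or> \<bar>s\<bar>\<^sup>2 < e\<^sup>2"
      by (auto simp: corner_dist2_def split: if_splits) (smt (verit) zero_le_power2)
    then have "\<bar>s - t\<bar> < e \<and> t * s \<ge> 0 \<or> \<bar>s\<bar> < e"
      using e by (meson power2_less_imp_less less_imp_le)
    moreover have "s \<ge> 0 \<or> t = 0" if "t * s \<ge> 0" using that t by (auto simp: zero_le_mult_iff)
    ultimately show ?thesis using t e by auto
  qed
  have n0: "?n s = 0" if "?p s = 0" for s using near(2)[of s] that by simp
  have I: "corner_int \<alpha> N e t = (\<integral>s. (wave \<alpha> t - wave \<alpha> s) * ?n s \<partial>lborel)"
    unfolding corner_int_def
  proof (rule Bochner_Integration.integral_cong[OF refl])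
    fix s
    show "indicator {-1..1} s * ((wave \<alpha> t - wave \<alpha> s) * ?n s) = (wave \<alpha> t - wave \<alpha> s) * ?n s"
      using p0[of s] n0[of s] by (cases "?p s = 0") (auto simp: indicator_def abs_le_iff)
  qed
  have main: "(\<integral>s. (t - s) * ?p s \<partial>lborel) = - (e ^ (k + 2) * h_fun (Suc k) (t / e))"
  proof -
    have sc: "corner_dist2 t (e * s) = e\<^sup>2 * corner_dist2 (t / e) s" for s
    proof -
      have "t * (e * s) \<ge> 0 \<longleftrightarrow> t / e * s \<ge> 0"
        using mult_le_cancel_left_pos[OF e(1), of 0 "t * s"] pos_le_divide_eq[OF e(1), of 0 "t * s"]
        by (simp add: mult_ac)
      moreover have "(e * s - t)\<^sup>2 = e\<^sup>2 * (s - t / e)\<^sup>2"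
        unfolding power_mult_distrib[symmetric] using e by (simp add: right_diff_distrib)
      moreover have "t\<^sup>2 = e\<^sup>2 * (t / e)\<^sup>2" using e by (simp add: power_divide)
      ultimately show ?thesis by (simp add: corner_dist2_def power_mult_distrib distrib_left)
    qed
    have "(\<integral>s. (t - s) * ?p s \<partial>lborel) = \<bar>e\<bar> * (\<integral>s. (t - (0 + e * s)) * ?p (0 + e * s) \<partial>lborel)"
      by (subst lborel_integral_real_affine[of e _ 0]) (use e in auto)
    also have "\<dots> = e * (\<integral>s. (e * e ^ k) * ((t / e - s) * cut_power k (sqrt (1 - corner_dist2 (t / e) s))) \<partial>lborel)"
    proof -
      have "(t - (0 + e * s)) * ?p (0 + e * s) = (e * e ^ k) * ((t / e - s) * cut_power k (sqrt (1 - corner_dist2 (t / e) s)))" for s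
      proof -
        have "t - (0 + e * s) = e * (t / e - s)" using e by (simp add: right_diff_distrib)
        moreover have "?p (0 + e * s) = e ^ k * cut_power k (sqrt (1 - corner_dist2 (t / e) s))"
          using e by (simp add: sc sqrt_scale cut_power_scale)
        ultimately show ?thesis by simp
      qed
      then show ?thesis using e by simp
    qed
    also have "\<dots> = e ^ (k + 2) * (\<integral>s. (t / e - s) * cut_power k (sqrt (1 - corner_dist2 (t / e) s)) \<partial>lborel)"
      by (simp add: power_add power2_eq_square)
    also have "(\<integral>s. (t / e - s) * cut_power k (sqrt (1 - corner_dist2 (t / e) s)) \<partial>lborel) = - h_fun (Suc k) (t / e)"
      using t e by (intro corner_moment) auto
    finally show ?thesis by simp
  qed
  define A where "A = pi / 2 * cos \<alpha>"
  have a: "\<bar>A\<bar> \<le> 2"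
  proof -
    have "\<bar>A\<bar> = pi / 2 * \<bar>cos \<alpha>\<bar>" by (simp add: A_def abs_mult)
    also have "\<dots> \<le> 2 * 1" using pi_less_4 by (intro mult_mono) auto
    finally show ?thesis by simp
  qed
  have ib: "integrable lborel f" if m: "f \<in> borel_measurable borel" and b: "\<And>s. \<bar>f s\<bar> \<le> C * ?p s" and C: "C \<ge> 0" for f C
  proof (rule integral_bounded_support(1)[OF m])
    show "\<bar>f s\<bar> \<le> (C * e ^ k) * indicator {-(2 * e)..2 * e} s" for s
    proof (cases "?p s = 0")
      case True then show ?thesis using b[of s] C e by simp
    next
      case False
      have "C * ?p s \<le> C * e ^ k" using C near(3) by (intro mult_left_mono) auto
      then show ?thesis using b[of s] p0[OF False] by (simp add: abs_le_iff)
    qed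
  qed (use e in auto)
  have b2: "\<bar>wave \<alpha> t - wave \<alpha> s\<bar> \<le> 2" for s
    using abs_wave_le[of \<alpha> t] abs_wave_le[of \<alpha> s] by linarith
  have i1: "integrable lborel (\<lambda>s. (wave \<alpha> t - wave \<alpha> s) * ?n s)"
  proof (rule ib[of _ "2 * (2 * w)"])
    show "\<bar>(wave \<alpha> t - wave \<alpha> s) * ?n s\<bar> \<le> 2 * (2 * w) * ?p s" for s
      using mult_mono[OF b2[of s] near(2)[of s]] w by (simp add: abs_mult mult_ac)
  qed (use w in auto)
  have i2: "integrable lborel (\<lambda>s. (t - s) * ?p s)"
  proof (rule ib[of _ "2 * e"])
    show "\<bar>(t - s) * ?p s\<bar> \<le> 2 * e * ?p s" for s
      using p0[of s] by (cases "?p s = 0") (auto simp: abs_mult intro!: mult_right_mono)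
  qed (use e in auto)
  define d where "d s = (wave \<alpha> t - wave \<alpha> s) * ?n s - A * w * ((t - s) * ?p s)" for s
  have db: "\<bar>d s\<bar> \<le> 32 * w * e ^ (k + 1) * (e + \<eta>) * indicator {-(2 * e)..2 * e} s" for s
  proof (cases "?p s = 0")
    case True
    then show ?thesis using n0[OF True] w e \<eta> by (simp add: d_def)
  next
    case False
    note s = p0[OF False]
    have "d s = (wave \<alpha> t - wave \<alpha> s - A * (t - s)) * ?n s + A * (t - s) * (?n s - w * ?p s)"
      by (simp add: d_def algebra_simps)
    then have "\<bar>d s\<bar> \<le> \<bar>wave \<alpha> t - wave \<alpha> s - A * (t - s)\<bar> * \<bar>?n s\<bar> + \<bar>A\<bar> * \<bar>t - s\<bar> * \<bar>?n s - w * ?p s\<bar>"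
      by (metis abs_mult abs_triangle_ineq)
    also have "\<dots> \<le> (16 * e\<^sup>2) * (2 * w * e ^ k) + 2 * (2 * e) * (\<eta> * w * e ^ k)"
    proof (intro add_mono mult_mono)
      have "\<bar>wave \<alpha> t - wave \<alpha> s - A * (t - s)\<bar> \<le> 4 * (2 * e) * \<bar>t - s\<bar>"
        unfolding A_def using s t e by (intro wave_taylor) auto
      also have "\<dots> \<le> 4 * (2 * e) * (2 * e)" using s e by (intro mult_left_mono) auto
      also have "\<dots> = 16 * e\<^sup>2" by (simp add: power2_eq_square)
      finally show "\<bar>wave \<alpha> t - wave \<alpha> s - A * (t - s)\<bar> \<le> 16 * e\<^sup>2" .
      have "2 * w * ?p s \<le> 2 * w * e ^ k" using w near(3) by (intro mult_left_mono) auto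
      then show "\<bar>?n s\<bar> \<le> 2 * w * e ^ k" using near(2)[of s] by linarith
      have "\<eta> * w * ?p s \<le> \<eta> * w * e ^ k" using w \<eta> near(3) by (intro mult_left_mono) auto
      then show "\<bar>?n s - w * ?p s\<bar> \<le> \<eta> * w * e ^ k" using near(1)[of s] by linarith
    qed (use a s w e \<eta> in auto)
    also have "\<dots> = 32 * w * e ^ (k + 1) * e + 4 * w * e ^ (k + 1) * \<eta>"
      by (simp add: power_add algebra_simps power2_eq_square)
    also have "\<dots> \<le> 32 * w * e ^ (k + 1) * e + 32 * w * e ^ (k + 1) * \<eta>"
      using w e \<eta> by (intro add_left_mono mult_right_mono) auto
    also have "\<dots> = 32 * w * e ^ (k + 1) * (e + \<eta>)" by (simp add: algebra_simps)
    finally show ?thesis using s by (simp add: abs_le_iff)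
  qed
  have dm: "d \<in> borel_measurable borel" unfolding d_def[abs_def] by measurable
  have "\<bar>\<integral>s. d s \<partial>lborel\<bar> \<le> 32 * w * e ^ (k + 1) * (e + \<eta>) * (2 * e - - (2 * e))"
    by (rule integral_bounded_support(2)[OF dm db]) (use e in simp)
  also have "\<dots> = 128 * w * e ^ (k + 2) * (e + \<eta>)"
    by (simp add: power_add algebra_simps power2_eq_square)
  finally have D: "\<bar>\<integral>s. d s \<partial>lborel\<bar> \<le> 128 * w * e ^ (k + 2) * (e + \<eta>)" .
  have "(\<integral>s. d s \<partial>lborel) = corner_int \<alpha> N e t - A * w * (\<integral>s. (t - s) * ?p s \<partial>lborel)"
    unfolding d_def I using i1 i2 by simp
  then have "(\<integral>s. d s \<partial>lborel) = corner_int \<alpha> N e t + pi / 2 * cos \<alpha> * w * e ^ (k + 2) * h_fun (Suc k) (t / e)"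
    unfolding main by (simp add: A_def)
  then show ?thesis using D by simp
qed

end

section \<open>The boundary of the square\<close>

definition edge_path :: "real \<Rightarrow> real \<times> real" where
  "edge_path u = (if u \<le> 1 then (u, 0) else if u \<le> 2 then (1, u - 1) else if u \<le> 3 then (3 - u, 1) else (0, 4 - u))"

text \<open>The arc length parametrization of the square that \<open>vol_M1\<close> uses, as a function of period \<open>4\<close>.\<close>
definition contour :: "real \<Rightarrow> real \<times> real" where
  "contour t = phi (cis (pi / 2 * t))"

definition contour_inv :: "real \<times> real \<Rightarrow> real" where
  "contour_inv x = (if snd x = 0 then fst x else if fst x = 1 then 1 + snd x else if snd x = 1 then 3 - fst x else 4 - snd x)"

lemma contour_add4 [simp]: "contour (t + 4) = contour t"
proof -
  have e: "pi / 2 * (t + 4) = pi / 2 * t + 2 * pi" by (simp add: field_simps)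
  show ?thesis unfolding contour_def e by (simp add: complex_eq_iff cis_mult[symmetric])
qed

lemma Arg2pi_cis: "0 \<le> t \<Longrightarrow> t < 4 \<Longrightarrow> Arg2pi (cis (pi / 2 * t)) = pi / 2 * t"
  by (rule Arg2pi_unique[of 1]) (auto simp: cis_conv_exp)

lemma contour_eq_edge_path:
  assumes "0 \<le> t" "t < 4" shows "contour t = edge_path t"
proof -
  have "pi / 2 * t \<le> pi / 2 \<longleftrightarrow> t \<le> 1" "pi / 2 * t \<le> pi \<longleftrightarrow> t \<le> 2" "pi / 2 * t \<le> 3 / 2 * pi \<longleftrightarrow> t \<le> 3"
    by (auto simp: field_simps)
  then show ?thesis
    unfolding contour_def phi_def Arg2pi_cis[OF assms] Let_def edge_path_def by simp
qed

lemma contour_frac: "contour t = edge_path (4 * frac (t / 4))"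
proof -
  have p: "contour (t + 4 * of_int n) = contour t" for t n
  proof (induction n rule: int_induct[where k = 0])
    case (step1 i) then show ?case using contour_add4[of "t + 4 * of_int i"] by (simp add: algebra_simps)
  next
    case (step2 i) then show ?case using contour_add4[of "t + 4 * of_int (i - 1)"] by (simp add: algebra_simps)
  qed simp
  have "4 * frac (t / 4) = t + 4 * of_int (- \<lfloor>t / 4\<rfloor>)" by (simp add: frac_def)
  then have "contour t = contour (4 * frac (t / 4))" by (simp only: p)
  also have "\<dots> = edge_path (4 * frac (t / 4))"
    using frac_lt_1[of "t / 4"] by (intro contour_eq_edge_path) auto
  finally show ?thesis .
qed

lemma contour_measurable [measurable]: "contour \<in> borel_measurable borel"
proof -
  have "edge_path \<in> borel_measurable borel" unfolding edge_path_def[abs_def] by measurable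
  moreover have "(\<lambda>t::real. 4 * frac (t / 4)) \<in> borel_measurable borel"
    unfolding frac_def by measurable
  ultimately have "(\<lambda>t. edge_path (4 * frac (t / 4))) \<in> borel_measurable borel"
    by (rule measurable_compose[rotated])
  then show ?thesis by (simp add: contour_frac[abs_def])
qed

lemma M1_eq: "M1 = {x. 0 \<le> fst x \<and> fst x \<le> 1 \<and> 0 \<le> snd x \<and> snd x \<le> 1 \<and> \<not> (0 < fst x \<and> fst x < 1 \<and> 0 < snd x \<and> snd x < 1)}"
proof -
  have "closure ({0..1::real} \<times> {0..1::real}) = {0..1} \<times> {0..1}" by (simp add: closure_Times)
  moreover have "interior ({0..1::real} \<times> {0..1::real}) = {0<..<1} \<times> {0<..<1}"
    by (simp add: interior_Times)
  ultimately show ?thesis unfolding M1_def frontier_def by (auto simp: mem_Times_iff)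
qed

lemma M1_borel [measurable]: "M1 \<in> sets borel"
  by (simp add: M1_def)

lemma contour_inv_range: "x \<in> M1 \<Longrightarrow> 0 \<le> contour_inv x \<and> contour_inv x < 4"
  unfolding M1_eq contour_inv_def by auto

lemma contour_contour_inv:
  assumes "x \<in> M1" shows "contour (contour_inv x) = x"
proof -
  have "edge_path (contour_inv x) = x"
    using assms unfolding M1_eq contour_inv_def edge_path_def by (cases x) (auto split: if_splits)
  then show ?thesis using contour_eq_edge_path contour_inv_range[OF assms] by simp
qed

lemma contour_inv_contour:
  assumes "0 \<le> t" "t < 4" shows "contour_inv (contour t) = t"
  using assms unfolding contour_eq_edge_path[OF assms] contour_inv_def edge_path_def by auto

lemma contour_in_M1: "contour t \<in> M1"
proof -
  have "0 \<le> u \<Longrightarrow> u < 4 \<Longrightarrow> edge_path u \<in> M1" for u unfolding M1_eq edge_path_def by auto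
  then show ?thesis using frac_lt_1[of "t / 4"] by (simp add: contour_frac)
qed

lemma contour_inv_measurable [measurable]: "contour_inv \<in> borel_measurable borel"
proof -
  have [measurable]: "(fst :: real \<times> real \<Rightarrow> real) \<in> borel_measurable borel" "(snd :: real \<times> real \<Rightarrow> real) \<in> borel_measurable borel"
    by (auto intro!: borel_measurable_continuous_onI continuous_intros)
  show ?thesis unfolding contour_inv_def[abs_def] by measurable
qed

lemma phi_inv_contour: "phi_inv (contour t) = cis (pi / 2 * t)"
proof -
  have "inj_on phi (sphere 0 1)"
  proof (rule inj_onI)
    fix z w :: complex assume zw: "z \<in> sphere 0 1" "w \<in> sphere 0 1" "phi z = phi w"
    have ex: "\<exists>t. 0 \<le> t \<and> t < 4 \<and> z = cis (pi / 2 * t)" if "z \<in> sphere 0 1" for z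
      using that Arg2pi[of z]
      by (intro exI[of _ "2 / pi * Arg2pi z"]) (auto simp: field_simps cis_conv_exp is_Arg_def)
    obtain s t where "0 \<le> t" "t < 4" "z = cis (pi / 2 * t)" "0 \<le> s" "s < 4" "w = cis (pi / 2 * s)"
      using ex zw by metis
    then show "z = w" using zw(3) contour_inv_contour unfolding contour_def by metis
  qed
  then show ?thesis unfolding phi_inv_def contour_def by (intro inv_into_f_f) auto
qed

lemma f_alpha_eq_inner:
  assumes "z \<in> sphere 0 1" shows "f_alpha \<alpha> z = (\<i> * cis \<alpha>) \<bullet> z"
proof -
  have "z = exp (\<i> * of_real (Arg2pi z))" using assms Arg2pi[of z] by (simp add: is_Arg_def)
  then have z: "z = cis (Arg2pi z)" by (simp add: cis_conv_exp)
  have "(\<i> * cis \<alpha>) \<bullet> cis (Arg2pi z) = sin (Arg2pi z - \<alpha>)"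
    by (simp add: inner_complex_def sin_diff)
  then show ?thesis using z by (simp add: f_alpha_def)
qed

lemma F_alpha_contour: "F_alpha \<alpha> (contour t, y) = sin (pi / 2 * t - \<alpha>)"
proof -
  have "F_alpha \<alpha> (contour t, y) = (\<i> * cis \<alpha>) \<bullet> cis (pi / 2 * t)"
    unfolding F_alpha_def by (simp add: phi_inv_contour f_alpha_eq_inner)
  then show ?thesis by (simp add: inner_complex_def sin_diff)
qed

lemma F_alpha_M1: "x \<in> M1 \<Longrightarrow> F_alpha \<alpha> (x, y) = sin (pi / 2 * contour_inv x - \<alpha>)"
  using F_alpha_contour[of \<alpha> "contour_inv x" y] by (simp add: contour_contour_inv)

text \<open>A quarter turn of the square maps \<open>contour t\<close> to \<open>contour (t + 1)\<close>, so all corners look like the one at \<open>0\<close>.\<close>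
lemma dist_contour_shift1: "dist (contour (s + 1)) (contour (t + 1)) = dist (contour s) (contour t)"
proof -
  define \<rho> :: "real \<times> real \<Rightarrow> real \<times> real" where "\<rho> x = (1 - snd x, fst x)" for x
  have *: "contour (t + 1) = \<rho> (contour t)" if "0 \<le> t" "t < 4" for t
  proof (cases "t < 3")
    case True
    then show ?thesis using that by (subst (1 2) contour_eq_edge_path) (auto simp: \<rho>_def edge_path_def)
  next
    case False
    have "contour (t + 1) = contour (t - 3)" using contour_add4[of "t - 3"] by (simp add: add.commute)
    then show ?thesis using that False by (auto simp: contour_eq_edge_path \<rho>_def edge_path_def)
  qed
  have "contour (t + 1) = \<rho> (contour t)" for t
  proof -
    have e: "contour (4 * frac (t / 4)) = contour t" for t
      by (subst (1) contour_eq_edge_path) (use frac_lt_1[of "t / 4"] contour_frac in auto)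
    have "contour (t + 1) = contour (4 * frac (t / 4) + 1)"
    proof -
      have "(4 * frac (t / 4) + 1) / 4 = (t + 1) / 4 + of_int (- \<lfloor>t / 4\<rfloor>)" by (simp add: frac_def field_simps)
      then have "frac ((4 * frac (t / 4) + 1) / 4) = frac ((t + 1) / 4)" by (simp only: frac_def floor_add_int of_int_add) simp
      then show ?thesis by (simp only: contour_frac)
    qed
    also have "\<dots> = \<rho> (contour (4 * frac (t / 4)))" using frac_lt_1[of "t / 4"] by (intro *) auto
    finally show ?thesis by (simp only: e)
  qed
  then have "dist (contour (s + 1)) (contour (t + 1)) = dist (\<rho> (contour s)) (\<rho> (contour t))" by (simp only:)
  then show ?thesis by (simp add: \<rho>_def dist_prod_def dist_real_def add.commute power2_commute)
qed

lemma dist_contour_shift: "dist (contour (real c + s)) (contour (real c + t)) = dist (contour s) (contour t)"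
proof (induction c)
  case (Suc c)
  then show ?case using dist_contour_shift1[of "real c + s" "real c + t"] by (simp add: add_ac)
qed simp

lemma contour_near_0:
  "0 \<le> t \<Longrightarrow> t \<le> 1 \<Longrightarrow> contour t = (t, 0)"
  "-1 \<le> t \<Longrightarrow> t \<le> 0 \<Longrightarrow> contour t = (0, - t)"
  "1 \<le> t \<Longrightarrow> t \<le> 2 \<Longrightarrow> contour t = (1, t - 1)"
  "-2 \<le> t \<Longrightarrow> t \<le> -1 \<Longrightarrow> contour t = (- 1 - t, 1)"
proof -
  show "0 \<le> t \<Longrightarrow> t \<le> 1 \<Longrightarrow> contour t = (t, 0)" "1 \<le> t \<Longrightarrow> t \<le> 2 \<Longrightarrow> contour t = (1, t - 1)"
    by (auto simp: contour_eq_edge_path edge_path_def)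
  have neg: "contour t = edge_path (t + 4)" if "-4 \<le> t" "t < 0" for t
    using contour_eq_edge_path[of "t + 4"] that by simp
  show "-1 \<le> t \<Longrightarrow> t \<le> 0 \<Longrightarrow> contour t = (0, - t)"
    by (cases "t = 0") (auto simp: contour_eq_edge_path neg edge_path_def)
  show "-2 \<le> t \<Longrightarrow> t \<le> -1 \<Longrightarrow> contour t = (- 1 - t, 1)"
    by (auto simp: neg edge_path_def)
qed

lemma dist_contour_near:
  assumes "\<bar>t\<bar> \<le> 1" "\<bar>s\<bar> \<le> 1"
  shows "(dist (contour t) (contour s))\<^sup>2 = corner_dist2 t s"
proof -
  consider "t \<ge> 0 \<and> s \<ge> 0" | "t \<le> 0 \<and> s \<le> 0" | "t > 0 \<and> s < 0" | "t < 0 \<and> s > 0" by linarith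
  then show ?thesis
  proof cases
    case 1 then show ?thesis using assms by (simp add: contour_near_0 dist_prod_def dist_real_def corner_dist2_def power2_commute)
  next
    case 2 then show ?thesis using assms by (simp add: contour_near_0 dist_prod_def dist_real_def corner_dist2_def mult_nonpos_nonpos)
  next
    case 3 then show ?thesis using assms mult_pos_neg[of t s] by (simp add: contour_near_0 dist_prod_def dist_real_def corner_dist2_def)
  next
    case 4 then show ?thesis using assms mult_neg_pos[of t s] by (simp add: contour_near_0 dist_prod_def dist_real_def corner_dist2_def)
  qed
qed

lemma dist_contour_far:
  assumes "\<bar>t\<bar> \<le> 1/2" "1 \<le> \<bar>s\<bar>" "\<bar>s\<bar> \<le> 2"
  shows "1/2 \<le> dist (contour t) (contour s)"
proof -
  have d: "\<bar>fst a - fst b\<bar> \<le> dist a b" "\<bar>snd a - snd b\<bar> \<le> dist a b" for a b :: "real \<times> real"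
    using dist_fst_le[of a b] dist_snd_le[of a b] by (simp_all add: dist_real_def)
  consider "t \<ge> 0 \<and> s \<ge> 0" | "t \<le> 0 \<and> s \<le> 0" | "t \<ge> 0 \<and> s < 0" | "t \<le> 0 \<and> s > 0" by linarith
  then show ?thesis
  proof cases
    case 1 then show ?thesis using assms d(1)[of "contour t" "contour s"] by (simp add: contour_near_0)
  next
    case 2 then show ?thesis using assms d(2)[of "contour t" "contour s"] by (simp add: contour_near_0)
  next
    case 3 then show ?thesis using assms d(2)[of "contour t" "contour s"] by (simp add: contour_near_0)
  next
    case 4 then show ?thesis using assms d(1)[of "contour t" "contour s"] by (simp add: contour_near_0)
  qed
qed

abbreviation period_measure :: "real measure" where
  "period_measure \<equiv> restrict_space lborel {0..<4}"

lemma vol_M1_eq: "vol_M1 = distr period_measure (restrict_space borel M1) contour"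
  unfolding vol_M1_def contour_def[abs_def] by simp

lemma contour_measurable_M1 [measurable]: "contour \<in> measurable borel (restrict_space borel M1)"
  "contour \<in> measurable period_measure (restrict_space borel M1)"
  by (auto intro!: measurable_restrict_space2 contour_in_M1 measurable_restrict_space1)

lemma sets_vol_M1 [simp, measurable_cong]: "sets vol_M1 = sets (restrict_space borel M1)"
  and space_vol_M1 [simp]: "space vol_M1 = M1"
  by (simp_all add: vol_M1_eq space_restrict_space)

lemma finite_measure_period: "finite_measure period_measure"
  by standard (simp add: emeasure_restrict_space space_restrict_space)

lemma finite_measure_vol_M1: "finite_measure vol_M1"
  unfolding vol_M1_eq using finite_measure_period by (rule finite_measure.finite_measure_distr) measurable

lemma integral_vol_M1:
  fixes f :: "real \<times> real \<Rightarrow> real"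
  assumes "f \<in> borel_measurable (restrict_space borel M1)"
  shows "(\<integral>x. f x \<partial>vol_M1) = (LINT t:{0..<4}|lborel. f (contour t))"
  unfolding vol_M1_eq
  by (subst integral_distr[OF contour_measurable_M1(2) assms])
     (simp add: integral_restrict_space set_lebesgue_integral_def)

section \<open>The operator on the product\<close>

lemma integral_period_shift:
  fixes f :: "real \<Rightarrow> real"
  assumes m[measurable]: "f \<in> borel_measurable borel" and per: "\<And>s. f (s + 4) = f s" and b: "\<And>s. \<bar>f s\<bar> \<le> C"
    and a: "-4 \<le> a" "a \<le> 4"
  shows "(\<integral>s. indicator {0..<4} s * f s \<partial>lborel) = (\<integral>s. indicator {a..<a + 4} s * f s \<partial>lborel)"
proof -
  have i: "integrable lborel (\<lambda>s. indicator {x..<y} s * f s)" if "x \<le> y" for x y :: real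
  proof (rule integral_bounded_support(1)[of _ C x y])
    show "\<bar>indicator {x..<y} s * f s\<bar> \<le> C * indicator {x..y} s" for s
      using b[of s] by (auto simp: indicator_def)
  qed (use that in auto)
  have split: "(\<integral>s. indicator {x..<z} s * f s \<partial>lborel) =
      (\<integral>s. indicator {x..<y} s * f s \<partial>lborel) + (\<integral>s. indicator {y..<z} s * f s \<partial>lborel)"
    if "x \<le> y" "y \<le> z" for x y z :: real
  proof -
    have "(\<integral>s. indicator {x..<z} s * f s \<partial>lborel) = (\<integral>s. indicator {x..<y} s * f s + indicator {y..<z} s * f s \<partial>lborel)"
      using that by (intro Bochner_Integration.integral_cong) (auto simp: indicator_def)
    also have "\<dots> = (\<integral>s. indicator {x..<y} s * f s \<partial>lborel) + (\<integral>s. indicator {y..<z} s * f s \<partial>lborel)"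
      by (intro Bochner_Integration.integral_add i that)
    finally show ?thesis .
  qed
  have shift: "(\<integral>s. indicator {x + 4..<y + 4} s * f s \<partial>lborel) = (\<integral>s. indicator {x..<y} s * f s \<partial>lborel)" for x y :: real
  proof -
    have "(\<integral>s. indicator {x + 4..<y + 4} s * f s \<partial>lborel) = (\<integral>s. indicator {x + 4..<y + 4} (4 + 1 * s) * f (4 + 1 * s) \<partial>lborel)"
      by (subst lborel_integral_real_affine[of 1 _ 4]) auto
    also have "\<dots> = (\<integral>s. indicator {x..<y} s * f s \<partial>lborel)"
      using per by (intro Bochner_Integration.integral_cong) (auto simp: indicator_def add.commute)
    finally show ?thesis .
  qed
  have pos: "(\<integral>s. indicator {0..<4} s * f s \<partial>lborel) = (\<integral>s. indicator {a..<a + 4} s * f s \<partial>lborel)" if "0 \<le> a" "a \<le> 4" for a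
    using split[of 0 a 4] split[of a 4 "a + 4"] shift[of 0 a] that by simp
  show ?thesis
  proof (cases "0 \<le> a")
    case True then show ?thesis using pos a by simp
  next
    case False
    then show ?thesis using pos[of "a + 4"] shift[of a "a + 4"] a by simp
  qed
qed

lemma wave_period: "wave \<alpha> (t + 4) = wave \<alpha> t"
proof -
  have "pi / 2 * (t + 4) - \<alpha> = (pi / 2 * t - \<alpha>) + 2 * pi" by (simp add: field_simps)
  then show ?thesis unfolding wave_def by (simp only: sin_periodic)
qed

lemma F_alpha_wave: "x \<in> M1 \<Longrightarrow> F_alpha \<alpha> (x, y) = wave \<alpha> (contour_inv x)" "F_alpha \<alpha> (contour t, y) = wave \<alpha> t"
  by (simp_all add: F_alpha_M1 F_alpha_contour wave_def)

lemma laplacian_M_contour: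
  fixes S :: "'a::euclidean_space set"
  assumes S: "smooth_submanifold k S" and y: "y \<in> S"
  shows "laplacian_M S (F_alpha \<alpha>) (contour t, y) = pi\<^sup>2 / 4 * wave \<alpha> t"
proof -
  let ?c = "complex_of_real (pi / 2) * (\<i> * cis \<alpha>)"
  let ?f = "\<lambda>(w, y'). F_alpha \<alpha> (phi ((pi / 2) *\<^sub>R w), y')"
  have f: "?f (w, y') = ?c \<bullet> w" if w: "w \<in> sphere 0 (2 / pi)" for w and y' :: 'a
  proof -
    let ?z = "(pi / 2) *\<^sub>R w"
    have z: "?z \<in> sphere 0 1" using w by simp
    have ex: "?z = cis (pi / 2 * (2 / pi * Arg2pi ?z))"
      using z Arg2pi[of ?z] by (simp add: is_Arg_def cis_conv_exp)
    then have "phi_inv (phi ?z) = ?z" using phi_inv_contour[of "2 / pi * Arg2pi ?z"] unfolding contour_def by metis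
    then have "?f (w, y') = (\<i> * cis \<alpha>) \<bullet> ?z" using f_alpha_eq_inner[OF z] by (simp add: F_alpha_def)
    also have "\<dots> = ?c \<bullet> w" by (simp add: inner_complex_def algebra_simps)
    finally show ?thesis .
  qed
  have w: "(2 / pi) *\<^sub>R cis (pi / 2 * t) \<in> sphere 0 (2 / pi)" by simp
  have "laplacian_M S (F_alpha \<alpha>) (contour t, y) = laplacian_on (sphere 0 (2 / pi) \<times> S) ?f ((2 / pi) *\<^sub>R cis (pi / 2 * t), y)"
    by (simp add: laplacian_M_def phi_inv_contour)
  also have "\<dots> = (?c \<bullet> ((2 / pi) *\<^sub>R cis (pi / 2 * t))) / (2 / pi)\<^sup>2"
    by (rule laplacian_on_circle_Times[OF S _ f w y]) auto
  also have "?c \<bullet> ((2 / pi) *\<^sub>R cis (pi / 2 * t)) = wave \<alpha> t"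
    by (simp add: inner_complex_def wave_def sin_diff)
  finally show ?thesis by (simp add: power_divide)
qed

lemma dist_prod_less_iff:
  "dist (a, b) (c, d) < e \<longleftrightarrow> dist b d < sqrt (e\<^sup>2 - (dist a c)\<^sup>2)" if "e > 0"
proof -
  have "dist (a, b) (c, d) < e \<longleftrightarrow> sqrt ((dist a c)\<^sup>2 + (dist b d)\<^sup>2) < sqrt (e\<^sup>2)"
    using that by (simp add: dist_Pair_Pair)
  also have "\<dots> \<longleftrightarrow> (dist b d)\<^sup>2 < e\<^sup>2 - (dist a c)\<^sup>2" by (simp only: real_sqrt_less_iff) linarith
  also have "\<dots> \<longleftrightarrow> sqrt ((dist b d)\<^sup>2) < sqrt (e\<^sup>2 - (dist a c)\<^sup>2)" by (simp only: real_sqrt_less_iff)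
  finally show ?thesis by simp
qed

locale corner_product =
  fixes k :: nat and S :: "'a::euclidean_space set"
  assumes compact: "compact S" and smooth: "smooth_submanifold k S" and nonempty: "S \<noteq> {}"
begin

definition vol :: "'a measure" where "vol = riemannian_volume k S"

lemma sets_vol [measurable_cong]: "sets vol = sets (restrict_space borel S)"
  and space_vol [simp]: "space vol = S"
  using sets_riemannian_volume[OF compact smooth] by (simp_all add: vol_def)

lemma S_borel: "S \<in> sets borel" using compact by (simp add: compact_imp_closed)

sublocale vol: finite_measure vol
  unfolding vol_def by (rule riemannian_volume_finite[OF compact smooth])

sublocale vol1: finite_measure vol_M1 by (rule finite_measure_vol_M1)

sublocale pair_sigma_finite vol_M1 vol ..

definition ball_volume :: "'a \<Rightarrow> real \<Rightarrow> real" where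
  "ball_volume y r = measure vol (S \<inter> ball y r)"

lemma S_ball_sets [measurable]: "S \<inter> ball y r \<in> sets vol"
  using S_borel by (auto simp: sets_vol sets_restrict_space_iff)

lemma ball_volume_mono: "mono (ball_volume y)"
  unfolding ball_volume_def by (intro monoI vol.finite_measure_mono) (auto)

lemma ball_volume_measurable [measurable]: "ball_volume y \<in> borel_measurable borel"
  by (rule borel_measurable_mono[OF ball_volume_mono])

lemma ball_volume_nonpos: "r \<le> 0 \<Longrightarrow> ball_volume y r = 0"
  unfolding ball_volume_def by (simp add: ball_empty)

lemma ball_volume_bounds: "0 \<le> ball_volume y r" "ball_volume y r \<le> measure vol S"
  using vol.bounded_measure[of "S \<inter> ball y r"] by (simp_all add: ball_volume_def)

lemma near_power_ball_volume:
  assumes "\<eta> > 0"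
  obtains \<rho> where "\<rho> > 0" "\<And>y e. y \<in> S \<Longrightarrow> e < \<rho> \<Longrightarrow> near_power k (unit_ball_vol (real k)) \<eta> e (ball_volume y)"
proof -
  let ?w = "unit_ball_vol (real k)"
  obtain \<rho> where \<rho>: "\<rho> > 0" "\<And>y r. y \<in> S \<Longrightarrow> 0 < r \<Longrightarrow> r < \<rho> \<Longrightarrow>
      ennreal ((1 - \<eta>) * (?w * r ^ k)) \<le> emeasure vol (S \<inter> ball y r) \<and>
      emeasure vol (S \<inter> ball y r) \<le> ennreal ((1 + \<eta>) * (?w * r ^ k))"
    using riemannian_volume_density[OF compact smooth assms] unfolding vol_def by metis
  have "near_power k ?w \<eta> e (ball_volume y)" if y: "y \<in> S" and e: "e < \<rho>" for y e
    unfolding near_power_def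
  proof (intro conjI allI impI)
    fix r assume r: "r \<le> e"
    show "\<bar>ball_volume y r - ?w * cut_power k r\<bar> \<le> \<eta> * ?w * cut_power k r"
    proof (cases "r > 0")
      case False
      then show ?thesis by (simp add: cut_power_def ball_volume_nonpos)
    next
      case True
      have "ennreal ((1 - \<eta>) * (?w * r ^ k)) \<le> ennreal (ball_volume y r) \<and>
        ennreal (ball_volume y r) \<le> ennreal ((1 + \<eta>) * (?w * r ^ k))"
        using \<rho>(2)[OF y True] r e by (simp add: ball_volume_def vol.emeasure_eq_measure)
      moreover have "0 \<le> (1 + \<eta>) * (?w * r ^ k)" using assms True by simp
      ultimately have "(1 - \<eta>) * (?w * r ^ k) \<le> ball_volume y r" "ball_volume y r \<le> (1 + \<eta>) * (?w * r ^ k)"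
        using ball_volume_bounds(1)[of y r] by (auto simp: ennreal_le_iff2)
      then show ?thesis using True by (simp add: cut_power_def abs_le_iff algebra_simps)
    qed
  qed measurable
  then show ?thesis using \<rho>(1) that by blast
qed

abbreviation volM :: "((real \<times> real) \<times> 'a) measure" where "volM \<equiv> vol_M1 \<Otimes>\<^sub>M vol"

lemma volM_eq: "volM = vol_M (Suc k) S"
  by (simp add: vol_M_def vol_def)

lemma space_volM: "space volM = M1 \<times> S"
  by (simp add: space_pair_measure)

sublocale volM: finite_measure volM
  by (intro finite_measure_pair_measure vol.finite_measure_axioms vol1.finite_measure_axioms)

lemma id_measurable: "(\<lambda>x. x) \<in> measurable vol_M1 borel" "(\<lambda>x. x) \<in> measurable vol borel"
  by (auto intro!: measurable_restrict_space1 simp: measurable_cong_sets[OF sets_vol refl] measurable_cong_sets[OF sets_vol_M1 refl])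

lemma fst_snd_measurable [measurable]: "fst \<in> measurable volM borel" "snd \<in> measurable volM borel"
  using measurable_compose[OF measurable_fst id_measurable(1), of vol]
    measurable_compose[OF measurable_snd id_measurable(2), of vol_M1] by simp_all

definition kernel :: "real \<Rightarrow> real \<Rightarrow> (real \<times> real) \<times> 'a \<Rightarrow> (real \<times> real) \<times> 'a \<Rightarrow> real" where
  "kernel \<alpha> e z0 z = indicator {z. dist z0 z < e} z * (wave \<alpha> (contour_inv (fst z0)) - wave \<alpha> (contour_inv (fst z)))"

lemma kernel_bound: "\<bar>kernel \<alpha> e z0 z\<bar> \<le> 2"
  using abs_wave_le[of \<alpha> "contour_inv (fst z0)"] abs_wave_le[of \<alpha> "contour_inv (fst z)"]
  unfolding kernel_def by (auto simp: indicator_def)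

lemma kernel_measurable: "(\<lambda>(z0, z). kernel \<alpha> e z0 z) \<in> borel_measurable (volM \<Otimes>\<^sub>M volM)"
proof -
  have [measurable]: "(\<lambda>p. dist (fst (fst p)) (fst (snd p))) \<in> borel_measurable (volM \<Otimes>\<^sub>M volM)"
    by (intro borel_measurable_dist; measurable)
  have [measurable]: "(\<lambda>p. dist (snd (fst p)) (snd (snd p))) \<in> borel_measurable (volM \<Otimes>\<^sub>M volM)"
    by (intro borel_measurable_dist; measurable)
  have "(\<lambda>p. indicator {r. r < e} (sqrt ((dist (fst (fst p)) (fst (snd p)))\<^sup>2 + (dist (snd (fst p)) (snd (snd p)))\<^sup>2)) *
    (wave \<alpha> (contour_inv (fst (fst p))) - wave \<alpha> (contour_inv (fst (snd p))))) \<in> borel_measurable (volM \<Otimes>\<^sub>M volM)"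
    by measurable
  also have "(\<lambda>p. indicator {r. r < e} (sqrt ((dist (fst (fst p)) (fst (snd p)))\<^sup>2 + (dist (snd (fst p)) (snd (snd p)))\<^sup>2)) *
    (wave \<alpha> (contour_inv (fst (fst p))) - wave \<alpha> (contour_inv (fst (snd p))))) = (\<lambda>(z0, z). kernel \<alpha> e z0 z)"
    by (auto simp: fun_eq_iff kernel_def indicator_def dist_prod_def)
  finally show ?thesis .
qed

lemma L_eps_kernel:
  assumes "z0 \<in> M1 \<times> S"
  shows "L_eps (Suc k) S e (F_alpha \<alpha>) z0 = 1 / e ^ (k + 3) * (\<integral>z. kernel \<alpha> e z0 z \<partial>volM)"
proof -
  have "(LINT z : ball z0 e \<inter> M1 \<times> S | volM. F_alpha \<alpha> z0 - F_alpha \<alpha> z) = (\<integral>z. kernel \<alpha> e z0 z \<partial>volM)"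
    unfolding set_lebesgue_integral_def
  proof (rule Bochner_Integration.integral_cong[OF refl])
    fix z assume "z \<in> space volM"
    then have "z \<in> M1 \<times> S" by (simp add: space_volM)
    then show "indicator (ball z0 e \<inter> M1 \<times> S) z *\<^sub>R (F_alpha \<alpha> z0 - F_alpha \<alpha> z) = kernel \<alpha> e z0 z"
      using assms by (cases z; cases z0) (auto simp: kernel_def indicator_def F_alpha_wave)
  qed
  then show ?thesis unfolding L_eps_def volM_eq[symmetric] by (simp add: numeral_eq_Suc)
qed

lemma L_eps_measurable: "(\<lambda>z. L_eps (Suc k) S e (F_alpha \<alpha>) z) \<in> borel_measurable volM"
proof -
  have "(\<lambda>z0. 1 / e ^ (k + 3) * (\<integral>z. kernel \<alpha> e z0 z \<partial>volM)) \<in> borel_measurable volM"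
    using sigma_finite_measure.borel_measurable_lebesgue_integral[OF _ kernel_measurable]
      finite_measure.axioms(1)[OF volM.finite_measure_axioms]
    by (intro borel_measurable_times borel_measurable_const) blast
  then show ?thesis
    by (subst measurable_cong[OF L_eps_kernel]) (simp_all add: space_volM)
qed

lemma L_eps_bounded:
  assumes "z0 \<in> M1 \<times> S" "e > 0"
  shows "\<bar>L_eps (Suc k) S e (F_alpha \<alpha>) z0\<bar> \<le> 1 / e ^ (k + 3) * (2 * measure volM (space volM))"
proof -
  have "\<bar>\<integral>z. kernel \<alpha> e z0 z \<partial>volM\<bar> \<le> (\<integral>z. \<bar>kernel \<alpha> e z0 z\<bar> \<partial>volM)" by (rule integral_abs_bound)
  also have "\<dots> \<le> (\<integral>z. 2 \<partial>volM)"
    using kernel_bound by (intro integral_mono_AE') auto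
  finally have "\<bar>\<integral>z. kernel \<alpha> e z0 z \<partial>volM\<bar> \<le> 2 * measure volM (space volM)" by simp
  then show ?thesis unfolding L_eps_kernel[OF assms(1)]
    using assms(2) by (simp add: abs_mult divide_right_mono)
qed

text \<open>Integrating over the second factor first turns the indicator of the ball into the volume of a ball of
  radius \<open>sqrt (e\<^sup>2 - d\<^sup>2)\<close> in \<open>S\<close>, where \<open>d\<close> is the distance in the square. By periodicity the integral over the
  square can be centred at the corner \<open>c\<close>, and the two opposite sides are out of reach.\<close>
lemma L_eps_corner_int:
  assumes e: "0 < e" "e \<le> 1/2" and t: "\<bar>t\<bar> \<le> 1/2" and c: "c \<le> 4" and y: "y \<in> S"
  shows "L_eps (Suc k) S e (F_alpha \<alpha>) (contour (real c + t), y) =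
    corner_int (\<alpha> - pi / 2 * real c) (ball_volume y) e t / e ^ (k + 3)"
proof -
  let ?x0 = "contour (real c + t)" and ?N = "ball_volume y"
  have z0: "(?x0, y) \<in> M1 \<times> S" using y contour_in_M1 by simp
  have m: "kernel \<alpha> e (?x0, y) \<in> borel_measurable volM"
    using measurable_Pair2[OF kernel_measurable, of "(?x0, y)"] z0 by (simp add: space_volM)
  have int: "integrable volM (kernel \<alpha> e (?x0, y))"
    by (rule volM.integrable_const_bound[of _ 2]) (use m kernel_bound in auto)
  have w0: "wave \<alpha> (contour_inv ?x0) = wave \<alpha> (real c + t)"
    using F_alpha_wave(1)[OF contour_in_M1, of \<alpha> "real c + t" y] F_alpha_wave(2)[of \<alpha> "real c + t" y] by simp
  have ww: "wave \<alpha> (contour_inv (contour s)) = wave \<alpha> s" for s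
    using F_alpha_wave(1)[OF contour_in_M1, of \<alpha> s y] F_alpha_wave(2)[of \<alpha> s y] by simp
  define \<psi> where "\<psi> s = (wave \<alpha> (real c + t) - wave \<alpha> s) * ?N (sqrt (e\<^sup>2 - (dist ?x0 (contour s))\<^sup>2))" for s
  have "(\<integral>z. kernel \<alpha> e (?x0, y) z \<partial>volM) = (\<integral>x. (\<integral>y'. kernel \<alpha> e (?x0, y) (x, y') \<partial>vol) \<partial>vol_M1)"
    by (rule integral_fst'[symmetric, OF int])
  also have "\<dots> = (\<integral>x. (wave \<alpha> (real c + t) - wave \<alpha> (contour_inv x)) * ?N (sqrt (e\<^sup>2 - (dist ?x0 x)\<^sup>2)) \<partial>vol_M1)"
  proof (rule Bochner_Integration.integral_cong[OF refl])
    fix x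
    let ?r = "sqrt (e\<^sup>2 - (dist ?x0 x)\<^sup>2)"
    have "(\<integral>y'. kernel \<alpha> e (?x0, y) (x, y') \<partial>vol) = (\<integral>y'. (wave \<alpha> (real c + t) - wave \<alpha> (contour_inv x)) * indicator (S \<inter> ball y ?r) y' \<partial>vol)"
      by (rule Bochner_Integration.integral_cong[OF refl])
        (auto simp: kernel_def w0 indicator_def dist_prod_less_iff[OF e(1)])
    also have "\<dots> = (wave \<alpha> (real c + t) - wave \<alpha> (contour_inv x)) * ?N ?r"
    proof -
      have "(S \<inter> ball y ?r) \<inter> S = S \<inter> ball y ?r" by auto
      then show ?thesis by (simp add: ball_volume_def)
    qed
    finally show "(\<integral>y'. kernel \<alpha> e (?x0, y) (x, y') \<partial>vol) = (wave \<alpha> (real c + t) - wave \<alpha> (contour_inv x)) * ?N ?r" .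
  qed
  also have "\<dots> = (LINT s:{0..<4}|lborel. \<psi> s)"
    unfolding \<psi>_def
  proof (subst integral_vol_M1)
    have [measurable]: "(\<lambda>x. dist ?x0 x) \<in> borel_measurable borel" by measurable
    have "(\<lambda>x. (wave \<alpha> (real c + t) - wave \<alpha> (contour_inv x)) * ?N (sqrt (e\<^sup>2 - (dist ?x0 x)\<^sup>2))) \<in> borel_measurable borel"
      by measurable
    then show "(\<lambda>x. (wave \<alpha> (real c + t) - wave \<alpha> (contour_inv x)) * ?N (sqrt (e\<^sup>2 - (dist ?x0 x)\<^sup>2))) \<in> borel_measurable (restrict_space borel M1)"
      by (rule measurable_restrict_space1)
  qed (simp add: ww)
  also have "\<dots> = (\<integral>s. indicator {0..<4} s * \<psi> s \<partial>lborel)" by (simp add: set_lebesgue_integral_def)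
  also have "\<dots> = (\<integral>s. indicator {real c - 2..<real c - 2 + 4} s * \<psi> s \<partial>lborel)"
  proof (rule integral_period_shift)
    show "\<psi> \<in> borel_measurable borel" unfolding \<psi>_def[abs_def] by measurable
    show "\<psi> (s + 4) = \<psi> s" for s by (simp add: \<psi>_def wave_period)
    show "\<bar>\<psi> s\<bar> \<le> 2 * measure vol S" for s
    proof -
      have "\<bar>wave \<alpha> (real c + t) - wave \<alpha> s\<bar> \<le> 2"
        using abs_wave_le[of \<alpha> "real c + t"] abs_wave_le[of \<alpha> s] by linarith
      moreover have "\<bar>?N r\<bar> \<le> measure vol S" for r using ball_volume_bounds[of y r] by simp
      ultimately show ?thesis unfolding \<psi>_def abs_mult by (intro mult_mono) auto
    qed
  qed (use c in auto)
  also have "\<dots> = (\<integral>s. indicator {real c - 2..<real c - 2 + 4} (real c + 1 * s) * \<psi> (real c + 1 * s) \<partial>lborel)"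
    by (subst lborel_integral_real_affine[of 1 _ "real c"]) auto
  also have "\<dots> = corner_int (\<alpha> - pi / 2 * real c) ?N e t"
    unfolding corner_int_def
  proof (rule integral_cong_AE)
    have "AE s in lborel. s \<notin> {1, -1 :: real}"
      by (intro AE_not_in countable_imp_null_set_lborel) auto
    then show "AE s in lborel. indicator {real c - 2..<real c - 2 + 4} (real c + 1 * s) * \<psi> (real c + 1 * s) =
       indicator {-1..1} s * ((wave (\<alpha> - pi / 2 * real c) t - wave (\<alpha> - pi / 2 * real c) s) * ?N (sqrt (e\<^sup>2 - corner_dist2 t s)))"
    proof eventually_elim
      case (elim s)
      show ?case
      proof (cases "\<bar>s\<bar> \<le> 1")
        case True
        then show ?thesis using t by (auto simp: \<psi>_def dist_contour_shift wave_shift dist_contour_near indicator_def)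
      next
        case False
        show ?thesis
        proof (cases "\<bar>s\<bar> \<le> 2")
          case True
          have "1/2 \<le> dist (contour t) (contour s)" using t True False by (intro dist_contour_far) auto
          then have "e\<^sup>2 \<le> (dist (contour t) (contour s))\<^sup>2" using e by (intro power_mono) auto
          then have "\<psi> (real c + s) = 0" by (simp add: \<psi>_def dist_contour_shift ball_volume_nonpos)
          moreover have "s \<notin> {-1..1}" using False by auto
          ultimately show ?thesis by simp
        next
          case False
          then show ?thesis by (auto simp: indicator_def)
        qed
      qed
    qed
  qed (unfold \<psi>_def, measurable)
  finally show ?thesis unfolding L_eps_kernel[OF z0] by simp
qed

end

section \<open>The limiting corner profile\<close>

context corner_product begin

definition profile :: "real \<Rightarrow> real" where
  "profile v = (if \<bar>v\<bar> < 1 then \<bar>h_fun (Suc k) \<bar>v\<bar>\<bar> else 0)"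

definition profile_mass :: real where "profile_mass = integral {0..1} (\<lambda>t. \<bar>h_fun (Suc k) t\<bar>)"

lemma abs_h_fun: "0 \<le> t \<Longrightarrow> t \<le> 1 \<Longrightarrow> \<bar>h_fun (Suc k) t\<bar> = cap_int k / 2 * t * sqrt (1 - t\<^sup>2) ^ Suc k"
  using cap_int_pos[of k] by (simp add: h_fun_explicit abs_mult abs_le_square_iff power_le_one)

lemma profile_eq: "profile v = indicator {-1..1} v * (cap_int k / 2 * \<bar>v\<bar> * sqrt (1 - v\<^sup>2) ^ Suc k)"
proof (cases "\<bar>v\<bar> < 1")
  case True
  moreover have "v \<in> {-1..1}" using True by auto
  ultimately show ?thesis by (simp add: profile_def abs_h_fun)
next
  case False
  show ?thesis
  proof (cases "\<bar>v\<bar> = 1")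
    case True
    then have "v\<^sup>2 = 1" by (metis power2_abs power_one)
    then show ?thesis using False by (simp add: profile_def)
  next
    case ne: False
    then have "v \<notin> {-1..1}" using False by auto
    then show ?thesis using False by (simp add: profile_def)
  qed
qed

lemma profile_measurable [measurable]: "profile \<in> borel_measurable borel"
  unfolding profile_eq[abs_def] by measurable

lemma profile_nonneg: "0 \<le> profile v" by (simp add: profile_def)

lemma profile_le: "profile v \<le> cap_int k / 2 * indicator {-1..1} v"
proof (cases "v \<in> {-1..1}")
  case True
  then have "\<bar>v\<bar> \<le> 1" "v\<^sup>2 \<le> 1" by (auto simp: abs_square_le_1)
  then have "cap_int k / 2 * \<bar>v\<bar> * sqrt (1 - v\<^sup>2) ^ Suc k \<le> cap_int k / 2 * 1 * 1"
    using cap_int_pos[of k] by (intro mult_mono power_le_one) auto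
  then show ?thesis using True by (simp add: profile_eq)
qed (simp add: profile_eq)

lemma profile_integrable:
  assumes [measurable]: "A \<in> sets borel" shows "integrable lborel (\<lambda>v. indicator A v * profile v)"
proof (rule integral_bounded_support(1)[of _ "cap_int k / 2" "-1" 1])
  show "\<bar>indicator A v * profile v\<bar> \<le> cap_int k / 2 * indicator {-1..1} v" for v
    using profile_le[of v] profile_nonneg[of v] by (cases "v \<in> A") auto
qed auto

lemma profile_right: "(\<integral>v. indicator {0..} v * profile v \<partial>lborel) = profile_mass"
proof -
  have eq: "\<bar>h_fun (Suc k) t\<bar> = cap_int k / 2 * t * sqrt (1 - t\<^sup>2) ^ Suc k" if "t \<in> {0..1}" for t
    using abs_h_fun that by simp
  have "continuous_on {0..1} (\<lambda>t. cap_int k / 2 * t * sqrt (1 - t\<^sup>2) ^ Suc k)" by (intro continuous_intros)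
  from set_borel_integral_eq_integral(2)[OF borel_integrable_atLeastAtMost'[OF this]]
  have "(LINT t:{0..1}|lborel. cap_int k / 2 * t * sqrt (1 - t\<^sup>2) ^ Suc k) = profile_mass"
    unfolding profile_mass_def by (subst Henstock_Kurzweil_Integration.integral_cong[OF eq]) simp_all
  moreover have "(LINT t:{0..1}|lborel. cap_int k / 2 * t * sqrt (1 - t\<^sup>2) ^ Suc k) = (\<integral>v. indicator {0..} v * profile v \<partial>lborel)"
    unfolding set_lebesgue_integral_def profile_eq
    by (intro Bochner_Integration.integral_cong) (auto simp: indicator_def)
  ultimately show ?thesis by simp
qed

lemma profile_left: "(\<integral>v. indicator {..<0} v * profile v \<partial>lborel) = profile_mass"
proof -
  have "(\<integral>v. indicator {..<0} v * profile v \<partial>lborel) = (\<integral>v. indicator {..<0} (-v) * profile (-v) \<partial>lborel)"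
    by (subst lborel_integral_real_affine[of "-1" _ 0]) auto
  also have "\<dots> = (\<integral>v. indicator {0..} v * profile v \<partial>lborel)"
  proof (rule Bochner_Integration.integral_cong[OF refl])
    fix v :: real
    show "indicator {..<0} (-v) * profile (-v) = indicator {0..} v * profile v"
      by (cases "v = 0") (auto simp: indicator_def profile_eq)
  qed
  finally show ?thesis by (simp add: profile_right)
qed

lemma profile_total: "(\<integral>v. profile v \<partial>lborel) = 2 * profile_mass"
proof -
  have "(\<integral>v. profile v \<partial>lborel) = (\<integral>v. indicator {..<0} v * profile v + indicator {0..} v * profile v \<partial>lborel)"
    by (intro Bochner_Integration.integral_cong) (auto simp: indicator_def)
  also have "\<dots> = (\<integral>v. indicator {..<0} v * profile v \<partial>lborel) + (\<integral>v. indicator {0..} v * profile v \<partial>lborel)"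
    by (intro Bochner_Integration.integral_add profile_integrable) auto
  finally show ?thesis by (simp add: profile_left profile_right)
qed

lemma profile_mass_pos: "profile_mass > 0"
proof -
  let ?f = "\<lambda>t. \<bar>h_fun (Suc k) t\<bar>"
  have eq: "?f t = cap_int k / 2 * t * sqrt (1 - t\<^sup>2) ^ Suc k" if "t \<in> {0..1}" for t
    using abs_h_fun that by simp
  have "continuous_on {0..1} (\<lambda>t. cap_int k / 2 * t * sqrt (1 - t\<^sup>2) ^ Suc k)" by (intro continuous_intros)
  then have c: "continuous_on {0..1} ?f" by (subst continuous_on_cong[OF refl eq])
  have "profile_mass \<noteq> 0"
  proof
    assume "profile_mass = 0"
    then have "\<forall>t\<in>{0..1}. ?f t = 0"
      using integral_eq_0_iff[OF c] unfolding profile_mass_def by simp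
    then have "?f (1/2) = 0" by simp
    moreover have "?f (1/2) > 0" using cap_int_pos[of k] by (subst abs_h_fun) (auto simp: power2_eq_square)
    ultimately show False by simp
  qed
  moreover have "profile_mass \<ge> 0" unfolding profile_mass_def
    using c by (intro Henstock_Kurzweil_Integration.integral_nonneg integrable_continuous_real) auto
  ultimately show ?thesis by simp
qed

lemma h_fun_not_constant: "\<not> h_fun (Suc k) constant_on {0..1}"
proof
  assume "h_fun (Suc k) constant_on {0..1}"
  then obtain a where "\<And>t. t \<in> {0..1} \<Longrightarrow> h_fun (Suc k) t = a" unfolding constant_on_def by blast
  from this[of 0] this[of "1/2"] have "h_fun (Suc k) 0 = h_fun (Suc k) (1/2)" by simp
  moreover have "h_fun (Suc k) 0 = 0" by (subst h_fun_explicit) auto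
  moreover have "\<bar>h_fun (Suc k) (1/2)\<bar> > 0" using cap_int_pos[of k] by (subst abs_h_fun) (auto simp: power2_eq_square)
  ultimately show False by simp
qed

lemma profile_piece:
  assumes e: "0 < e" "e \<le> 1/2" and c: "c \<le> (4::nat)"
  shows "(\<integral>t. indicator {0..<4} t * profile ((t - real c) / e) \<partial>lborel) = (if c = 0 \<or> c = 4 then 1 else 2) * e * profile_mass"
proof -
  have "(\<integral>t. indicator {0..<4} t * profile ((t - real c) / e) \<partial>lborel) =
     \<bar>e\<bar> * (\<integral>v. indicator {0..<4} (real c + e * v) * profile ((real c + e * v - real c) / e) \<partial>lborel)"
    by (subst lborel_integral_real_affine[of e _ "real c"]) (use e in auto)
  also have "\<dots> = e * (\<integral>v. indicator {0..<4} (real c + e * v) * profile v \<partial>lborel)" using e by simp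
  also have "(\<integral>v. indicator {0..<4} (real c + e * v) * profile v \<partial>lborel) =
      (\<integral>v. (if c = 0 then indicator {0..} v else if c = 4 then indicator {..<0} v else 1) * profile v \<partial>lborel)"
  proof (rule Bochner_Integration.integral_cong[OF refl])
    fix v :: real
    show "indicator {0..<4} (real c + e * v) * profile v = (if c = 0 then indicator {0..} v else if c = 4 then indicator {..<0} v else 1) * profile v"
    proof (cases "\<bar>v\<bar> < 1")
      case False then show ?thesis by (simp add: profile_def)
    next
      case True
      have "\<bar>e * v\<bar> \<le> 1/2 * 1" unfolding abs_mult using e True by (intro mult_mono) auto
      then have ev: "-1/2 \<le> e * v" "e * v \<le> 1/2" by (auto simp: abs_le_iff)
      have s: "0 \<le> e * v \<longleftrightarrow> 0 \<le> v" using e by (simp add: zero_le_mult_iff)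
      consider "c = 0" | "c = 4" | "1 \<le> real c \<and> real c \<le> 3 \<and> c \<noteq> 0 \<and> c \<noteq> 4" using c by linarith
      then show ?thesis
      proof cases
        case 1 then show ?thesis using ev s by (auto simp: indicator_def)
      next
        case 2 then show ?thesis using ev s by (auto simp: indicator_def)
      next
        case 3
        then have "real c + e * v \<in> {0..<4}" using ev by auto
        then show ?thesis using 3 by simp
      qed
    qed
  qed
  also have "\<dots> = (if c = 0 \<or> c = 4 then 1 else 2) * profile_mass"
    by (simp add: profile_left profile_right profile_total)
  finally show ?thesis by simp
qed

definition omega :: real where "omega = unit_ball_vol (real k)"

lemma omega_pos: "omega > 0" by (simp add: omega_def)

lemma sigma_pos: "sigma_m (Suc k) > 0" by (simp add: sigma_m_def)

definition model :: "real \<Rightarrow> real \<Rightarrow> real \<Rightarrow> real" where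
  "model \<alpha> e t = (\<Sum>c\<le>4. (omega * (pi / 2) * \<bar>cos (\<alpha> - pi / 2 * real c)\<bar> / e) * profile ((t - real c) / e))"

text \<open>The corner \<open>contour 0 = contour 4\<close> occurs twice because \<open>t\<close> runs
  over an interval, here and in \<open>model\<close>.\<close>
definition near_corner :: "real \<Rightarrow> real \<Rightarrow> real" where
  "near_corner e t = (\<Sum>c\<le>(4::nat). indicator {real c - e<..<real c + e} t)"

text \<open>The first term bounds the error at points away from the corners. In the second one, \<open>2 \<sigma>\<close> bounds the Laplacian term,
  which is not part of the model near a corner.\<close>
definition pointwise_error :: "real \<Rightarrow> real \<Rightarrow> real \<Rightarrow> real" where
  "pointwise_error e \<eta> t = 4 * omega * (e\<^sup>2 + \<eta>) + (128 * omega + 2 * sigma_m (Suc k)) * (1 + \<eta> / e) * near_corner e t"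

definition defect :: "real \<Rightarrow> real \<Rightarrow> (real \<times> real) \<times> 'a \<Rightarrow> real" where
  "defect \<alpha> e z = L_eps (Suc k) S e (F_alpha \<alpha>) z - 1/2 * sigma_m (Suc k) * laplacian_M S (F_alpha \<alpha>) z"

text \<open>At most one corner is within \<open>e\<close>. A reflection, which changes \<open>\<alpha>\<close> into \<open>- \<alpha>\<close> and the sign of the wave,
  reduces the claim to points after the corner.\<close>
lemma defect_near_model:
  assumes e: "0 < e" "e \<le> 1/2" and y: "y \<in> S" and t: "0 \<le> t" "t < 4"
    and N: "near_power k omega \<eta> e (ball_volume y)" and \<eta>: "0 \<le> \<eta>" "\<eta> \<le> 1"
  shows "\<bar>\<bar>defect \<alpha> e (contour t, y)\<bar> - model \<alpha> e t\<bar> \<le> pointwise_error e \<eta> t"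
proof -
  \<comment> \<open>the corner nearest to \<open>t\<close>\<close>
  define c where "c = nat \<lfloor>t + 1/2\<rfloor>"
  define \<tau> where "\<tau> = t - real c"
  have c: "c \<le> 4" "\<bar>\<tau>\<bar> \<le> 1/2" "t = real c + \<tau>"
    using t unfolding c_def \<tau>_def by linarith+
  have far: "e \<le> \<bar>t - real c'\<bar>" if "c' \<noteq> c" for c' :: nat
  proof -
    have "1 \<le> \<bar>real c - real c'\<bar>" using that by linarith
    then show ?thesis using c e by linarith
  qed
  have single: "(\<Sum>c'\<le>4. f c') = f c" if "\<And>c'. c' \<noteq> c \<Longrightarrow> f c' = 0" for f :: "nat \<Rightarrow> real"
    using c(1) that by (subst sum.remove[of _ c]) auto
  define \<beta> where "\<beta> = \<alpha> - pi / 2 * real c"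
  define s where "s = \<bar>\<tau>\<bar>"
  have model: "model \<alpha> e t = (omega * (pi / 2) * \<bar>cos \<beta>\<bar> / e) * profile (\<tau> / e)"
    unfolding model_def \<beta>_def \<tau>_def
  proof (rule single)
    fix c' assume "c' \<noteq> c"
    from far[OF this] have "\<not> \<bar>(t - real c') / e\<bar> < 1" using e by (simp add: abs_divide)
    then show "omega * (pi / 2) * \<bar>cos (\<alpha> - pi / 2 * real c')\<bar> / e * profile ((t - real c') / e) = 0"
      by (simp add: profile_def)
  qed
  have nc: "near_corner e t = (if s < e then 1 else 0)"
  proof -
    have "near_corner e t = indicator {real c - e<..<real c + e} t"
      unfolding near_corner_def
    proof (rule single)
      fix c' assume "c' \<noteq> c"
      from far[OF this] show "indicator {real c' - e<..<real c' + e} t = (0::real)" by (auto simp: indicator_def)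
    qed
    then show ?thesis by (auto simp: s_def \<tau>_def indicator_def)
  qed
  define \<beta>' where "\<beta>' = (if \<tau> \<ge> 0 then \<beta> else - \<beta>)"
  let ?K = "corner_int \<beta>' (ball_volume y) e s"
  have defect: "defect \<alpha> e (contour t, y) = corner_int \<beta> (ball_volume y) e \<tau> / e ^ (k + 3) - pi\<^sup>2 / 8 * sigma_m (Suc k) * wave \<beta> \<tau>"
    unfolding defect_def laplacian_M_contour[OF smooth y] c(3) L_eps_corner_int[OF e c(2,1) y] wave_shift \<beta>_def[symmetric]
    by simp
  have abs_defect: "\<bar>defect \<alpha> e (contour t, y)\<bar> = \<bar>?K / e ^ (k + 3) - pi\<^sup>2 / 8 * sigma_m (Suc k) * wave \<beta>' s\<bar>"
  proof (cases "\<tau> \<ge> 0")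
    case True then show ?thesis unfolding defect by (simp add: \<beta>'_def s_def)
  next
    case False
    then have "\<tau> = - s" "\<beta>' = - \<beta>" by (auto simp: s_def \<beta>'_def)
    then show ?thesis unfolding defect by (simp add: corner_int_reflect wave_minus)
  qed
  have cosb: "cos \<beta>' = cos \<beta>" by (simp add: \<beta>'_def)
  have s: "0 \<le> s" "s \<le> 1/2" using c by (auto simp: s_def)
  have ek: "e ^ (k + 3) > 0" using e by simp
  note omegap = omega_pos
  show ?thesis
  proof (cases "s < e")
    case False
    then have "\<not> \<bar>\<tau> / e\<bar> < 1" using e by (simp add: s_def abs_divide)
    then have m0: "model \<alpha> e t = 0" unfolding model by (simp add: profile_def)
    have "\<bar>?K - pi\<^sup>2 / 8 * wave \<beta>' s * (e ^ (k + 3) * sigma_m (Suc k))\<bar> \<le> 4 * omega * e ^ (k + 3) * (e\<^sup>2 + \<eta>)"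
      using corner_int_flat[OF N omega_pos \<eta> e, of s \<beta>'] s False cap_second_moment[OF e(1), of k] by (simp add: omega_def)
    then have "\<bar>?K - pi\<^sup>2 / 8 * wave \<beta>' s * (e ^ (k + 3) * sigma_m (Suc k))\<bar> / e ^ (k + 3) \<le> 4 * omega * e ^ (k + 3) * (e\<^sup>2 + \<eta>) / e ^ (k + 3)"
      using ek by (intro divide_right_mono) auto
    also have "4 * omega * e ^ (k + 3) * (e\<^sup>2 + \<eta>) / e ^ (k + 3) = 4 * omega * (e\<^sup>2 + \<eta>)" using e by simp
    also have "\<bar>?K - pi\<^sup>2 / 8 * wave \<beta>' s * (e ^ (k + 3) * sigma_m (Suc k))\<bar> / e ^ (k + 3) =
      \<bar>(?K - pi\<^sup>2 / 8 * wave \<beta>' s * (e ^ (k + 3) * sigma_m (Suc k))) / e ^ (k + 3)\<bar>" using ek by (simp add: abs_divide)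
    also have "(?K - pi\<^sup>2 / 8 * wave \<beta>' s * (e ^ (k + 3) * sigma_m (Suc k))) / e ^ (k + 3) = ?K / e ^ (k + 3) - pi\<^sup>2 / 8 * sigma_m (Suc k) * wave \<beta>' s"
      using e by (simp add: diff_divide_distrib)
    finally show ?thesis unfolding m0 abs_defect pointwise_error_def nc using False by simp
  next
    case True
    have b: "profile (\<tau> / e) = \<bar>h_fun (Suc k) (s / e)\<bar>" using True e by (simp add: profile_def s_def abs_divide)
    let ?h = "h_fun (Suc k) (s / e)"
    have "\<bar>?K + pi / 2 * cos \<beta>' * omega * e ^ (k + 2) * ?h\<bar> \<le> 128 * omega * e ^ (k + 2) * (e + \<eta>)"
      by (rule corner_int_corner[OF N omega_pos \<eta> e s(1) True])
    then have "\<bar>?K + pi / 2 * cos \<beta>' * omega * e ^ (k + 2) * ?h\<bar> / e ^ (k + 3) \<le> 128 * omega * e ^ (k + 2) * (e + \<eta>) / e ^ (k + 3)"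
      using ek by (intro divide_right_mono) auto
    also have "128 * omega * e ^ (k + 2) * (e + \<eta>) / e ^ (k + 3) = 128 * omega * (1 + \<eta> / e)"
      using e by (simp add: power_add field_simps power2_eq_square power3_eq_cube)
    also have "\<bar>?K + pi / 2 * cos \<beta>' * omega * e ^ (k + 2) * ?h\<bar> / e ^ (k + 3) = \<bar>(?K + pi / 2 * cos \<beta>' * omega * e ^ (k + 2) * ?h) / e ^ (k + 3)\<bar>"
      using ek by (simp add: abs_divide)
    also have "(?K + pi / 2 * cos \<beta>' * omega * e ^ (k + 2) * ?h) / e ^ (k + 3) = ?K / e ^ (k + 3) + (omega * (pi / 2) * cos \<beta> / e) * ?h"
      using e by (simp add: cosb add_divide_distrib power_add power2_eq_square power3_eq_cube)
    finally have 1: "\<bar>?K / e ^ (k + 3) + (omega * (pi / 2) * cos \<beta> / e) * ?h\<bar> \<le> 128 * omega * (1 + \<eta> / e)" .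
    have 2: "\<bar>pi\<^sup>2 / 8 * sigma_m (Suc k) * wave \<beta>' s\<bar> \<le> 2 * sigma_m (Suc k) * (1 + \<eta> / e)"
    proof -
      have "\<bar>pi\<^sup>2 / 8 * sigma_m (Suc k) * wave \<beta>' s\<bar> = pi\<^sup>2 / 8 * sigma_m (Suc k) * \<bar>wave \<beta>' s\<bar>"
        using sigma_pos by (simp add: abs_mult)
      also have "\<dots> \<le> 2 * sigma_m (Suc k) * 1"
        using pi_sq_le sigma_pos abs_wave_le by (intro mult_mono) auto
      also have "\<dots> \<le> 2 * sigma_m (Suc k) * (1 + \<eta> / e)" using sigma_pos e \<eta> by (intro mult_left_mono) auto
      finally show ?thesis .
    qed
    have m: "model \<alpha> e t = \<bar>(omega * (pi / 2) * cos \<beta> / e) * ?h\<bar>"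
      unfolding model b using omegap e by (simp add: abs_mult)
    have "\<bar>\<bar>defect \<alpha> e (contour t, y)\<bar> - model \<alpha> e t\<bar> \<le> 128 * omega * (1 + \<eta> / e) + 2 * sigma_m (Suc k) * (1 + \<eta> / e)"
      unfolding abs_defect m using 1 2 by linarith
    also have "\<dots> = (128 * omega + 2 * sigma_m (Suc k)) * (1 + \<eta> / e)" by (simp add: algebra_simps)
    also have "\<dots> \<le> pointwise_error e \<eta> t" unfolding pointwise_error_def nc using True omegap \<eta> by simp
    finally show ?thesis .
  qed
qed

end

section \<open>Integration and limits\<close>

context corner_product begin

lemma integral_over_contour:
  assumes [measurable]: "g \<in> borel_measurable borel" and b: "\<And>t. \<bar>g t\<bar> \<le> C"
  shows "integrable volM (\<lambda>z. g (contour_inv (fst z)))"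
    and "(\<integral>z. g (contour_inv (fst z)) \<partial>volM) = measure vol S * (\<integral>t. indicator {0..<4} t * g t \<partial>lborel)"
proof -
  have m: "(\<lambda>z. g (contour_inv (fst z))) \<in> borel_measurable volM" by measurable
  show i: "integrable volM (\<lambda>z. g (contour_inv (fst z)))"
    by (rule volM.integrable_const_bound[of _ C]) (use m b in auto)
  have "(\<integral>z. g (contour_inv (fst z)) \<partial>volM) = (\<integral>x. (\<integral>y. g (contour_inv (fst (x, y))) \<partial>vol) \<partial>vol_M1)"
    using integral_fst'[OF i] by simp
  also have "\<dots> = (\<integral>x. measure vol S * g (contour_inv x) \<partial>vol_M1)" by simp
  also have "\<dots> = measure vol S * (\<integral>x. g (contour_inv x) \<partial>vol_M1)" by (rule Bochner_Integration.integral_mult_right_zero)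
  also have "(\<integral>x. g (contour_inv x) \<partial>vol_M1) = (LINT t:{0..<4}|lborel. g (contour_inv (contour t)))"
    by (rule integral_vol_M1) (intro measurable_restrict_space1, measurable)
  also have "\<dots> = (\<integral>t. indicator {0..<4} t * g t \<partial>lborel)"
    unfolding set_lebesgue_integral_def
    by (intro Bochner_Integration.integral_cong) (auto simp: indicator_def contour_inv_contour)
  finally show "(\<integral>z. g (contour_inv (fst z)) \<partial>volM) = measure vol S * (\<integral>t. indicator {0..<4} t * g t \<partial>lborel)" .
qed

definition limit_value :: "real \<Rightarrow> real" where
  "limit_value \<alpha> = 2 * pi * (\<bar>sin \<alpha>\<bar> + \<bar>cos \<alpha>\<bar>) * measure vol S * omega * profile_mass"

lemma model_measurable [measurable]: "model \<alpha> e \<in> borel_measurable borel"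
  unfolding model_def[abs_def] by measurable

lemma near_corner_measurable [measurable]: "near_corner e \<in> borel_measurable borel"
  unfolding near_corner_def[abs_def] by measurable

lemma pointwise_error_measurable [measurable]: "pointwise_error e \<eta> \<in> borel_measurable borel"
  unfolding pointwise_error_def[abs_def] by measurable

lemma profile_le_const: "profile v \<le> cap_int k / 2"
  using profile_le[of v] cap_int_pos[of k] by (cases "v \<in> {-1..1}") auto

lemma model_bounds:
  assumes "e > 0" shows "0 \<le> model \<alpha> e t" "model \<alpha> e t \<le> 5 * (omega * 2 / e * (cap_int k / 2))"
proof -
  have w: "omega \<ge> 0" using omega_pos by simp
  show "0 \<le> model \<alpha> e t" unfolding model_def
    using assms w profile_nonneg by (intro sum_nonneg mult_nonneg_nonneg divide_nonneg_pos) auto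
  have "model \<alpha> e t \<le> (\<Sum>c\<le>(4::nat). omega * 2 / e * (cap_int k / 2))"
    unfolding model_def
  proof (rule sum_mono)
    fix c :: nat
    have "(pi / 2) * \<bar>cos (\<alpha> - pi / 2 * real c)\<bar> \<le> 2 * 1" using pi_less_4 by (intro mult_mono) auto
    then have "omega * (pi / 2) * \<bar>cos (\<alpha> - pi / 2 * real c)\<bar> \<le> omega * 2" using w by (simp add: mult.assoc mult_left_mono)
    then have "omega * (pi / 2) * \<bar>cos (\<alpha> - pi / 2 * real c)\<bar> / e \<le> omega * 2 / e" using assms by (intro divide_right_mono) auto
    then show "omega * (pi / 2) * \<bar>cos (\<alpha> - pi / 2 * real c)\<bar> / e * profile ((t - real c) / e) \<le> omega * 2 / e * (cap_int k / 2)"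
      using assms w profile_nonneg profile_le_const by (intro mult_mono) auto
  qed
  then show "model \<alpha> e t \<le> 5 * (omega * 2 / e * (cap_int k / 2))" by simp
qed

lemma near_corner_bounds: "0 \<le> near_corner e t" "near_corner e t \<le> 5"
proof -
  show "0 \<le> near_corner e t" unfolding near_corner_def by (intro sum_nonneg) auto
  have "near_corner e t \<le> (\<Sum>c\<le>(4::nat). 1)" unfolding near_corner_def by (intro sum_mono) (auto simp: indicator_def)
  then show "near_corner e t \<le> 5" by simp
qed

text \<open>The factor \<open>1 / e\<close> cancels the width of the strips, so the integral does not depend on \<open>e\<close>.\<close>
lemma integral_model:
  assumes e: "0 < e" "e \<le> 1/2"
  shows "measure vol S * (\<integral>t. indicator {0..<4} t * model \<alpha> e t \<partial>lborel) = limit_value \<alpha>"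
proof -
  let ?a = "\<lambda>c::nat. omega * (pi / 2) * \<bar>cos (\<alpha> - pi / 2 * real c)\<bar> / e"
  have i: "integrable lborel (\<lambda>t. indicator {0..<4} t * profile ((t - real c) / e))" for c :: nat
  proof (rule integral_bounded_support(1)[of _ "cap_int k / 2" 0 4])
    show "\<bar>indicator {0..<4} t * profile ((t - real c) / e)\<bar> \<le> cap_int k / 2 * indicator {0..4} t" for t
      using profile_le_const[of "(t - real c) / e"] profile_nonneg[of "(t - real c) / e"] cap_int_pos[of k]
      by (auto simp: indicator_def)
  qed auto
  have "(\<integral>t. indicator {0..<4} t * model \<alpha> e t \<partial>lborel) = (\<integral>t. (\<Sum>c\<le>(4::nat). ?a c * (indicator {0..<4} t * profile ((t - real c) / e))) \<partial>lborel)"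
    unfolding model_def by (simp add: sum_distrib_left mult_ac)
  also have "\<dots> = (\<Sum>c\<le>(4::nat). ?a c * (\<integral>t. indicator {0..<4} t * profile ((t - real c) / e) \<partial>lborel))"
    by (subst Bochner_Integration.integral_sum) (use i in auto)
  also have "\<dots> = (\<Sum>c\<le>(4::nat). ?a c * ((if c = 0 \<or> c = 4 then 1 else 2) * e * profile_mass))"
    by (intro sum.cong refl) (simp add: profile_piece[OF e])
  also have "\<dots> = (\<Sum>c\<le>(4::nat). omega * (pi / 2) * profile_mass * ((if c = 0 \<or> c = 4 then 1 else 2) * \<bar>cos (\<alpha> - pi / 2 * real c)\<bar>))"
    using e by (intro sum.cong refl) auto
  also have "\<dots> = omega * (pi / 2) * profile_mass * (\<Sum>c\<le>(4::nat). (if c = 0 \<or> c = 4 then 1 else 2) * \<bar>cos (\<alpha> - pi / 2 * real c)\<bar>)"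
    by (simp only: sum_distrib_left)
  also have "(\<Sum>c\<le>(4::nat). (if c = 0 \<or> c = 4 then 1 else 2) * \<bar>cos (\<alpha> - pi / 2 * real c)\<bar>) = 4 * (\<bar>sin \<alpha>\<bar> + \<bar>cos \<alpha>\<bar>)"
  proof -
    have "{..4} = {0, 1, 2, 3, 4::nat}" by auto
    moreover have "cos (\<alpha> - pi / 2) = sin \<alpha>" by (simp add: cos_diff)
    moreover have "cos (\<alpha> - pi) = - cos \<alpha>" by (simp add: cos_diff)
    moreover have "cos (\<alpha> - pi / 2 * 3) = - sin \<alpha>"
    proof -
      have "\<alpha> - pi / 2 * 3 = (\<alpha> + pi / 2) - 2 * pi" by simp
      then show ?thesis by (simp only: cos_diff cos_add) simp
    qed
    moreover have "cos (\<alpha> - pi / 2 * 4) = cos \<alpha>" by (simp add: cos_diff)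
    ultimately show ?thesis by simp
  qed
  finally have eq: "(\<integral>t. indicator {0..<4} t * model \<alpha> e t \<partial>lborel) = omega * (pi / 2) * profile_mass * (4 * (\<bar>sin \<alpha>\<bar> + \<bar>cos \<alpha>\<bar>))" .
  show ?thesis unfolding eq limit_value_def by simp
qed

lemma integral_near_corner:
  assumes "e > 0" shows "(\<integral>t. indicator {0..<4} t * near_corner e t \<partial>lborel) \<le> 10 * e"
proof -
  have i: "integrable lborel (\<lambda>t. indicator {real c - e<..<real c + e} t :: real)" for c :: nat
    using assms by (simp add: integrable_indicator_iff)
  have "(\<integral>t. indicator {0..<4} t * near_corner e t \<partial>lborel) \<le> (\<integral>t. near_corner e t \<partial>lborel)"
  proof (rule integral_mono)
    show "integrable lborel (near_corner e)" unfolding near_corner_def[abs_def] by (intro Bochner_Integration.integrable_sum i)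
    then show "integrable lborel (\<lambda>t. indicator {0..<4} t * near_corner e t)"
      by (rule Bochner_Integration.integrable_bound) (auto simp: indicator_def)
  qed (use near_corner_bounds(1)[of e] in \<open>auto simp: indicator_def\<close>)
  also have "\<dots> = (\<Sum>c\<le>(4::nat). (\<integral>t. indicator {real c - e<..<real c + e} t \<partial>lborel))"
    unfolding near_corner_def by (rule Bochner_Integration.integral_sum) (rule i)
  also have "\<dots> = (\<Sum>c\<le>(4::nat). 2 * e)" using assms by (intro sum.cong refl) simp
  finally show ?thesis by simp
qed

definition error_bound :: "real \<Rightarrow> real \<Rightarrow> real" where
  "error_bound e \<eta> = measure vol S * (16 * omega * (e\<^sup>2 + \<eta>) + 10 * (128 * omega + 2 * sigma_m (Suc k)) * (e + \<eta>))"

lemma pointwise_error_nonneg: "e > 0 \<Longrightarrow> \<eta> \<ge> 0 \<Longrightarrow> 0 \<le> pointwise_error e \<eta> t"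
  unfolding pointwise_error_def using omega_pos sigma_pos near_corner_bounds(1)[of e t]
  by (intro add_nonneg_nonneg mult_nonneg_nonneg) auto

lemma pointwise_error_le: "e > 0 \<Longrightarrow> \<eta> \<ge> 0 \<Longrightarrow> pointwise_error e \<eta> t \<le> 4 * omega * (e\<^sup>2 + \<eta>) + (128 * omega + 2 * sigma_m (Suc k)) * (1 + \<eta> / e) * 5"
  unfolding pointwise_error_def using omega_pos sigma_pos near_corner_bounds(2)[of e t]
  by (intro add_left_mono mult_left_mono mult_nonneg_nonneg) auto

lemma integral_pointwise_error:
  assumes e: "e > 0" and \<eta>: "\<eta> \<ge> 0"
  shows "measure vol S * (\<integral>t. indicator {0..<4} t * pointwise_error e \<eta> t \<partial>lborel) \<le> error_bound e \<eta>"
proof -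
  let ?C = "(128 * omega + 2 * sigma_m (Suc k)) * (1 + \<eta> / e)"
  have C: "?C \<ge> 0" using omega_pos sigma_pos e \<eta> by simp
  have i1: "integrable lborel (\<lambda>t. indicator {0..<4::real} t * (4 * omega * (e\<^sup>2 + \<eta>)))"
    by (intro integrable_mult_left) (simp add: integrable_indicator_iff)
  have i2: "integrable lborel (\<lambda>t. indicator {0..<4} t * near_corner e t)"
    by (rule integral_bounded_support(1)[of _ 5 0 4])
      (use near_corner_bounds[of e] in \<open>auto simp: indicator_def\<close>)
  have "(\<integral>t. indicator {0..<4} t * pointwise_error e \<eta> t \<partial>lborel) =
     (\<integral>t. indicator {0..<4} t * (4 * omega * (e\<^sup>2 + \<eta>)) + ?C * (indicator {0..<4} t * near_corner e t) \<partial>lborel)"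
    unfolding pointwise_error_def by (simp add: algebra_simps)
  also have "\<dots> = (\<integral>t. indicator {0..<4::real} t * (4 * omega * (e\<^sup>2 + \<eta>)) \<partial>lborel) + ?C * (\<integral>t. indicator {0..<4} t * near_corner e t \<partial>lborel)"
    by (subst Bochner_Integration.integral_add) (use i1 i2 in auto)
  also have "\<dots> \<le> 16 * omega * (e\<^sup>2 + \<eta>) + ?C * (10 * e)"
    using integral_near_corner[OF e] C by (intro add_mono mult_left_mono) auto
  also have "\<dots> = 16 * omega * (e\<^sup>2 + \<eta>) + 10 * (128 * omega + 2 * sigma_m (Suc k)) * (e + \<eta>)"
    using e by (simp add: field_simps)
  finally show ?thesis unfolding error_bound_def by (intro mult_left_mono) auto
qed

lemma defect_measurable [measurable]: "defect \<alpha> e \<in> borel_measurable volM"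
proof -
  have "(\<lambda>z. L_eps (Suc k) S e (F_alpha \<alpha>) z - 1/2 * sigma_m (Suc k) * (pi\<^sup>2 / 4 * wave \<alpha> (contour_inv (fst z)))) \<in> borel_measurable volM"
    using L_eps_measurable by measurable
  also have "?this \<longleftrightarrow> defect \<alpha> e \<in> borel_measurable volM"
  proof (rule measurable_cong)
    fix z assume "z \<in> space volM"
    then obtain x y where z: "z = (x, y)" "x \<in> M1" "y \<in> S" by (auto simp: space_volM)
    have "laplacian_M S (F_alpha \<alpha>) z = pi\<^sup>2 / 4 * wave \<alpha> (contour_inv (fst z))"
      using laplacian_M_contour[OF smooth z(3), of \<alpha> "contour_inv x"] z by (simp add: contour_contour_inv)
    then show "L_eps (Suc k) S e (F_alpha \<alpha>) z - 1/2 * sigma_m (Suc k) * (pi\<^sup>2 / 4 * wave \<alpha> (contour_inv (fst z))) = defect \<alpha> e z"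
      by (simp add: defect_def)
  qed
  finally show ?thesis .
qed

lemma defect_bounded:
  assumes "e > 0"
  obtains C where "\<And>z. z \<in> space volM \<Longrightarrow> \<bar>defect \<alpha> e z\<bar> \<le> C"
proof -
  have "\<bar>defect \<alpha> e z\<bar> \<le> 1 / e ^ (k + 3) * (2 * measure volM (space volM)) + sigma_m (Suc k) * (pi\<^sup>2 / 8)"
    if zin: "z \<in> space volM" for z
  proof -
    obtain x y where z: "z = (x, y)" "x \<in> M1" "y \<in> S" using zin by (auto simp: space_volM)
    have l: "laplacian_M S (F_alpha \<alpha>) z = pi\<^sup>2 / 4 * wave \<alpha> (contour_inv x)"
      using laplacian_M_contour[OF smooth z(3), of \<alpha> "contour_inv x"] z by (simp add: contour_contour_inv)
    have "\<bar>1/2 * sigma_m (Suc k) * laplacian_M S (F_alpha \<alpha>) z\<bar> = sigma_m (Suc k) * (pi\<^sup>2 / 8) * \<bar>wave \<alpha> (contour_inv x)\<bar>"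
      unfolding l using sigma_pos by (simp add: abs_mult)
    also have "\<dots> \<le> sigma_m (Suc k) * (pi\<^sup>2 / 8) * 1"
      using sigma_pos by (intro mult_left_mono abs_wave_le) auto
    finally have "\<bar>1/2 * sigma_m (Suc k) * laplacian_M S (F_alpha \<alpha>) z\<bar> \<le> sigma_m (Suc k) * (pi\<^sup>2 / 8)" by simp
    moreover have "\<bar>L_eps (Suc k) S e (F_alpha \<alpha>) z\<bar> \<le> 1 / e ^ (k + 3) * (2 * measure volM (space volM))"
      using L_eps_bounded[of z e \<alpha>] zin assms by (simp add: space_volM)
    ultimately show ?thesis unfolding defect_def by linarith
  qed
  then show ?thesis using that by blast
qed

lemma defect_powr_integrable:
  assumes "e > 0" "p > 0" shows "integrable volM (\<lambda>z. \<bar>defect \<alpha> e z\<bar> powr p)"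
proof -
  obtain C where C: "\<And>z. z \<in> space volM \<Longrightarrow> \<bar>defect \<alpha> e z\<bar> \<le> C" using defect_bounded[OF assms(1)] by blast
  show ?thesis
    by (rule volM.integrable_const_bound[of _ "C powr p"]) (use C assms in \<open>auto intro!: AE_I2 powr_mono2\<close>)
qed

lemma defect_integrable:
  assumes "e > 0" shows "integrable volM (\<lambda>z. \<bar>defect \<alpha> e z\<bar>)"
  using defect_powr_integrable[OF assms zero_less_one] by simp

text \<open>For the second estimate, \<open>\<bar>x\<bar> powr p \<ge> K powr (p - 1) * (\<bar>x\<bar> - K)\<close> is used near the corners only; elsewhere the
  model vanishes and the lower bound is at most \<open>0\<close>.\<close>
lemma norm_estimates:
  assumes e: "0 < e" "e \<le> 1/2" and N: "\<And>y. y \<in> S \<Longrightarrow> near_power k omega \<eta> e (ball_volume y)" and \<eta>: "0 \<le> \<eta>" "\<eta> \<le> 1"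
  shows "\<bar>(\<integral>z. \<bar>defect \<alpha> e z\<bar> \<partial>volM) - limit_value \<alpha>\<bar> \<le> error_bound e \<eta>"
    and "p > 1 \<Longrightarrow> K > 0 \<Longrightarrow> (\<integral>z. \<bar>defect \<alpha> e z\<bar> powr p \<partial>volM) \<ge> K powr (p - 1) * (limit_value \<alpha> - error_bound e \<eta> - K * (measure vol S * (10 * e)))"
proof -
  let ?m = "\<lambda>z::(real \<times> real) \<times> 'a. model \<alpha> e (contour_inv (fst z))"
    and ?r = "\<lambda>z::(real \<times> real) \<times> 'a. pointwise_error e \<eta> (contour_inv (fst z))"
    and ?n = "\<lambda>z::(real \<times> real) \<times> 'a. near_corner e (contour_inv (fst z))"
  have pt: "\<bar>\<bar>defect \<alpha> e z\<bar> - ?m z\<bar> \<le> ?r z" if zin: "z \<in> space volM" for z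
  proof -
    obtain x y where z: "z = (x, y)" "x \<in> M1" "y \<in> S" using zin by (auto simp: space_volM)
    show ?thesis
      using defect_near_model[OF e z(3), of "contour_inv x" \<eta> \<alpha>] contour_inv_range[OF z(2)] N[OF z(3)] \<eta> z by (simp add: contour_contour_inv)
  qed
  have mb: "\<bar>model \<alpha> e t\<bar> \<le> 5 * (omega * 2 / e * (cap_int k / 2))" for t
    using model_bounds[OF e(1), of \<alpha> t] by simp
  have mi: "integrable volM ?m" "(\<integral>z. ?m z \<partial>volM) = limit_value \<alpha>"
    using integral_over_contour[OF model_measurable mb] integral_model[OF e, of \<alpha>] by simp_all
  have eb: "\<bar>pointwise_error e \<eta> t\<bar> \<le> 4 * omega * (e\<^sup>2 + \<eta>) + (128 * omega + 2 * sigma_m (Suc k)) * (1 + \<eta> / e) * 5" for t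
    using pointwise_error_nonneg[OF e(1) \<eta>(1), of t] pointwise_error_le[OF e(1) \<eta>(1), of t] by simp
  have ri: "integrable volM ?r" "(\<integral>z. ?r z \<partial>volM) \<le> error_bound e \<eta>"
    using integral_over_contour[OF pointwise_error_measurable eb] integral_pointwise_error[OF e(1) \<eta>(1)] by simp_all
  have ni: "integrable volM ?n" "(\<integral>z. ?n z \<partial>volM) \<le> measure vol S * (10 * e)"
    using integral_over_contour[of "near_corner e" 5] near_corner_bounds[of e] integral_near_corner[OF e(1)]
    by (auto simp: abs_of_nonneg intro!: mult_left_mono)
  note di = defect_integrable[OF e(1), of \<alpha>]
  have "\<bar>(\<integral>z. \<bar>defect \<alpha> e z\<bar> \<partial>volM) - limit_value \<alpha>\<bar> = \<bar>\<integral>z. \<bar>defect \<alpha> e z\<bar> - ?m z \<partial>volM\<bar>"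
    using mi di by simp
  also have "\<dots> \<le> (\<integral>z. \<bar>\<bar>defect \<alpha> e z\<bar> - ?m z\<bar> \<partial>volM)" by (rule integral_abs_bound)
  also have "\<dots> \<le> (\<integral>z. ?r z \<partial>volM)"
    using mi di ri pt by (intro integral_mono) auto
  finally show "\<bar>(\<integral>z. \<bar>defect \<alpha> e z\<bar> \<partial>volM) - limit_value \<alpha>\<bar> \<le> error_bound e \<eta>" using ri(2) by linarith
  assume p: "p > 1" and K: "K > 0"
  have "K powr (p - 1) * (limit_value \<alpha> - error_bound e \<eta> - K * (measure vol S * (10 * e))) \<le>
     K powr (p - 1) * ((\<integral>z. ?m z \<partial>volM) - (\<integral>z. ?r z \<partial>volM) - K * (\<integral>z. ?n z \<partial>volM))"
  proof (rule mult_left_mono)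
    have "K * (\<integral>z. ?n z \<partial>volM) \<le> K * (measure vol S * (10 * e))"
      using ni(2) K by (intro mult_left_mono) auto
    then show "limit_value \<alpha> - error_bound e \<eta> - K * (measure vol S * (10 * e)) \<le>
      (\<integral>z. ?m z \<partial>volM) - (\<integral>z. ?r z \<partial>volM) - K * (\<integral>z. ?n z \<partial>volM)"
      using mi(2) ri(2) by linarith
  qed simp
  also have "\<dots> = (\<integral>z. K powr (p - 1) * (?m z - ?r z - K * ?n z) \<partial>volM)"
    using mi ri ni by simp
  also have "\<dots> \<le> (\<integral>z. \<bar>defect \<alpha> e z\<bar> powr p \<partial>volM)"
  proof (rule integral_mono)
    show "integrable volM (\<lambda>z. K powr (p - 1) * (?m z - ?r z - K * ?n z))" using mi ri ni by simp
    show "integrable volM (\<lambda>z. \<bar>defect \<alpha> e z\<bar> powr p)" using defect_powr_integrable e p by simp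
    fix z assume z: "z \<in> space volM"
    have le: "?m z - ?r z \<le> \<bar>defect \<alpha> e z\<bar>" using pt[OF z] by linarith
    have n: "?n z \<ge> 0" using near_corner_bounds by simp
    show "K powr (p - 1) * (?m z - ?r z - K * ?n z) \<le> \<bar>defect \<alpha> e z\<bar> powr p"
    proof (cases "K \<le> \<bar>defect \<alpha> e z\<bar>")
      case True
      have "K powr (p - 1) * (?m z - ?r z - K * ?n z) \<le> K powr (p - 1) * \<bar>defect \<alpha> e z\<bar>"
        using le n K by (intro mult_left_mono) (auto intro: order_trans[of _ "?m z - ?r z"])
      also have "\<dots> \<le> \<bar>defect \<alpha> e z\<bar> powr (p - 1) * \<bar>defect \<alpha> e z\<bar>"
        using True K p by (intro mult_right_mono powr_mono2) auto
      also have "\<dots> = \<bar>defect \<alpha> e z\<bar> powr p" using True K powr_mult_base[of "\<bar>defect \<alpha> e z\<bar>" "p - 1"] by (simp add: mult.commute)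
      finally show ?thesis .
    next
      case False
      have "?m z - ?r z - K * ?n z \<le> 0"
      proof (cases "?n z \<ge> 1")
        case True
        then have "K * 1 \<le> K * ?n z" using K by (intro mult_left_mono) auto
        then show ?thesis using le False by linarith
      next
        case nc: False
        have "indicator {real c - e<..<real c + e} (contour_inv (fst z)) = (0::real)" if "c \<le> (4::nat)" for c
        proof (rule ccontr)
          assume "indicator {real c - e<..<real c + e} (contour_inv (fst z)) \<noteq> (0::real)"
          then have "(1::real) = indicator {real c - e<..<real c + e} (contour_inv (fst z))" by (simp add: indicator_def split: if_splits)
          also have "\<dots> \<le> ?n z" unfolding near_corner_def using that by (intro member_le_sum) auto
          finally show False using nc by simp
        qed
        then have far: "e \<le> \<bar>contour_inv (fst z) - real c\<bar>" if "c \<le> (4::nat)" for c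
          using that by (fastforce simp: indicator_def abs_le_iff not_less split: if_splits)
        have "?m z = 0" unfolding model_def
        proof (rule sum.neutral, rule ballI)
          fix c :: nat assume "c \<in> {..4}"
          then have "\<not> \<bar>(contour_inv (fst z) - real c) / e\<bar> < 1" using far[of c] e by (simp add: abs_divide)
          then show "omega * (pi / 2) * \<bar>cos (\<alpha> - pi / 2 * real c)\<bar> / e * profile ((contour_inv (fst z) - real c) / e) = 0"
            by (simp add: profile_def)
        qed
        moreover have "0 \<le> ?r z" using pointwise_error_nonneg e \<eta> by simp
        moreover have "0 \<le> K * ?n z" using K n by simp
        ultimately show ?thesis by linarith
      qed
      then have "K powr (p - 1) * (?m z - ?r z - K * ?n z) \<le> 0" by (simp add: mult_nonneg_nonpos)
      then show ?thesis by (meson order_trans powr_ge_zero)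
    qed
  qed
  finally show "K powr (p - 1) * (limit_value \<alpha> - error_bound e \<eta> - K * (measure vol S * (10 * e))) \<le> (\<integral>z. \<bar>defect \<alpha> e z\<bar> powr p \<partial>volM)" .
qed

lemma limit_value_pos: "limit_value \<alpha> > 0"
proof -
  have "\<bar>sin \<alpha>\<bar> + \<bar>cos \<alpha>\<bar> > 0"
    using sin_cos_squared_add[of \<alpha>] by (cases "sin \<alpha> = 0") auto
  moreover have "measure vol S > 0" unfolding vol_def by (rule riemannian_volume_pos[OF compact smooth nonempty])
  ultimately show ?thesis unfolding limit_value_def using omega_pos profile_mass_pos by (intro mult_pos_pos) auto
qed

text \<open>First \<open>\<eta>\<close> is fixed, then \<open>e\<close> is taken so small that the balls of radius \<open>e\<close> in \<open>S\<close> have relative error \<open>\<eta>\<close>.\<close>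
lemma eventually_error_small:
  assumes "\<delta> > 0"
  shows "eventually (\<lambda>e. e > 0 \<and> e \<le> 1/2 \<and> e < \<delta> \<and> (\<exists>\<eta>. 0 \<le> \<eta> \<and> \<eta> \<le> 1 \<and> error_bound e \<eta> < \<delta> \<and>
     (\<forall>y\<in>S. near_power k omega \<eta> e (ball_volume y)))) (at_right 0)"
proof -
  define C where "C = measure vol S * (16 * omega + 10 * (128 * omega + 2 * sigma_m (Suc k)))"
  have C: "C \<ge> 0" unfolding C_def using omega_pos sigma_pos by (intro mult_nonneg_nonneg) auto
  have eb: "error_bound e \<eta> \<le> C * (e + \<eta>)" if "0 < e" "e \<le> 1/2" "0 \<le> \<eta>" for e \<eta>
  proof -
    have "e\<^sup>2 \<le> e" using that by (simp add: power2_eq_square mult_le_cancel_left1)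
    then have "16 * omega * (e\<^sup>2 + \<eta>) \<le> 16 * omega * (e + \<eta>)" using omega_pos by (intro mult_left_mono) auto
    then have "16 * omega * (e\<^sup>2 + \<eta>) + 10 * (128 * omega + 2 * sigma_m (Suc k)) * (e + \<eta>)
      \<le> 16 * omega * (e + \<eta>) + 10 * (128 * omega + 2 * sigma_m (Suc k)) * (e + \<eta>)" by (rule add_right_mono)
    then have "error_bound e \<eta> \<le> measure vol S * (16 * omega * (e + \<eta>) + 10 * (128 * omega + 2 * sigma_m (Suc k)) * (e + \<eta>))"
      unfolding error_bound_def by (rule mult_left_mono) simp
    also have "\<dots> = C * (e + \<eta>)" unfolding C_def by (simp add: algebra_simps)
    finally show ?thesis .
  qed
  define \<eta> where "\<eta> = min 1 (\<delta> / (4 * (C + 1)))"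
  have \<eta>: "0 < \<eta>" "\<eta> \<le> 1" "\<eta> \<le> \<delta> / (4 * (C + 1))" using assms C by (auto simp: \<eta>_def)
  obtain \<rho> where \<rho>: "\<rho> > 0" "\<And>y e. y \<in> S \<Longrightarrow> e < \<rho> \<Longrightarrow> near_power k omega \<eta> e (ball_volume y)"
    using near_power_ball_volume[OF \<eta>(1)] unfolding omega_def by metis
  define e0 where "e0 = min (min (1/2) \<rho>) (min \<delta> \<eta>)"
  have e0: "e0 > 0" using \<rho> \<eta> assms by (simp add: e0_def)
  have "eventually (\<lambda>e. e \<in> {0<..<e0}) (at_right 0)" by (rule eventually_at_right_real[OF e0])
  then show ?thesis
  proof eventually_elim
    case (elim e)
    then have e: "0 < e" "e \<le> 1/2" "e < \<rho>" "e < \<delta>" "e \<le> \<eta>" by (auto simp: e0_def)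
    have "error_bound e \<eta> \<le> C * (e + \<eta>)" using e \<eta> by (intro eb) auto
    also have "\<dots> \<le> C * (\<eta> + \<eta>)" using C e by (intro mult_left_mono) auto
    also have "\<dots> \<le> (C + 1) * (2 * \<eta>)" using \<eta> C by (simp add: algebra_simps)
    also have "\<dots> \<le> (C + 1) * (2 * (\<delta> / (4 * (C + 1))))" using \<eta>(3) C by (intro mult_left_mono) auto
    also have "\<dots> = \<delta> / 2"
    proof -
      have "D * (2 * (\<delta> / (4 * D))) = \<delta> / 2" if "D > 0" for D :: real using that by simp
      moreover have "C + 1 > 0" using C by simp
      ultimately show ?thesis by blast
    qed
    also have "\<dots> < \<delta>" using assms by simp
    finally have "error_bound e \<eta> < \<delta>" .
    moreover have "\<forall>y\<in>S. near_power k omega \<eta> e (ball_volume y)" using \<rho>(2) e by blast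
    ultimately show ?case using e \<eta> by (intro conjI exI[of _ \<eta>]) auto
  qed
qed

lemma L1_limit: "((\<lambda>e. \<integral>z. \<bar>defect \<alpha> e z\<bar> \<partial>volM) \<longlongrightarrow> limit_value \<alpha>) (at_right 0)"
proof (rule tendstoI)
  fix \<delta> :: real assume "\<delta> > 0"
  from eventually_error_small[OF this]
  show "eventually (\<lambda>e. dist (\<integral>z. \<bar>defect \<alpha> e z\<bar> \<partial>volM) (limit_value \<alpha>) < \<delta>) (at_right 0)"
  proof eventually_elim
    case (elim e)
    then obtain \<eta> where "0 \<le> \<eta>" "\<eta> \<le> 1" "error_bound e \<eta> < \<delta>" "\<And>y. y \<in> S \<Longrightarrow> near_power k omega \<eta> e (ball_volume y)" by blast
    then show ?case using norm_estimates(1)[of e \<eta> \<alpha>] elim by (auto simp: dist_real_def)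
  qed
qed

lemma Lp_limit:
  assumes p: "p > 1"
  shows "filterlim (\<lambda>e. \<integral>z. \<bar>defect \<alpha> e z\<bar> powr p \<partial>volM) at_top (at_right 0)"
  unfolding filterlim_at_top
proof
  fix Z :: real
  \<comment> \<open>Chosen such that a quarter of the limit value, times \<open>K powr (p - 1)\<close>, is at least \<open>Z\<close>.\<close>
  define K where "K = (max 1 (4 * \<bar>Z\<bar> / limit_value \<alpha>)) powr (1 / (p - 1))"
  have K: "K > 0" unfolding K_def by simp
  have KZ: "\<bar>Z\<bar> \<le> K powr (p - 1) * (limit_value \<alpha> / 4)"
  proof -
    have "K powr (p - 1) = max 1 (4 * \<bar>Z\<bar> / limit_value \<alpha>)" using p by (simp add: K_def powr_powr)
    then have "4 * \<bar>Z\<bar> / limit_value \<alpha> \<le> K powr (p - 1)" by simp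
    then show ?thesis using limit_value_pos[of \<alpha>] by (simp add: field_simps)
  qed
  define V where "V = measure vol S"
  have V: "V \<ge> 0" by (simp add: V_def)
  define \<delta> where "\<delta> = min (limit_value \<alpha> / 4) (limit_value \<alpha> / (4 * (10 * K * V + 1)))"
  have \<delta>: "\<delta> > 0" using limit_value_pos[of \<alpha>] K V by (auto simp: \<delta>_def intro!: divide_pos_pos add_nonneg_pos)
  from eventually_error_small[OF \<delta>]
  show "eventually (\<lambda>e. Z \<le> (\<integral>z. \<bar>defect \<alpha> e z\<bar> powr p \<partial>volM)) (at_right 0)"
  proof eventually_elim
    case (elim e)
    then obtain \<eta> where \<eta>: "0 \<le> \<eta>" "\<eta> \<le> 1" "error_bound e \<eta> < \<delta>" "\<And>y. y \<in> S \<Longrightarrow> near_power k omega \<eta> e (ball_volume y)" by blast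
    have "K * (V * (10 * e)) = 10 * K * V * e" by simp
    also have "\<dots> \<le> (10 * K * V + 1) * e" using elim by (simp add: algebra_simps)
    also have "\<dots> \<le> (10 * K * V + 1) * (limit_value \<alpha> / (4 * (10 * K * V + 1)))"
      using elim K V by (intro mult_left_mono) (auto simp: \<delta>_def)
    also have "\<dots> = limit_value \<alpha> / 4"
    proof -
      have "10 * K * V + 1 > 0" using K V by (intro add_nonneg_pos) auto
      moreover have "D * (T / (4 * D)) = T / 4" if "D > 0" for D T :: real using that by simp
      ultimately show ?thesis by blast
    qed
    finally have 1: "K * (V * (10 * e)) \<le> limit_value \<alpha> / 4" .
    have 2: "error_bound e \<eta> \<le> limit_value \<alpha> / 4" using \<eta>(3) by (simp add: \<delta>_def)
    have "Z \<le> K powr (p - 1) * (limit_value \<alpha> / 4)" using KZ by linarith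
    also have "\<dots> \<le> K powr (p - 1) * (limit_value \<alpha> - error_bound e \<eta> - K * (V * (10 * e)))"
      using 1 2 limit_value_pos[of \<alpha>] by (intro mult_left_mono) auto
    also have "\<dots> \<le> (\<integral>z. \<bar>defect \<alpha> e z\<bar> powr p \<partial>volM)"
      using norm_estimates(2)[of e \<eta> p K \<alpha>] elim \<eta> p K by (auto simp: V_def)
    finally show ?case .
  qed
qed

end

theorem propositionG1:
  fixes m d :: nat and V M2 :: "'a::euclidean_space set" and \<alpha> :: real
  assumes "0 < m" and "m < d"
    and "subspace V" and "dim V = d - 2"
    and "M2 \<subseteq> V" and "closed_submanifold (m - 1) M2"
  shows "(\<forall>p>1. filterlim
           (\<lambda>\<epsilon>. \<integral>z. \<bar>L_eps m M2 \<epsilon> (F_alpha \<alpha>) z - 1/2 * sigma_m m * laplacian_M M2 (F_alpha \<alpha>) z\<bar> powr p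
                  \<partial>vol_M m M2)
           at_top (at_right 0)) \<and>
         ((\<lambda>\<epsilon>. \<integral>z. \<bar>L_eps m M2 \<epsilon> (F_alpha \<alpha>) z - 1/2 * sigma_m m * laplacian_M M2 (F_alpha \<alpha>) z\<bar>
                  \<partial>vol_M m M2)
           \<longlongrightarrow> 2 * pi * (\<bar>sin \<alpha>\<bar> + \<bar>cos \<alpha>\<bar>) * measure (riemannian_volume (m - 1) M2) M2
                * unit_ball_vol (real (m - 1)) * integral {0..1} (\<lambda>t. \<bar>h_fun m t\<bar>)) (at_right 0) \<and>
         2 * pi * (\<bar>sin \<alpha>\<bar> + \<bar>cos \<alpha>\<bar>) * measure (riemannian_volume (m - 1) M2) M2
                * unit_ball_vol (real (m - 1)) * integral {0..1} (\<lambda>t. \<bar>h_fun m t\<bar>) \<noteq> 0 \<and>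
         \<not> h_fun m constant_on {0..1}"
proof -
  obtain k where m: "m = Suc k" using assms(1) gr0_implies_Suc by blast
  interpret corner_product k M2
    using assms(6) by unfold_locales (simp_all add: closed_submanifold_def m)
  have limit_value: "2 * pi * (\<bar>sin \<alpha>\<bar> + \<bar>cos \<alpha>\<bar>) * measure (riemannian_volume (m - 1) M2) M2
       * unit_ball_vol (real (m - 1)) * integral {0..1} (\<lambda>t. \<bar>h_fun m t\<bar>) = limit_value \<alpha>"
    by (simp add: m limit_value_def vol_def omega_def profile_mass_def)
  show ?thesis
    unfolding limit_value
    using Lp_limit[of _ \<alpha>] L1_limit[of \<alpha>] limit_value_pos[of \<alpha>] h_fun_not_constant
    by (simp add: m defect_def volM_eq del: One_nat_def)
qed

end
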